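(* (1) The assignment $K_i\mapsto\mathcal K_i$, $E_h\mapsto\mathcal E_h$, $F_h\mapsto\mathcal F_h$, $K_{\bar i}\mapsto\mathcal K_{\bar i}$, $E_{\bar h}\mapsto\mathcal E_{\bar h}$, $F_{\bar h}\mapsto\mathcal F_{\bar h}$ ($1\le i\le n$, $1\le h\le n-1$) defines an algebra homomorphism $\rho:U_\upsilon(\mathfrak q_n)\to \mathrm{End}_{\mathbb Q(\upsilon)}(\mathscr A_\upsilon(n))$. In other words, $\mathscr A_\upsilon(n)$ is a $U_\upsilon(\mathfrak q_n)$-module with the following action, for all $\mathbf a\in\mathbb N^n\times\{0,1\}^n$, $1\le i\le n$, $1\le h\le n-1$: $$K_i.X^{\mathbf a}=\upsilon^{a_i+a_{\bar i}}X^{\mathbf a},$$ $$E_h.X^{\mathbf a}=\upsilon^{a_{\overline{h+1}}}[a_{h+1}]X^{\mathbf a+\mathbf e_h-\mathbf e_{h+1}}+\upsilon^{-a_{h+1}}[a_{\overline{h+1}}]X^{\mathbf a+\mathbf e_{\bar h}-\mathbf e_{\overline{h+1}}},$$ $$F_h.X^{\mathbf a}=\upsilon^{-a_{\bar h}}[a_h]X^{\mathbf a-\mathbf e_h+\mathbf e_{h+1}}+\upsilon^{a_h}[a_{\bar h}]X^{\mathbf a-\mathbf e_{\bar h}+\mathbf e_{\overline{h+1}}},$$ $$K_{\bar i}.X^{\mathbf a}=(-1)^{\sum_{1\le j<i}a_{\bar j}}\big(\upsilon^{-a_i}[a_{\bar i}]X^{\mathbf a+\mathbf e_i-\mathbf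 e_{\bar i}}+\upsilon^{a_{\bar i}}[a_i]X^{\mathbf a+\mathbf e_{\bar i}-\mathbf e_i}\big),$$ $$E_{\bar h}.X^{\mathbf a}=(-1)^{\sum_{1\le j\le h}a_{\bar j}}\big(\upsilon^{a_{\overline{h+1}}}[a_{h+1}]X^{\mathbf a+\mathbf e_{\bar h}-\mathbf e_{h+1}}+\upsilon^{-a_{h+1}}[a_{\overline{h+1}}]X^{\mathbf a+\mathbf e_h-\mathbf e_{\overline{h+1}}}\big),$$ $$F_{\bar h}.X^{\mathbf a}=(-1)^{\sum_{1\le j\le h}a_{\bar j}}\upsilon^{-a_{\bar h}}[a_h]X^{\mathbf a-\mathbf e_h+\mathbf e_{\overline{h+1}}}+(-1)^{\sum_{1\le j<h}a_{\bar j}}\upsilon^{a_h}[a_{\bar h}]X^{\mathbf a-\mathbf e_{\bar h}+\mathbf e_{h+1}}.$$ (2) $\mathscr A_\upsilon(n)$ is a weight $U_\upsilon(\mathfrak q_n)$-supermodule, and each homogeneous component $\mathscr A_\upsilon(n,r)$, $r\in\mathbb N$, is a $U_\upsilon(\mathfrak q_n)$-subsupermodule.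
   Context: Let $n\ge 2$, let $\upsilon$ be an indeterminate, $[c]=\frac{\upsilon^c-\upsilon^{-c}}{\upsilon-\upsilon^{-1}}$. $U=U_\upsilon(\mathfrak q_n)$ denotes the unital associative $\mathbb Q(\upsilon)$-superalgebra with even generators $K_i^{\pm1},E_j,F_j$ and odd generators $K_{\bar i},E_{\bar j},F_{\bar j}$ ($1\le i\le n$, $1\le j\le n-1$) and relations (indices in all admissible ranges): (QQ1) $K_iK_i^{-1}=K_i^{-1}K_i=1$, $K_iK_j=K_jK_i$, $K_iK_{\bar j}=K_{\bar j}K_i$, $K_{\bar i}K_{\bar j}+K_{\bar j}K_{\bar i}=2\delta_{ij}\frac{K_i^2-K_i^{-2}}{\upsilon^2-\upsilon^{-2}}$; (QQ2) $K_iE_j=\upsilon^{\delta_{i,j}-\delta_{i,j+1}}E_jK_i$, $K_iF_j=\upsilon^{-(\delta_{i,j}-\delta_{i,j+1})}F_jK_i$, and the same two relations with $E_j,F_j$ replaced by $E_{\bar j},F_{\bar j}$; (QQ3) $K_{\bar i}E_j=E_jK_{\bar i}$, $K_{\bar i}F_j=F_jK_{\bar i}$ for $i\ne j,j+1$; $K_{\bar j}E_j-\upsilon E_jK_{\bar j}=E_{\bar j}K_j^{-1}$, $\upsilon K_{\overline{j+1}}E_j-E_jK_{\overline{j+1}}=-K_{j+1}^{-1}E_{\bar j}$, $K_{\bar j}F_j-\upsilon F_jK_{\bar j}=-F_{\bar j}K_j$, $\upsilon K_{\overline{j+1}}F_j-F_jK_{\overline{j+1}}=K_{j+1}F_{\bar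 j}$; (QQ4) $E_iF_j-F_jE_i=\delta_{ij}\frac{K_iK_{i+1}^{-1}-K_i^{-1}K_{i+1}}{\upsilon-\upsilon^{-1}}$, $E_iF_{\bar j}-F_{\bar j}E_i=\delta_{ij}(K_{i+1}^{-1}K_{\bar i}-K_{\overline{i+1}}K_i^{-1})$, $E_{\bar i}F_j-F_jE_{\bar i}=\delta_{ij}(K_{i+1}K_{\bar i}-K_{\overline{i+1}}K_i)$; (QQ5) $E_iE_j=E_jE_i$, $F_iF_j=F_jF_i$ for $|i-j|>1$; $E_iE_{\bar i}=E_{\bar i}E_i$, $F_iF_{\bar i}=F_{\bar i}F_i$; $E_iE_{i+1}-\upsilon E_{i+1}E_i=E_{\bar i}E_{\overline{i+1}}+\upsilon E_{\overline{i+1}}E_{\bar i}$, $\upsilon F_{i+1}F_i-F_iF_{i+1}=F_{\bar i}F_{\overline{i+1}}+\upsilon F_{\overline{i+1}}F_{\bar i}$; (QQ6) for $|i-j|=1$: $E_i^2Z-(\upsilon+\upsilon^{-1})E_iZE_i+ZE_i^2=0$ for $Z\in\{E_j,E_{\bar j}\}$ and $F_i^2Z-(\upsilon+\upsilon^{-1})F_iZF_i+ZF_i^2=0$ for $Z\in\{F_j,F_{\bar j}\}$. $\mathscr A_\upsilon(n)$ is the $\mathbb Q(\upsilon)$-superalgebra with even generators $X_1,\dots,X_n$, odd generators $X_{\bar1},\dots,X_{\bar n}$ and relations $X_iX_j=X_jX_i$, $X_iX_{\bar j}=X_{\bar j}X_i$, $X_{\bar i}X_{\bar j}=-X_{\bar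 j}X_{\bar i}$ ($i\ne j$), $X_{\bar i}^2=\frac{\upsilon-\upsilon^{-1}}{\upsilon+\upsilon^{-1}}X_i^2$. For $\mathbf a=(a_1,\dots,a_n,a_{\bar1},\dots,a_{\bar n})\in\mathbb N^{2n}$, $X^{\mathbf a}=X_1^{a_1}\cdots X_n^{a_n}X_{\bar1}^{a_{\bar1}}\cdots X_{\bar n}^{a_{\bar n}}$; the $X^{\mathbf a}$ with $\mathbf a\in\mathbb N^n\times\{0,1\}^n$ form a basis. $\mathbf e_1,\dots,\mathbf e_n,\mathbf e_{\bar1},\dots,\mathbf e_{\bar n}$ is the standard basis of $\mathbb Z^{2n}$. $\mathscr A_\upsilon(n,r)$ is the span of the basis elements $X^{\mathbf a}$ with $\sum_i(a_i+a_{\bar i})=r$; the parity of $X^{\mathbf a}$ is $\sum_ia_{\bar i}$ mod 2. Terms with coefficient $[0]=0$ are read as $0$; an exponent $2$ of $X_{\bar i}$ is evaluated in $\mathscr A_\upsilon(n)$. Linear operators on $\mathscr A_\upsilon(n)$, defined on basis elements $X^{\mathbf a}$, $\mathbf a\in \mathbb N^n\times\{0,1\}^n$, for $1\le i\le n$: $\partial_i(X^{\mathbf a})=[a_i]X^{\mathbf a-\mathbf e_i}$; $\partial_{\bar i}(X^{\mathbf a})=(-1)^{\sum_{1\le j<i}a_{\bar j}}[a_{\bar i}]X^{\mathbf a-\mathbf e_{\bar i}}$; $\chi_i,\chi_{\bar i}$ are left multiplication by $X_i$, $X_{\bar i}$; $\delta_i^{\pm1}(X^{\mathbf a})=\upsilon^{\pm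 a_i}X^{\mathbf a}$, $\delta_{\bar i}^{\pm1}(X^{\mathbf a})=\upsilon^{\pm a_{\bar i}}X^{\mathbf a}$; $s_{\bar i}(X^{\mathbf a})=(-1)^{a_{\bar i}}X^{\mathbf a}$. Then (products being compositions) $\mathcal K_i=\delta_i\delta_{\bar i}$, $\mathcal E_h=\chi_h\partial_{h+1}\delta_{\overline{h+1}}+\chi_{\bar h}\partial_{\overline{h+1}}\delta_{h+1}^{-1}s_{\bar h}$, $\mathcal F_h=\chi_{h+1}\partial_h\delta_{\bar h}^{-1}+\chi_{\overline{h+1}}\partial_{\bar h}\delta_h$, $\mathcal K_{\bar i}=\chi_i\partial_{\bar i}\delta_i^{-1}+\chi_{\bar i}\partial_i\delta_{\bar i}$, $\mathcal E_{\bar h}=\chi_{\bar h}\partial_{h+1}\delta_{\overline{h+1}}s_{\bar h}+\chi_h\partial_{\overline{h+1}}\delta_{h+1}^{-1}$, $\mathcal F_{\bar h}=\chi_{\overline{h+1}}\partial_h\delta_{\bar h}^{-1}+\chi_{h+1}\partial_{\bar h}\delta_h$. A $U$-supermodule $M$ is a weight supermodule if $M=\bigoplus_{\lambda\in\mathbb Z^n}M_\lambda$ with $M_\lambda=\{m\in M\mid K_i.m=\upsilon^{\lambda_i}m\ \forall\,1\le i\le n\}$. *)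

theory Defs
  imports
    "HOL-Algebra.Algebraic_Closure_Type"
    "HOL-Algebra.Module"
    "HOL-Computational_Algebra.Fraction_Field"
    "HOL-Computational_Algebra.Polynomial"
    "HOL-Library.Poly_Mapping"
    "HOL-Library.Z2"
begin

type_synonym qv = "rat poly fract"

definition ups :: qv (\<open>\<upsilon>\<close>) where
  "\<upsilon> = Fract [:0, 1:] 1"

definition qint :: "int \<Rightarrow> qv" where
  "qint c = (\<upsilon> powi c - \<upsilon> powi (- c)) / (\<upsilon> - inverse \<upsilon>)"

abbreviation QV :: "qv ring" where
  "QV \<equiv> ring_of_type_algebra"

definition lin_span :: "('k, 'c) ring_scheme \<Rightarrow> ('k, 'm, 'd) module_scheme \<Rightarrow> 'm set \<Rightarrow> 'm set" where
  "lin_span R M S = \<Inter> {N. submodule N R M \<and> S \<subseteq> N}"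

text \<open>\<open>N\<close> is the internal direct sum of the submodules \<open>V i\<close>: summation is a bijection from the
  external direct sum (families of finite support) onto \<open>N\<close>.\<close>

definition direct_sum ::
  "('k, 'c) ring_scheme \<Rightarrow> ('k, 'm, 'd) module_scheme \<Rightarrow> 'm set \<Rightarrow> 'i set \<Rightarrow> ('i \<Rightarrow> 'm set) \<Rightarrow> bool" where
  "direct_sum R M N I V \<longleftrightarrow>
     (\<forall>i\<in>I. submodule (V i) R M) \<and>
     bij_betw (\<lambda>f. \<Oplus>\<^bsub>M\<^esub>i\<in>{i\<in>I. f i \<noteq> \<zero>\<^bsub>M\<^esub>}. f i)
       {f \<in> \<Pi>\<^sub>E i\<in>I. V i. finite {i\<in>I. f i \<noteq> \<zero>\<^bsub>M\<^esub>}} N"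

text \<open>The library's locale \<open>algebra\<close> covers commutative algebras only, so associative algebras are
  used here simply as \<^type>\<open>module\<close> records.\<close>

definition algebra_hom ::
  "('k, 'c) ring_scheme \<Rightarrow> ('k, 'a, 'd) module_scheme \<Rightarrow> ('k, 'b, 'e) module_scheme \<Rightarrow> ('a \<Rightarrow> 'b) set" where
  "algebra_hom R A B =
     {f \<in> ring_hom A B. \<forall>c\<in>carrier R. \<forall>x\<in>carrier A. f (c \<odot>\<^bsub>A\<^esub> x) = c \<odot>\<^bsub>B\<^esub> f x}"

definition End_alg ::
  "('k, 'c) ring_scheme \<Rightarrow> ('k, 'm, 'd) module_scheme \<Rightarrow> ('k, 'm \<Rightarrow> 'm) module" where
  "End_alg R M =
     \<lparr>carrier = {f \<in> carrier M \<rightarrow>\<^sub>E carrier M.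
        (\<forall>x\<in>carrier M. \<forall>y\<in>carrier M. f (x \<oplus>\<^bsub>M\<^esub> y) = f x \<oplus>\<^bsub>M\<^esub> f y) \<and>
        (\<forall>c\<in>carrier R. \<forall>x\<in>carrier M. f (c \<odot>\<^bsub>M\<^esub> x) = c \<odot>\<^bsub>M\<^esub> f x)},
      monoid.mult = (\<lambda>f g. compose (carrier M) f g),
      one = (\<lambda>x\<in>carrier M. x),
      zero = (\<lambda>x\<in>carrier M. \<zero>\<^bsub>M\<^esub>),
      add = (\<lambda>f g. \<lambda>x\<in>carrier M. f x \<oplus>\<^bsub>M\<^esub> g x),
      module.smult = (\<lambda>c f. \<lambda>x\<in>carrier M. c \<odot>\<^bsub>M\<^esub> f x)\<rparr>"

text \<open>The free monoid. It is a copy of the type of lists in order to be an instance of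
  \<^class>\<open>monoid_add\<close>; finitely supported functions on it then form the free algebra, with
  the convolution product of \<^theory>\<open>HOL-Library.Poly_Mapping\<close>.\<close>

datatype 'a fmon = Wd (letters: "'a list")

instantiation fmon :: (type) monoid_add
begin

definition zero_fmon :: "'a fmon" where
  "0 = Wd []"

definition plus_fmon :: "'a fmon \<Rightarrow> 'a fmon \<Rightarrow> 'a fmon" where
  "u + w = Wd (letters u @ letters w)"

instance
  by standard (simp_all add: zero_fmon_def plus_fmon_def)

end

type_synonym 'a falg = "'a fmon \<Rightarrow>\<^sub>0 qv"

definition gen :: "'g \<Rightarrow> 'g falg" where
  "gen g = Poly_Mapping.single (Wd [g]) 1"

definition scal :: "qv \<Rightarrow> 'g falg" where
  "scal c = Poly_Mapping.single 0 c"

definition free_alg :: "'g set \<Rightarrow> (qv, 'g falg) module" where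
  "free_alg G =
     \<lparr>carrier = {f. \<forall>w\<in>Poly_Mapping.keys f. set (letters w) \<subseteq> G},
      monoid.mult = (*), one = 1, zero = 0, add = (+), module.smult = (\<lambda>c f. scal c * f)\<rparr>"

text \<open>A relation \<open>l = r\<close> is the pair \<open>(l, r)\<close>.\<close>

definition rel_ideal :: "'g set \<Rightarrow> ('g falg \<times> 'g falg) set \<Rightarrow> 'g falg set" where
  "rel_ideal G Rel = Idl\<^bsub>free_alg G\<^esub> {l - r | l r. (l, r) \<in> Rel}"

definition presented :: "'g set \<Rightarrow> ('g falg \<times> 'g falg) set \<Rightarrow> (qv, 'g falg set) module" where
  "presented G Rel = (let F = free_alg G; I = rel_ideal G Rel; Q = F Quot I in
     \<lparr>carrier = carrier Q, monoid.mult = monoid.mult Q, one = one Q, zero = zero Q, add = add Q,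
      module.smult = (\<lambda>c Y. \<Union>x\<in>Y. I +>\<^bsub>F\<^esub> (c \<odot>\<^bsub>F\<^esub> x))\<rparr>)"

definition cls :: "'g set \<Rightarrow> ('g falg \<times> 'g falg) set \<Rightarrow> 'g falg \<Rightarrow> 'g falg set" where
  "cls G Rel x = rel_ideal G Rel +>\<^bsub>free_alg G\<^esub> x"

text \<open>Parities live in \<^typ>\<open>bit\<close>, the integers modulo 2, and \<open>par\<close> is the parity of the generators.\<close>

definition presented_part ::
  "'g set \<Rightarrow> ('g falg \<times> 'g falg) set \<Rightarrow> ('g \<Rightarrow> bit) \<Rightarrow> bit \<Rightarrow> 'g falg set set" where
  "presented_part G Rel par p = lin_span QV (presented G Rel)
     {cls G Rel (Poly_Mapping.single (Wd gs) 1) | gs. set gs \<subseteq> G \<and> sum_list (map par gs) = p}"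

text \<open>A module over an associative algebra \<open>U\<close> is a module \<open>M\<close> over the ground ring with an algebra
  homomorphism \<open>act\<close> from \<open>U\<close> to the endomorphism algebra of \<open>M\<close>; \<open>act u m\<close> is \<open>u.m\<close>.\<close>

definition alg_module ::
  "('k, 'c) ring_scheme \<Rightarrow> ('k, 'u, 'd) module_scheme \<Rightarrow> ('k, 'm, 'e) module_scheme \<Rightarrow>
   ('u \<Rightarrow> 'm \<Rightarrow> 'm) \<Rightarrow> bool" where
  "alg_module R U M act \<longleftrightarrow> module R M \<and> act \<in> algebra_hom R U (End_alg R M)"

definition supermodule ::
  "('k, 'c) ring_scheme \<Rightarrow> ('k, 'u, 'd) module_scheme \<Rightarrow> (bit \<Rightarrow> 'u set) \<Rightarrow>
   ('k, 'm, 'e) module_scheme \<Rightarrow> (bit \<Rightarrow> 'm set) \<Rightarrow> ('u \<Rightarrow> 'm \<Rightarrow> 'm) \<Rightarrow> bool" where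
  "supermodule R U Up M Mp act \<longleftrightarrow>
     alg_module R U M act \<and>
     direct_sum R M (carrier M) UNIV Mp \<and>
     (\<forall>p q. \<forall>u\<in>Up p. \<forall>m\<in>Mp q. act u m \<in> Mp (p + q))"

definition subsupermodule ::
  "('k, 'c) ring_scheme \<Rightarrow> ('k, 'u, 'd) module_scheme \<Rightarrow> ('k, 'm, 'e) module_scheme \<Rightarrow>
   (bit \<Rightarrow> 'm set) \<Rightarrow> ('u \<Rightarrow> 'm \<Rightarrow> 'm) \<Rightarrow> 'm set \<Rightarrow> bool" where
  "subsupermodule R U M Mp act N \<longleftrightarrow>
     submodule N R M \<and>
     (\<forall>u\<in>carrier U. \<forall>m\<in>N. act u m \<in> N) \<and>
     direct_sum R M N UNIV (\<lambda>p. N \<inter> Mp p)"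

datatype qn_gen =
    KG nat | KinvG nat | EG nat | FG nat | KbG nat | EbG nat | FbG nat

primrec qn_par :: "qn_gen \<Rightarrow> bit" where
  "qn_par (KG i) = 0"
| "qn_par (KinvG i) = 0"
| "qn_par (EG j) = 0"
| "qn_par (FG j) = 0"
| "qn_par (KbG i) = 1"
| "qn_par (EbG j) = 1"
| "qn_par (FbG j) = 1"

definition qn_gens :: "nat \<Rightarrow> qn_gen set" where
  "qn_gens n =
     KG ` {1..n} \<union> KinvG ` {1..n} \<union> KbG ` {1..n} \<union>
     EG ` {1..<n} \<union> FG ` {1..<n} \<union> EbG ` {1..<n} \<union> FbG ` {1..<n}"

abbreviation (input) "fK i \<equiv> gen (KG i)"
abbreviation (input) "fKi i \<equiv> gen (KinvG i)"
abbreviation (input) "fKb i \<equiv> gen (KbG i)"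
abbreviation (input) "fE j \<equiv> gen (EG j)"
abbreviation (input) "fF j \<equiv> gen (FG j)"
abbreviation (input) "fEb j \<equiv> gen (EbG j)"
abbreviation (input) "fFb j \<equiv> gen (FbG j)"

abbreviation (input) kdelta :: "nat \<Rightarrow> nat \<Rightarrow> 'a::zero_neq_one" where
  "kdelta i j \<equiv> of_bool (i = j)"

inductive_set qn_rels :: "nat \<Rightarrow> (qn_gen falg \<times> qn_gen falg) set" for n :: nat where
  QQ1a: "i \<in> {1..n} \<Longrightarrow> (fK i * fKi i, 1) \<in> qn_rels n"
| QQ1b: "i \<in> {1..n} \<Longrightarrow> (fKi i * fK i, 1) \<in> qn_rels n"
| QQ1c: "i \<in> {1..n} \<Longrightarrow> j \<in> {1..n} \<Longrightarrow> (fK i * fK j, fK j * fK i) \<in> qn_rels n"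
| QQ1d: "i \<in> {1..n} \<Longrightarrow> j \<in> {1..n} \<Longrightarrow> (fK i * fKb j, fKb j * fK i) \<in> qn_rels n"
| QQ1e: "i \<in> {1..n} \<Longrightarrow> j \<in> {1..n} \<Longrightarrow>
    (fKb i * fKb j + fKb j * fKb i,
     scal (2 * kdelta i j / (\<upsilon> powi 2 - \<upsilon> powi (-2))) * (fK i ^ 2 - fKi i ^ 2)) \<in> qn_rels n"
| QQ2a: "i \<in> {1..n} \<Longrightarrow> j \<in> {1..<n} \<Longrightarrow>
    (fK i * fE j, scal (\<upsilon> powi (kdelta i j - kdelta i (j + 1))) * (fE j * fK i)) \<in> qn_rels n"
| QQ2b: "i \<in> {1..n} \<Longrightarrow> j \<in> {1..<n} \<Longrightarrow>
    (fK i * fF j, scal (\<upsilon> powi (- (kdelta i j - kdelta i (j + 1)))) * (fF j * fK i)) \<in> qn_rels n"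
| QQ2c: "i \<in> {1..n} \<Longrightarrow> j \<in> {1..<n} \<Longrightarrow>
    (fK i * fEb j, scal (\<upsilon> powi (kdelta i j - kdelta i (j + 1))) * (fEb j * fK i)) \<in> qn_rels n"
| QQ2d: "i \<in> {1..n} \<Longrightarrow> j \<in> {1..<n} \<Longrightarrow>
    (fK i * fFb j, scal (\<upsilon> powi (- (kdelta i j - kdelta i (j + 1)))) * (fFb j * fK i)) \<in> qn_rels n"
| QQ3a: "i \<in> {1..n} \<Longrightarrow> j \<in> {1..<n} \<Longrightarrow> i \<noteq> j \<Longrightarrow> i \<noteq> j + 1 \<Longrightarrow>
    (fKb i * fE j, fE j * fKb i) \<in> qn_rels n"
| QQ3b: "i \<in> {1..n} \<Longrightarrow> j \<in> {1..<n} \<Longrightarrow> i \<noteq> j \<Longrightarrow> i \<noteq> j + 1 \<Longrightarrow>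
    (fKb i * fF j, fF j * fKb i) \<in> qn_rels n"
| QQ3c: "j \<in> {1..<n} \<Longrightarrow>
    (fKb j * fE j - scal \<upsilon> * (fE j * fKb j), fEb j * fKi j) \<in> qn_rels n"
| QQ3d: "j \<in> {1..<n} \<Longrightarrow>
    (scal \<upsilon> * (fKb (j + 1) * fE j) - fE j * fKb (j + 1), - (fKi (j + 1) * fEb j)) \<in> qn_rels n"
| QQ3e: "j \<in> {1..<n} \<Longrightarrow>
    (fKb j * fF j - scal \<upsilon> * (fF j * fKb j), - (fFb j * fK j)) \<in> qn_rels n"
| QQ3f: "j \<in> {1..<n} \<Longrightarrow>
    (scal \<upsilon> * (fKb (j + 1) * fF j) - fF j * fKb (j + 1), fK (j + 1) * fFb j) \<in> qn_rels n"
| QQ4a: "i \<in> {1..<n} \<Longrightarrow> j \<in> {1..<n} \<Longrightarrow>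
    (fE i * fF j - fF j * fE i,
     scal (kdelta i j / (\<upsilon> - inverse \<upsilon>)) * (fK i * fKi (i + 1) - fKi i * fK (i + 1))) \<in> qn_rels n"
| QQ4b: "i \<in> {1..<n} \<Longrightarrow> j \<in> {1..<n} \<Longrightarrow>
    (fE i * fFb j - fFb j * fE i,
     scal (kdelta i j) * (fKi (i + 1) * fKb i - fKb (i + 1) * fKi i)) \<in> qn_rels n"
| QQ4c: "i \<in> {1..<n} \<Longrightarrow> j \<in> {1..<n} \<Longrightarrow>
    (fEb i * fF j - fF j * fEb i,
     scal (kdelta i j) * (fK (i + 1) * fKb i - fKb (i + 1) * fK i)) \<in> qn_rels n"
| QQ5a: "i \<in> {1..<n} \<Longrightarrow> j \<in> {1..<n} \<Longrightarrow> \<bar>int i - int j\<bar> > 1 \<Longrightarrow>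
    (fE i * fE j, fE j * fE i) \<in> qn_rels n"
| QQ5b: "i \<in> {1..<n} \<Longrightarrow> j \<in> {1..<n} \<Longrightarrow> \<bar>int i - int j\<bar> > 1 \<Longrightarrow>
    (fF i * fF j, fF j * fF i) \<in> qn_rels n"
| QQ5c: "i \<in> {1..<n} \<Longrightarrow> (fE i * fEb i, fEb i * fE i) \<in> qn_rels n"
| QQ5d: "i \<in> {1..<n} \<Longrightarrow> (fF i * fFb i, fFb i * fF i) \<in> qn_rels n"
| QQ5e: "i \<in> {1..<n} \<Longrightarrow> i + 1 \<in> {1..<n} \<Longrightarrow>
    (fE i * fE (i + 1) - scal \<upsilon> * (fE (i + 1) * fE i),
     fEb i * fEb (i + 1) + scal \<upsilon> * (fEb (i + 1) * fEb i)) \<in> qn_rels n"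
| QQ5f: "i \<in> {1..<n} \<Longrightarrow> i + 1 \<in> {1..<n} \<Longrightarrow>
    (scal \<upsilon> * (fF (i + 1) * fF i) - fF i * fF (i + 1),
     fFb i * fFb (i + 1) + scal \<upsilon> * (fFb (i + 1) * fFb i)) \<in> qn_rels n"
| QQ6a: "i \<in> {1..<n} \<Longrightarrow> j \<in> {1..<n} \<Longrightarrow> \<bar>int i - int j\<bar> = 1 \<Longrightarrow> Z \<in> {fE j, fEb j} \<Longrightarrow>
    (fE i ^ 2 * Z - scal (\<upsilon> + inverse \<upsilon>) * (fE i * Z * fE i) + Z * fE i ^ 2, 0) \<in> qn_rels n"
| QQ6b: "i \<in> {1..<n} \<Longrightarrow> j \<in> {1..<n} \<Longrightarrow> \<bar>int i - int j\<bar> = 1 \<Longrightarrow> Z \<in> {fF j, fFb j} \<Longrightarrow>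
    (fF i ^ 2 * Z - scal (\<upsilon> + inverse \<upsilon>) * (fF i * Z * fF i) + Z * fF i ^ 2, 0) \<in> qn_rels n"

definition Uq :: "nat \<Rightarrow> (qv, qn_gen falg set) module" where
  "Uq n = presented (qn_gens n) (qn_rels n)"

definition Uq_part :: "nat \<Rightarrow> bit \<Rightarrow> qn_gen falg set set" where
  "Uq_part n = presented_part (qn_gens n) (qn_rels n) qn_par"

definition Ugen :: "nat \<Rightarrow> qn_gen \<Rightarrow> qn_gen falg set" where
  "Ugen n g = cls (qn_gens n) (qn_rels n) (gen g)"

text \<open>\<open>Or i\<close> and \<open>Bar i\<close> are the indices \<open>i\<close> and \<open>i\<close> with a bar; they label both the generators of
  the algebra and the entries of exponent vectors.\<close>

datatype idx = Or nat | Bar nat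

definition idxs :: "nat \<Rightarrow> idx set" where
  "idxs n = Or ` {1..n} \<union> Bar ` {1..n}"

inductive_set qpol_rels :: "nat \<Rightarrow> (idx falg \<times> idx falg) set" for n :: nat where
  XX: "i \<in> {1..n} \<Longrightarrow> j \<in> {1..n} \<Longrightarrow>
    (gen (Or i) * gen (Or j), gen (Or j) * gen (Or i)) \<in> qpol_rels n"
| XXb: "i \<in> {1..n} \<Longrightarrow> j \<in> {1..n} \<Longrightarrow>
    (gen (Or i) * gen (Bar j), gen (Bar j) * gen (Or i)) \<in> qpol_rels n"
| XbXb: "i \<in> {1..n} \<Longrightarrow> j \<in> {1..n} \<Longrightarrow> i \<noteq> j \<Longrightarrow>
    (gen (Bar i) * gen (Bar j), - (gen (Bar j) * gen (Bar i))) \<in> qpol_rels n"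
| Xb2: "i \<in> {1..n} \<Longrightarrow>
    (gen (Bar i) ^ 2,
     scal ((\<upsilon> - inverse \<upsilon>) / (\<upsilon> + inverse \<upsilon>)) * gen (Or i) ^ 2) \<in> qpol_rels n"

definition Aq :: "nat \<Rightarrow> (qv, idx falg set) module" where
  "Aq n = presented (idxs n) (qpol_rels n)"

definition Xgen :: "nat \<Rightarrow> idx \<Rightarrow> idx falg set" where
  "Xgen n p = cls (idxs n) (qpol_rels n) (gen p)"

text \<open>Exponents are arbitrary here, so an exponent 2 of a generator \<open>Bar i\<close> is evaluated in the
  algebra; the exponent vectors of the monomial basis are those in \<open>expos\<close> below.\<close>

definition Xmon :: "nat \<Rightarrow> (idx \<Rightarrow> nat) \<Rightarrow> idx falg set" where
  "Xmon n a = foldr (\<lambda>p y. (Xgen n p [^]\<^bsub>Aq n\<^esub> a p) \<otimes>\<^bsub>Aq n\<^esub> y)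
     (map Or [1..<n + 1] @ map Bar [1..<n + 1]) \<one>\<^bsub>Aq n\<^esub>"

definition expos :: "nat \<Rightarrow> (idx \<Rightarrow> nat) set" where
  "expos n = {a. (\<forall>p. p \<notin> idxs n \<longrightarrow> a p = 0) \<and> (\<forall>i. a (Bar i) \<le> 1)}"

text \<open>\<open>a - e\<^sub>p\<close> and \<open>a + e\<^sub>q - e\<^sub>p\<close> (\<open>p \<noteq> q\<close>). If \<open>a p = 0\<close>, the subtraction
  truncates; all uses below then carry the coefficient \<open>qint 0 = 0\<close>.\<close>

definition dec :: "idx \<Rightarrow> (idx \<Rightarrow> nat) \<Rightarrow> (idx \<Rightarrow> nat)" where
  "dec p a = a(p := a p - 1)"

definition move :: "idx \<Rightarrow> idx \<Rightarrow> (idx \<Rightarrow> nat) \<Rightarrow> (idx \<Rightarrow> nat)" where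
  "move p q a = a(p := a p - 1, q := a q + 1)"

definition Aq_hom :: "nat \<Rightarrow> nat \<Rightarrow> idx falg set set" where
  "Aq_hom n r = lin_span QV (Aq n)
     (Xmon n ` {a \<in> expos n. (\<Sum>i=1..n. a (Or i) + a (Bar i)) = r})"

definition Aq_part :: "nat \<Rightarrow> bit \<Rightarrow> idx falg set set" where
  "Aq_part n p = lin_span QV (Aq n)
     (Xmon n ` {a \<in> expos n. of_nat (\<Sum>i=1..n. a (Bar i)) = p})"

abbreviation EndA :: "nat \<Rightarrow> (qv, idx falg set \<Rightarrow> idx falg set) module" where
  "EndA n \<equiv> End_alg QV (Aq n)"

text \<open>The linear operator with prescribed values on the basis of monomials; it exists
  because these monomials form a basis, and is unique because elements of \<^const>\<open>End_alg\<close> are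
  undefined outside the carrier.\<close>

definition lin_ext :: "nat \<Rightarrow> ((idx \<Rightarrow> nat) \<Rightarrow> idx falg set) \<Rightarrow> idx falg set \<Rightarrow> idx falg set" where
  "lin_ext n g = (THE f. f \<in> carrier (EndA n) \<and> (\<forall>a\<in>expos n. f (Xmon n a) = g a))"

definition sgn_lt :: "(idx \<Rightarrow> nat) \<Rightarrow> nat \<Rightarrow> qv" where
  "sgn_lt a i = (- 1) ^ (\<Sum>j\<in>{1..<i}. a (Bar j))"

definition sgn_le :: "(idx \<Rightarrow> nat) \<Rightarrow> nat \<Rightarrow> qv" where
  "sgn_le a i = (- 1) ^ (\<Sum>j\<in>{1..i}. a (Bar j))"

primrec pd :: "nat \<Rightarrow> idx \<Rightarrow> idx falg set \<Rightarrow> idx falg set" where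
  "pd n (Or i) = lin_ext n (\<lambda>a. qint (int (a (Or i))) \<odot>\<^bsub>Aq n\<^esub> Xmon n (dec (Or i) a))"
| "pd n (Bar i) = lin_ext n (\<lambda>a. (sgn_lt a i * qint (int (a (Bar i)))) \<odot>\<^bsub>Aq n\<^esub> Xmon n (dec (Bar i) a))"

definition chi :: "nat \<Rightarrow> idx \<Rightarrow> idx falg set \<Rightarrow> idx falg set" where
  "chi n p = (\<lambda>x\<in>carrier (Aq n). Xgen n p \<otimes>\<^bsub>Aq n\<^esub> x)"

definition del :: "nat \<Rightarrow> idx \<Rightarrow> idx falg set \<Rightarrow> idx falg set" where
  "del n p = lin_ext n (\<lambda>a. \<upsilon> powi int (a p) \<odot>\<^bsub>Aq n\<^esub> Xmon n a)"

definition del_inv :: "nat \<Rightarrow> idx \<Rightarrow> idx falg set \<Rightarrow> idx falg set" where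
  "del_inv n p = lin_ext n (\<lambda>a. \<upsilon> powi (- int (a p)) \<odot>\<^bsub>Aq n\<^esub> Xmon n a)"

definition sbar :: "nat \<Rightarrow> nat \<Rightarrow> idx falg set \<Rightarrow> idx falg set" where
  "sbar n i = lin_ext n (\<lambda>a. (- 1) ^ a (Bar i) \<odot>\<^bsub>Aq n\<^esub> Xmon n a)"

definition op_K :: "nat \<Rightarrow> nat \<Rightarrow> idx falg set \<Rightarrow> idx falg set" where
  "op_K n i = del n (Or i) \<otimes>\<^bsub>EndA n\<^esub> del n (Bar i)"

definition op_E :: "nat \<Rightarrow> nat \<Rightarrow> idx falg set \<Rightarrow> idx falg set" where
  "op_E n h =
     chi n (Or h) \<otimes>\<^bsub>EndA n\<^esub> pd n (Or (h + 1)) \<otimes>\<^bsub>EndA n\<^esub> del n (Bar (h + 1))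
     \<oplus>\<^bsub>EndA n\<^esub>
     chi n (Bar h) \<otimes>\<^bsub>EndA n\<^esub> pd n (Bar (h + 1)) \<otimes>\<^bsub>EndA n\<^esub> del_inv n (Or (h + 1)) \<otimes>\<^bsub>EndA n\<^esub> sbar n h"

definition op_F :: "nat \<Rightarrow> nat \<Rightarrow> idx falg set \<Rightarrow> idx falg set" where
  "op_F n h =
     chi n (Or (h + 1)) \<otimes>\<^bsub>EndA n\<^esub> pd n (Or h) \<otimes>\<^bsub>EndA n\<^esub> del_inv n (Bar h)
     \<oplus>\<^bsub>EndA n\<^esub>
     chi n (Bar (h + 1)) \<otimes>\<^bsub>EndA n\<^esub> pd n (Bar h) \<otimes>\<^bsub>EndA n\<^esub> del n (Or h)"

definition op_Kb :: "nat \<Rightarrow> nat \<Rightarrow> idx falg set \<Rightarrow> idx falg set" where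
  "op_Kb n i =
     chi n (Or i) \<otimes>\<^bsub>EndA n\<^esub> pd n (Bar i) \<otimes>\<^bsub>EndA n\<^esub> del_inv n (Or i)
     \<oplus>\<^bsub>EndA n\<^esub>
     chi n (Bar i) \<otimes>\<^bsub>EndA n\<^esub> pd n (Or i) \<otimes>\<^bsub>EndA n\<^esub> del n (Bar i)"

definition op_Eb :: "nat \<Rightarrow> nat \<Rightarrow> idx falg set \<Rightarrow> idx falg set" where
  "op_Eb n h =
     chi n (Bar h) \<otimes>\<^bsub>EndA n\<^esub> pd n (Or (h + 1)) \<otimes>\<^bsub>EndA n\<^esub> del n (Bar (h + 1)) \<otimes>\<^bsub>EndA n\<^esub> sbar n h
     \<oplus>\<^bsub>EndA n\<^esub>
     chi n (Or h) \<otimes>\<^bsub>EndA n\<^esub> pd n (Bar (h + 1)) \<otimes>\<^bsub>EndA n\<^esub> del_inv n (Or (h + 1))"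

definition op_Fb :: "nat \<Rightarrow> nat \<Rightarrow> idx falg set \<Rightarrow> idx falg set" where
  "op_Fb n h =
     chi n (Bar (h + 1)) \<otimes>\<^bsub>EndA n\<^esub> pd n (Or h) \<otimes>\<^bsub>EndA n\<^esub> del_inv n (Bar h)
     \<oplus>\<^bsub>EndA n\<^esub>
     chi n (Or (h + 1)) \<otimes>\<^bsub>EndA n\<^esub> pd n (Bar h) \<otimes>\<^bsub>EndA n\<^esub> del n (Or h)"

text \<open>The value at \<open>KinvG i\<close> is forced, being inverse to the value at \<open>KG i\<close>.\<close>

definition extends_assignment ::
  "nat \<Rightarrow> (qn_gen falg set \<Rightarrow> idx falg set \<Rightarrow> idx falg set) \<Rightarrow> bool" where
  "extends_assignment n \<rho> \<longleftrightarrow>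
     \<rho> \<in> algebra_hom QV (Uq n) (EndA n) \<and>
     (\<forall>i\<in>{1..n}. \<rho> (Ugen n (KG i)) = op_K n i \<and> \<rho> (Ugen n (KbG i)) = op_Kb n i) \<and>
     (\<forall>h\<in>{1..<n}.
        \<rho> (Ugen n (EG h)) = op_E n h \<and> \<rho> (Ugen n (FG h)) = op_F n h \<and>
        \<rho> (Ugen n (EbG h)) = op_Eb n h \<and> \<rho> (Ugen n (FbG h)) = op_Fb n h)"

definition weight_space ::
  "nat \<Rightarrow> (qv, 'm, 'e) module_scheme \<Rightarrow> (qn_gen falg set \<Rightarrow> 'm \<Rightarrow> 'm) \<Rightarrow> (nat \<Rightarrow> int) \<Rightarrow> 'm set" where
  "weight_space n M act \<mu> =
     {m \<in> carrier M. \<forall>i\<in>{1..n}. act (Ugen n (KG i)) m = \<upsilon> powi (\<mu> i) \<odot>\<^bsub>M\<^esub> m}"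

definition weight_supermodule ::
  "nat \<Rightarrow> (qv, 'm, 'e) module_scheme \<Rightarrow> (bit \<Rightarrow> 'm set) \<Rightarrow> (qn_gen falg set \<Rightarrow> 'm \<Rightarrow> 'm) \<Rightarrow> bool" where
  "weight_supermodule n M Mp act \<longleftrightarrow>
     supermodule QV (Uq n) (Uq_part n) M Mp act \<and>
     direct_sum QV M (carrier M) ({1..n} \<rightarrow>\<^sub>E UNIV) (weight_space n M act)"

end

(* A linear map on A(n) is determined by its transpose on linear functionals, and functionals are
   determined by their values on the monomials. Indexing monomials by states (a pair of an exponent
   and a flag for the odd exponent at every site) turns all operators into explicit maps on functions
   of states. Allowing arbitrary integers as even exponents removes the truncation at 0, and then every
   defining relation of U becomes an identity between Laurent polynomials in the powers of upsilon,
   checked on the at most three consecutive sites (or two disjoint pairs of sites) that it involves.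
   The same transposition, applied to left multiplication, shows that the monomials are linearly
   independent; spanning follows by reordering. Direct sum decompositions are read off from a
   partition of the monomial basis. *)

theory Submission
  imports Defs
begin

section \<open>Presented algebras\<close>

text \<open>The operators are linear extensions from a family whose independence has itself to be
  proved, and the elements of both algebras are cosets, so a check on elements would mix
  representatives with basis arguments at every step. Functions on states carry no quotient:
  \<open>dual_chi\<close> and \<open>dual_U\<close> are closed formulas, and identities between them
  are pointwise. They descend afterwards, because the elements of the free algebra that kill every
  function form an ideal. Transposition reverses products twice, once in passing to functionals and
  once in passing back in \<open>rho\<close>, so the result is a homomorphism. The way back needs
  that a map of functionals comes from an operator on \<open>Aq n\<close> at all, which is the
  meaning of \<open>realizable\<close>. On states with integer exponents the formulas describe,
  formally, an action on the algebra with the even generators inverted; the zero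
  \<open>qint 0\<close> is what lets them restrict to honest monomials.\<close>

lemma QV_simps [simp]:
  "carrier QV = UNIV" "monoid.mult QV = (*)" "one QV = 1" "add QV = (+)" "zero QV = 0"
  by (simp_all add: ring_of_type_algebra_def)

lemma cring_QV: "cring QV"
  by (rule cring_from_type_algebra)

section \<open>Elements of the free algebra\<close>

lemma sum_single_keys: "x = (\<Sum>w\<in>Poly_Mapping.keys x. Poly_Mapping.single w (Poly_Mapping.lookup x w))"
  by (rule poly_mapping_eqI)
    (auto simp: lookup_sum lookup_single when_def in_keys_iff)

lemma poly_mapping_sum_induct [consumes 1, case_names zero add single]:
  fixes x :: "'a \<Rightarrow>\<^sub>0 'b::comm_monoid_add"
  assumes K: "Poly_Mapping.keys x \<subseteq> A" and z: "P 0"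
    and a: "\<And>x y. P x \<Longrightarrow> P y \<Longrightarrow> P (x + y)"
    and s: "\<And>w c. w \<in> A \<Longrightarrow> P (Poly_Mapping.single w c)"
  shows "P x"
proof -
  have "P (\<Sum>w\<in>B. Poly_Mapping.single w (Poly_Mapping.lookup x w))"
    if "finite B" "B \<subseteq> A" for B
    using that by (induction B rule: finite_induct) (auto intro: z a s)
  then show ?thesis
    using K by (subst sum_single_keys) auto
qed

lemma falg_induct [consumes 1, case_names zero add single]:
  assumes "x \<in> carrier (free_alg G)" "P 0" "\<And>x y. P x \<Longrightarrow> P y \<Longrightarrow> P (x + y)"
    and "\<And>w c. set w \<subseteq> G \<Longrightarrow> P (Poly_Mapping.single (Wd w) c)"
  shows "P x"
proof (rule poly_mapping_sum_induct)
  show "Poly_Mapping.keys x \<subseteq> {w. set (letters w) \<subseteq> G}"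
    using assms(1) by (auto simp: free_alg_def)
  show "P (Poly_Mapping.single w c)" if "w \<in> {w. set (letters w) \<subseteq> G}" for w c
    using assms(4)[of "letters w"] that by simp
qed (use assms in auto)

lemma scal_mult_single: "scal c * Poly_Mapping.single w d = Poly_Mapping.single w (c * d)"
  by (simp add: scal_def mult_single)

lemma scal_commute: "x * scal c = scal c * x"
  by (rule poly_mapping_sum_induct[of x UNIV "\<lambda>x. x * scal c = scal c * x"])
    (auto simp: algebra_simps scal_def mult_single)

lemma scal_simps [simp]:
  "scal 1 = 1" "scal 0 = 0"
  by (simp_all add: scal_def)

lemma scal_hom:
  "scal (c + d) = scal c + scal d" "scal (c * d) = scal c * scal d"
  by (simp_all add: scal_def single_add mult_single)

lemma single_Cons: "Poly_Mapping.single (Wd (g # w)) c = gen g * Poly_Mapping.single (Wd w) c"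
  by (simp add: gen_def mult_single plus_fmon_def)

lemma single_Nil: "Poly_Mapping.single (Wd []) c = scal c"
  by (simp add: scal_def zero_fmon_def)

lemma free_alg_simps [simp]:
  "monoid.mult (free_alg G) = (*)" "one (free_alg G) = 1" "zero (free_alg G) = 0"
  "add (free_alg G) = (+)" "module.smult (free_alg G) = (\<lambda>c f. scal c * f)"
  by (simp_all add: free_alg_def)

lemma free_alg_closed [simp, intro]:
  "0 \<in> carrier (free_alg G)"
  "1 \<in> carrier (free_alg G)"
  "scal c \<in> carrier (free_alg G)"
  "g \<in> G \<Longrightarrow> gen g \<in> carrier (free_alg G)"
  "set gs \<subseteq> G \<Longrightarrow> Poly_Mapping.single (Wd gs) c \<in> carrier (free_alg G)"
  "x \<in> carrier (free_alg G) \<Longrightarrow> - x \<in> carrier (free_alg G)"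
  by (auto simp: free_alg_def scal_def gen_def zero_fmon_def in_keys_iff lookup_single when_def lookup_one
      split: if_splits)

lemma free_alg_closed' [simp, intro]:
  assumes "x \<in> carrier (free_alg G)" "y \<in> carrier (free_alg G)"
  shows "x + y \<in> carrier (free_alg G)" "x - y \<in> carrier (free_alg G)" "x * y \<in> carrier (free_alg G)"
proof -
  have 1: "a + b \<in> carrier (free_alg G)" if "a \<in> carrier (free_alg G)" "b \<in> carrier (free_alg G)" for a b
    using that keys_add[of a b] by (auto simp: free_alg_def)
  from 1[of x y] assms show "x + y \<in> carrier (free_alg G)" by simp
  from 1[of x "- y"] assms show "x - y \<in> carrier (free_alg G)" by simp
  show "x * y \<in> carrier (free_alg G)"
    using assms keys_mult[of x y] by (fastforce simp: free_alg_def plus_fmon_def)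
qed

lemma free_alg_power_closed [simp, intro]:
  "x \<in> carrier (free_alg G) \<Longrightarrow> x ^ k \<in> carrier (free_alg G)"
  by (induction k) auto

lemma ring_free_alg: "ring (free_alg G)"
proof (rule ringI)
  show "abelian_group (free_alg G)"
    by (rule abelian_groupI) (auto simp: algebra_simps intro!: bexI[of _ "- x" for x])
  show "Group.monoid (free_alg G)"
    by (rule Group.monoidI) (auto simp: algebra_simps)
qed (auto simp: algebra_simps)

lemma free_alg_a_minus: "x \<in> carrier (free_alg G) \<Longrightarrow> a_inv (free_alg G) x = - x"
  by (rule abelian_group.minus_equality[OF ring.is_abelian_group[OF ring_free_alg]]) auto

section \<open>The quotient by a set of relations\<close>

locale presentation =
  fixes G :: "'g set" and Rel :: "('g falg \<times> 'g falg) set"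
  assumes rels_closed: "(l, r) \<in> Rel \<Longrightarrow> l \<in> carrier (free_alg G) \<and> r \<in> carrier (free_alg G)"
begin

abbreviation "F \<equiv> carrier (free_alg G)"
abbreviation "I \<equiv> rel_ideal G Rel"
abbreviation "A \<equiv> presented G Rel"
abbreviation "cl \<equiv> cls G Rel"

lemma ideal_I: "ideal I (free_alg G)"
  unfolding rel_ideal_def
  by (rule ring.genideal_ideal[OF ring_free_alg]) (auto dest: rels_closed)

lemma rel_in_I: "(l, r) \<in> Rel \<Longrightarrow> l - r \<in> I"
  using ring.genideal_self[OF ring_free_alg, of "{l - r | l r. (l, r) \<in> Rel}"] rels_closed
  unfolding rel_ideal_def by blast

lemma I_minimal:
  assumes "ideal J (free_alg G)" "\<And>l r. (l, r) \<in> Rel \<Longrightarrow> l - r \<in> J"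
  shows "I \<subseteq> J"
  unfolding rel_ideal_def
  by (rule ring.genideal_minimal[OF ring_free_alg]) (use assms in auto)

lemma cl_eq_iff:
  assumes "x \<in> F" "y \<in> F"
  shows "cl x = cl y \<longleftrightarrow> x - y \<in> I"
proof -
  interpret ideal I "free_alg G" by (rule ideal_I)
  show ?thesis
    using quotient_eq_iff_same_a_r_cos[OF ideal_I assms] assms
    by (simp add: cls_def a_minus_def free_alg_a_minus)
qed

lemma mem_cl: "x \<in> F \<Longrightarrow> x \<in> cl x"
  using abelian_subgroup.a_rcos_self[OF abelian_subgroupI3[OF ideal.axioms(1)[OF ideal_I]]]
  by (simp add: cls_def ring.is_abelian_group ring_free_alg)

lemma mem_cl_iff: "x \<in> F \<Longrightarrow> y \<in> cl x \<longleftrightarrow> y \<in> F \<and> cl y = cl x"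
proof -
  assume x: "x \<in> F"
  interpret ideal I "free_alg G" by (rule ideal_I)
  show ?thesis
    using x mem_cl[of y] a_repr_independence[of y I x, OF _ x a_subgroup] a_r_coset_subset_G[OF a_subset x]
    by (auto simp: cls_def)
qed

lemma carrier_A: "carrier A = cl ` F"
  by (auto simp: presented_def Let_def FactRing_def A_RCOSETS_def' cls_def)

lemma cl_closed [simp, intro]: "x \<in> F \<Longrightarrow> cl x \<in> carrier A"
  by (simp add: carrier_A)

lemma cl_hom:
  assumes "x \<in> F" "y \<in> F"
  shows "cl x \<oplus>\<^bsub>A\<^esub> cl y = cl (x + y)" "cl x \<otimes>\<^bsub>A\<^esub> cl y = cl (x * y)"
  using ideal.rcos_ring_hom[OF ideal_I] assms
  by (simp_all add: ring_hom_def presented_def Let_def cls_def)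

lemma cl_one: "\<one>\<^bsub>A\<^esub> = cl 1"
  by (simp add: presented_def Let_def cls_def FactRing_def)

lemma cl_zero: "\<zero>\<^bsub>A\<^esub> = cl 0"
proof -
  interpret ideal I "free_alg G" by (rule ideal_I)
  show ?thesis
    using a_coset_add_zero[OF a_subset] by (simp add: presented_def Let_def cls_def FactRing_def)
qed

text \<open>In \<open>presented\<close> the multiple of a coset is the union of the cosets of all
  its multiplied members; the ideal absorbs \<open>scal c\<close>, so these cosets coincide and the
  union is one of them.\<close>

lemma cl_smult:
  assumes "x \<in> F"
  shows "c \<odot>\<^bsub>A\<^esub> cl x = cl (scal c * x)"
proof -
  have "cl (scal c * y) = cl (scal c * x)" if "y \<in> cl x" for y
  proof -
    have y: "y \<in> F" "y - x \<in> I"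
      using that assms cl_eq_iff mem_cl_iff by auto
    then have "scal c * (y - x) \<in> I"
      using ideal.I_l_closed[OF ideal_I, of "y - x" "scal c"] by simp
    then show ?thesis using y assms by (subst cl_eq_iff) (auto simp: algebra_simps)
  qed
  then have "(\<Union>y\<in>cl x. cl (scal c * y)) = cl (scal c * x)"
    using mem_cl[OF assms] by blast
  then show ?thesis
    by (simp add: presented_def Let_def cls_def)
qed

lemma ring_A: "ring A"
proof (rule ringI)
  show "abelian_group A"
    by (rule abelian_groupI)
      (auto simp: carrier_A cl_hom cl_zero algebra_simps intro!: bexI[of _ "- x" for x])
  show "Group.monoid A"
    by (rule Group.monoidI) (auto simp: carrier_A cl_hom cl_one algebra_simps)
qed (auto simp: carrier_A cl_hom algebra_simps)

lemma module_A: "module QV A"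
proof (rule moduleI)
  show "abelian_group A" by (rule ring.is_abelian_group[OF ring_A])
qed (auto simp: cring_QV carrier_A cl_hom cl_smult scal_hom algebra_simps)

end

section \<open>Transposed actions on functionals\<close>

definition lin_op :: "(('s \<Rightarrow> qv) \<Rightarrow> 't \<Rightarrow> qv) \<Rightarrow> bool" where
  "lin_op D \<longleftrightarrow> (\<forall>f h. D (\<lambda>s. f s + h s) = (\<lambda>s. D f s + D h s)) \<and> (\<forall>c f. D (\<lambda>s. c * f s) = (\<lambda>s. c * D f s))"

lemma lin_opD:
  assumes "lin_op D"
  shows "D (\<lambda>s. f s + h s) s = D f s + D h s" "D (\<lambda>s. c * f s) s = c * D f s"
    "D (\<lambda>s. 0) s = 0"
proof -
  show 1: "D (\<lambda>s. f s + h s) s = D f s + D h s" "D (\<lambda>s. c * f s) s = c * D f s" for c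
    using assms by (simp_all add: lin_op_def)
  show "D (\<lambda>s. 0) s = 0" using 1(2)[of 0] by simp
qed

text \<open>\<open>fev T x\<close> is the transpose of the action of \<open>x\<close>, where \<open>T g\<close> is the transpose of the action of
  the generator \<open>g\<close>; hence the order of composition is reversed.\<close>

definition fev :: "('g \<Rightarrow> ('s \<Rightarrow> qv) \<Rightarrow> 's \<Rightarrow> qv) \<Rightarrow> 'g falg \<Rightarrow> ('s \<Rightarrow> qv) \<Rightarrow> 's \<Rightarrow> qv" where
  "fev T x f s = (\<Sum>w\<in>Poly_Mapping.keys x. Poly_Mapping.lookup x w * fold T (letters w) f s)"

text \<open>Keys may cancel in a sum, so sums over different key sets are first brought to a common
  finite set.\<close>

lemma fev_superset:
  "finite B \<Longrightarrow> Poly_Mapping.keys x \<subseteq> B \<Longrightarrow>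
    fev T x f s = (\<Sum>w\<in>B. Poly_Mapping.lookup x w * fold T (letters w) f s)"
  unfolding fev_def by (rule sum.mono_neutral_left) (auto simp: in_keys_iff)

lemma fev_add: "fev T (x + y) f s = fev T x f s + fev T y f s"
proof -
  let ?B = "Poly_Mapping.keys x \<union> Poly_Mapping.keys y"
  have "Poly_Mapping.keys (x + y) \<subseteq> ?B" by (rule keys_add)
  then show ?thesis
    by (simp add: fev_superset[of ?B] lookup_add distrib_right sum.distrib)
qed

lemma fev_uminus: "fev T (- x) f s = - fev T x f s"
  by (simp add: fev_superset[of "Poly_Mapping.keys x" "- x"] fev_def in_keys_iff sum_negf)

lemma fev_diff: "fev T (x - y) f s = fev T x f s - fev T y f s"
  using fev_add[of T x "- y" f s] by (simp add: fev_uminus)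

lemma fev_zero: "fev T 0 f s = 0"
  by (simp add: fev_def)

lemma fev_single: "fev T (Poly_Mapping.single w c) f s = c * fold T (letters w) f s"
  by (simp add: fev_def)

lemma fev_one: "fev T 1 f s = f s"
  unfolding single_one[symmetric] fev_single by (simp add: zero_fmon_def)

lemma fev_gen [simp]: "fev T (gen g) f = T g f"
  by (rule ext) (simp add: gen_def fev_single)

locale dual_action =
  fixes T :: "'g \<Rightarrow> ('s \<Rightarrow> qv) \<Rightarrow> 's \<Rightarrow> qv"
  assumes lin_T: "lin_op (T g)"
begin

lemma lin_fold: "lin_op (fold T w)"
  by (induction w) (use lin_T in \<open>auto simp: lin_op_def\<close>)

lemma lin_fev: "lin_op (fev T x)"
  using lin_fold
  by (auto simp: lin_op_def fev_def fun_eq_iff sum.distrib sum_distrib_left algebra_simps)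

text \<open>By bilinearity two words suffice, and \<open>fold\<close> over a concatenation runs
  through the letters of the left factor first. In the step over \<open>x\<close> the argument of
  \<open>fev T y\<close> is a sum, which is where \<open>lin_fev\<close> enters.\<close>

lemma fev_mult: "fev T (x * y) f s = fev T y (fev T x f) s"
proof (rule poly_mapping_sum_induct[of x UNIV])
  fix w c
  show "fev T (Poly_Mapping.single w c * y) f s = fev T y (fev T (Poly_Mapping.single w c) f) s"
  proof (rule poly_mapping_sum_induct[of y UNIV])
    fix w' c'
    show "fev T (Poly_Mapping.single w c * Poly_Mapping.single w' c') f s =
        fev T (Poly_Mapping.single w' c') (fev T (Poly_Mapping.single w c) f) s"
      by (simp add: mult_single fev_single plus_fmon_def lin_opD(2)[OF lin_fold] flip: fun_eq_iff
          cong: fold_cong)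
        (simp add: fev_single[abs_def] lin_opD(2)[OF lin_fold])
  qed (auto simp: fev_zero fev_add distrib_left)
next
  fix x x'
  assume "fev T (x * y) f s = fev T y (fev T x f) s" "fev T (x' * y) f s = fev T y (fev T x' f) s"
  then show "fev T ((x + x') * y) f s = fev T y (fev T (x + x') f) s"
    by (simp add: fev_add[abs_def] lin_opD[OF lin_fev] distrib_right)
qed (auto simp: fev_zero[abs_def] lin_opD[OF lin_fev])

lemma fev_mult': "fev T (x * y) f = fev T y (fev T x f)"
  by (rule ext) (rule fev_mult)

lemma fev_scal: "fev T (scal c) f s = c * f s"
  by (simp add: scal_def fev_single zero_fmon_def)

lemma fev_scal_mult: "fev T (scal c * x) f s = c * fev T x f s"
  by (simp add: fev_mult fev_scal[abs_def] lin_opD[OF lin_fev])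

lemma fev_power2: "fev T (x ^ 2) f = fev T x (fev T x f)"
  by (simp add: power2_eq_square fev_mult')

end

locale dual_representation = presentation G Rel + dual_action T
  for G :: "'g set" and Rel and T :: "'g \<Rightarrow> ('s \<Rightarrow> qv) \<Rightarrow> 's \<Rightarrow> qv" +
  assumes fev_rel: "(l, r) \<in> Rel \<Longrightarrow> fev T l f s = fev T r f s"
begin

text \<open>The elements that annihilate every functional form a two-sided ideal containing the
  relators, and the relation ideal is the smallest such ideal.\<close>

lemma fev_I: "x \<in> I \<Longrightarrow> fev T x f s = 0"
proof -
  let ?J = "{x \<in> F. \<forall>f s. fev T x f s = 0}"
  \<comment> \<open>In the product of a killing element \<open>a\<close> with \<open>x\<close> on
    its right, \<open>x\<close> is applied to the zero functional. This side needs linearity; with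
    \<open>x\<close> on the left the claim is immediate.\<close>
  have ann: "fev T x (fev T a f) s = 0" if "\<forall>f s. fev T a f s = 0" for x a f s
  proof -
    have "fev T a f = (\<lambda>s. 0)" using that by auto
    then show ?thesis by (simp add: lin_opD[OF lin_fev])
  qed
  have minv: "m_inv (add_monoid (free_alg G)) x = - x" if "x \<in> F" for x
    using free_alg_a_minus[OF that] by (simp add: a_inv_def)
  have "ideal ?J (free_alg G)"
  proof (rule idealI[OF ring_free_alg])
    show "subgroup ?J (add_monoid (free_alg G))"
      by (rule group.subgroupI[OF abelian_group.a_group[OF ring.is_abelian_group[OF ring_free_alg]]])
        (auto simp: fev_zero fev_add fev_uminus minv[simplified])
  qed (auto simp: fev_mult ann)
  then have "I \<subseteq> ?J"
    by (rule I_minimal) (use rels_closed fev_rel in \<open>auto simp: fev_diff\<close>)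
  then show "x \<in> I \<Longrightarrow> fev T x f s = 0" by auto
qed

lemma fev_cl: "x \<in> F \<Longrightarrow> y \<in> F \<Longrightarrow> cl x = cl y \<Longrightarrow> fev T x f s = fev T y f s"
  using fev_I[of "x - y"] by (simp add: cl_eq_iff fev_diff)

text \<open>Elements of the algebra are cosets, so some representative is chosen; by
  \<open>fev_cl\<close> the choice does not matter for genuine cosets.\<close>

definition cev :: "'g falg set \<Rightarrow> ('s \<Rightarrow> qv) \<Rightarrow> 's \<Rightarrow> qv" where
  "cev u = fev T (SOME x. x \<in> u)"

lemma cev_cl [simp]: "x \<in> F \<Longrightarrow> cev (cl x) = fev T x"
proof -
  assume x: "x \<in> F"
  have "(SOME y. y \<in> cl x) \<in> cl x" by (rule someI[of _ x]) (simp add: mem_cl x)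
  then show ?thesis
    unfolding cev_def using x by (auto simp: mem_cl_iff intro!: ext fev_cl)
qed

lemma lin_cev: "lin_op (cev u)"
  by (simp add: cev_def lin_fev)

lemma cev_hom:
  "u \<in> carrier A \<Longrightarrow> v \<in> carrier A \<Longrightarrow> cev (u \<oplus>\<^bsub>A\<^esub> v) f s = cev u f s + cev v f s"
  "u \<in> carrier A \<Longrightarrow> v \<in> carrier A \<Longrightarrow> cev (u \<otimes>\<^bsub>A\<^esub> v) f s = cev v (cev u f) s"
  "u \<in> carrier A \<Longrightarrow> cev (c \<odot>\<^bsub>A\<^esub> u) f s = c * cev u f s"
  "cev \<one>\<^bsub>A\<^esub> f s = f s" "cev \<zero>\<^bsub>A\<^esub> f s = 0"
  by (auto simp: carrier_A cl_hom cl_smult fev_add fev_mult cl_one cl_zero fev_one fev_zero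
      fev_scal[abs_def] lin_opD[OF lin_fev])

end

section \<open>The dual action on states\<close>

lemma ups_power: "\<upsilon> ^ k = Fract (monom 1 k) 1"
  by (induction k) (simp_all add: ups_def One_fract_def monom_Suc)

lemma ups_nonzero [simp]: "\<upsilon> \<noteq> 0"
  by (simp add: ups_def Zero_fract_def eq_fract)

lemma ups_power_eq_iff: "\<upsilon> ^ k = \<upsilon> ^ l \<longleftrightarrow> k = l"
  by (auto simp: ups_power eq_fract monom_eq_iff')

text \<open>Infinite order of the indeterminate, reduced to monomials of different degree. It
  separates the eigenvalues of the \<open>KG i\<close> in the weight decomposition.\<close>

lemma ups_powi_eq_iff: "\<upsilon> powi a = \<upsilon> powi b \<longleftrightarrow> a = b"
proof
  have *: "a = b" if "a \<le> b" "\<upsilon> powi a = \<upsilon> powi b" for a b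
  proof -
    have "\<upsilon> powi (b - a) = 1"
      using that by (simp add: power_int_diff)
    then have "\<upsilon> ^ nat (b - a) = \<upsilon> ^ 0"
      using that(1) by (simp add: power_int_def split: if_splits)
    then show ?thesis using that(1) by (simp only: ups_power_eq_iff)
  qed
  assume "\<upsilon> powi a = \<upsilon> powi b"
  then show "a = b" using *[of a b] *[of b a] by linarith
qed simp

text \<open>These two facts cover the denominators of \<open>qint\<close> and of the square relation
  for odd generators.\<close>

lemma ups_sq_neq: "\<upsilon>\<^sup>2 \<noteq> 1" "\<upsilon>\<^sup>2 + 1 \<noteq> 0"
proof -
  show "\<upsilon>\<^sup>2 \<noteq> 1" using ups_power_eq_iff[of 2 0] by simp
  show "\<upsilon>\<^sup>2 + 1 \<noteq> 0"
    by (auto simp: ups_def power2_eq_square One_fract_def Zero_fract_def eq_fract one_pCons)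
qed

lemma ups_diff_nonzero: "\<upsilon> - inverse \<upsilon> \<noteq> 0" "\<upsilon> + inverse \<upsilon> \<noteq> 0"
  using ups_sq_neq by (auto simp: field_simps power2_eq_square)

text \<open>The state \<open>s\<close> stands for the monomial with even exponents \<open>fst (s i)\<close> and odd exponents
  \<open>of_bool (snd (s i))\<close>. A negative even exponent is never reached from a monomial, because the
  step from 0 to -1 carries the coefficient \<open>qint 0\<close>.\<close>

type_synonym state = "nat \<Rightarrow> int \<times> bool"

text \<open>The sign of carrying an odd generator of site i past the odd factors of earlier sites.
  It is a product of one sign per site, so that changing one site affects at most one
  factor.\<close>

definition bar_sign :: "state \<Rightarrow> nat \<Rightarrow> qv" where
  "bar_sign s i = (\<Prod>j\<in>{1..<i}. if snd (s j) then - 1 else 1)"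

lemma bar_sign_sq [simp]: "bar_sign s i * bar_sign s i = 1" "bar_sign s i * (bar_sign s i * c) = c"
proof -
  show "bar_sign s i * bar_sign s i = 1"
    unfolding bar_sign_def prod.distrib[symmetric] by (rule prod.neutral) auto
  then show "bar_sign s i * (bar_sign s i * c) = c" by (simp flip: mult.assoc)
qed

lemma bar_sign_Suc [simp]: "1 \<le> i \<Longrightarrow> bar_sign s (Suc i) = (if snd (s i) then - bar_sign s i else bar_sign s i)"
  by (simp add: bar_sign_def atLeastLessThanSuc)

lemma bar_sign_upd:
  "bar_sign (s(k := p)) i = (if k \<in> {1..<i} \<and> snd p \<noteq> snd (s k) then - bar_sign s i else bar_sign s i)"
proof (cases "k \<in> {1..<i}")
  case True
  have "(\<Prod>j\<in>{1..<i} - {k}. if snd ((s(k := p)) j) then - 1 else 1) =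
      (\<Prod>j\<in>{1..<i} - {k}. if snd (s j) then - 1 else (1 :: qv))"
    by (rule prod.cong) auto
  with True show ?thesis
    unfolding bar_sign_def by (simp only: prod.remove[OF finite_atLeastLessThan True]) auto
next
  case False
  then show ?thesis by (auto simp: bar_sign_def intro!: prod.cong)
qed

definition bar_sq :: qv where
  "bar_sq = (\<upsilon> - inverse \<upsilon>) / (\<upsilon> + inverse \<upsilon>)"

text \<open>\<open>f\<close> is evaluated on the monomial multiplied from the left by a generator.
  If site i already carries its odd factor, the square relation yields \<open>bar_sq\<close> times
  the square of the even generator, hence the exponent raised by 2.\<close>

primrec dual_chi :: "idx \<Rightarrow> (state \<Rightarrow> qv) \<Rightarrow> state \<Rightarrow> qv" where
  "dual_chi (Or i) f s = f (s(i := (fst (s i) + 1, snd (s i))))"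
| "dual_chi (Bar i) f s = bar_sign s i *
     (if snd (s i) then bar_sq * f (s(i := (fst (s i) + 2, False))) else f (s(i := (fst (s i), True))))"

text \<open>The odd case shows no quantum integer because [0] = 0 and [1] = 1.\<close>

primrec dual_pd :: "idx \<Rightarrow> (state \<Rightarrow> qv) \<Rightarrow> state \<Rightarrow> qv" where
  "dual_pd (Or i) f s = qint (fst (s i)) * f (s(i := (fst (s i) - 1, snd (s i))))"
| "dual_pd (Bar i) f s = (if snd (s i) then bar_sign s i * f (s(i := (fst (s i), False))) else 0)"

primrec exponent :: "state \<Rightarrow> idx \<Rightarrow> int" where
  "exponent s (Or i) = fst (s i)"
| "exponent s (Bar i) = of_bool (snd (s i))"

text \<open>Transposes of composites: the diagonal factor acts first on a monomial, so it stands
  outermost and is evaluated at the original state; \<open>dual_pd\<close> follows, and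
  \<open>dual_chi\<close>, which acts last, is innermost.\<close>

primrec dual_U :: "qn_gen \<Rightarrow> (state \<Rightarrow> qv) \<Rightarrow> state \<Rightarrow> qv" where
  "dual_U (KG i) f s = \<upsilon> powi (exponent s (Or i) + exponent s (Bar i)) * f s"
| "dual_U (KinvG i) f s = \<upsilon> powi (- (exponent s (Or i) + exponent s (Bar i))) * f s"
| "dual_U (EG h) f s = \<upsilon> powi exponent s (Bar (Suc h)) * dual_pd (Or (Suc h)) (dual_chi (Or h) f) s
     + (if snd (s h) then - 1 else 1) * \<upsilon> powi (- exponent s (Or (Suc h))) * dual_pd (Bar (Suc h)) (dual_chi (Bar h) f) s"
| "dual_U (FG h) f s = \<upsilon> powi (- exponent s (Bar h)) * dual_pd (Or h) (dual_chi (Or (Suc h)) f) s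
     + \<upsilon> powi exponent s (Or h) * dual_pd (Bar h) (dual_chi (Bar (Suc h)) f) s"
| "dual_U (KbG i) f s = \<upsilon> powi (- exponent s (Or i)) * dual_pd (Bar i) (dual_chi (Or i) f) s
     + \<upsilon> powi exponent s (Bar i) * dual_pd (Or i) (dual_chi (Bar i) f) s"
| "dual_U (EbG h) f s = (if snd (s h) then - 1 else 1) * \<upsilon> powi exponent s (Bar (Suc h)) * dual_pd (Or (Suc h)) (dual_chi (Bar h) f) s
     + \<upsilon> powi (- exponent s (Or (Suc h))) * dual_pd (Bar (Suc h)) (dual_chi (Or h) f) s"
| "dual_U (FbG h) f s = \<upsilon> powi (- exponent s (Bar h)) * dual_pd (Or h) (dual_chi (Bar (Suc h)) f) s
     + \<upsilon> powi exponent s (Or h) * dual_pd (Bar h) (dual_chi (Or (Suc h)) f) s"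

lemma lin_dual_U: "lin_op (dual_U g)"
  by (cases g) (auto simp: lin_op_def fun_eq_iff algebra_simps)

lemma lin_dual_chi: "lin_op (dual_chi p)"
  by (cases p) (auto simp: lin_op_def fun_eq_iff algebra_simps)

interpretation dual_U: dual_action dual_U
  by unfold_locales (rule lin_dual_U)

interpretation dual_chi: dual_action dual_chi
  by unfold_locales (rule lin_dual_chi)

section \<open>Normal forms on three consecutive sites\<close>

text \<open>The values at three neighbouring sites become free variables, so that updates inside the
  window normalize; the rest of \<open>s\<close> enters the coefficients only through
  \<open>bar_sign s i\<close>.\<close>

definition win :: "nat \<Rightarrow> state \<Rightarrow> int \<times> bool \<Rightarrow> int \<times> bool \<Rightarrow> int \<times> bool \<Rightarrow> state" where
  "win i s p q r = s(i := p, Suc i := q, Suc (Suc i) := r)"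

lemma win_self: "win i s (s i) (s (Suc i)) (s (Suc (Suc i))) = s"
  by (auto simp: win_def)

lemma win_simps [simp]:
  "win i s p q r i = p" "win i s p q r (Suc i) = q" "win i s p q r (Suc (Suc i)) = r"
  "(win i s p q r)(i := p') = win i s p' q r" "(win i s p q r)(Suc i := q') = win i s p q' r"
  "(win i s p q r)(Suc (Suc i) := r') = win i s p q r'"
  "bar_sign (win i s p q r) i = bar_sign s i"
  by (auto simp: win_def bar_sign_upd)

lemma state_win_cases: "(\<And>x b y d z e. P (win i s (x, b) (y, d) (z, e))) \<Longrightarrow> P s"
  by (metis win_self surj_pair)

lemma qint_field: "qint x = (\<upsilon> powi x * \<upsilon> - \<upsilon> / \<upsilon> powi x) / (\<upsilon> * \<upsilon> - 1)"
  using ups_diff_nonzero ups_sq_neq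
  by (simp add: qint_def field_simps power2_eq_square power_int_minus)

lemma bar_sq_field: "bar_sq = (\<upsilon> * \<upsilon> - 1) / (\<upsilon> * \<upsilon> + 1)"
proof -
  have "bar_sq = (\<upsilon> * (\<upsilon> - inverse \<upsilon>)) / (\<upsilon> * (\<upsilon> + inverse \<upsilon>))"
    unfolding bar_sq_def by (subst mult_divide_mult_cancel_left) simp_all
  then show ?thesis by (simp add: algebra_simps)
qed

lemma w_field: "1 / (\<upsilon> - 1 / \<upsilon>) = \<upsilon> / (\<upsilon> * \<upsilon> - 1)"
  using ups_diff_nonzero ups_sq_neq
  by (simp add: field_simps power2_eq_square)

lemma ups_nz: "\<upsilon> * \<upsilon> - 1 \<noteq> 0" "\<upsilon> * \<upsilon> + 1 \<noteq> 0" "\<upsilon> powi x \<noteq> 0"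
  using ups_sq_neq by (auto simp: power2_eq_square)

text \<open>Makes the denominator in the square relation for \<open>KbG\<close> invertible.\<close>

lemma ups_4: "\<upsilon> * (\<upsilon> * (\<upsilon> * \<upsilon>)) \<noteq> 1"
  using ups_power_eq_iff[of 4 0] by (simp add: power4_eq_xxxx mult.assoc)

lemma powi_field:
  "\<upsilon> powi (x + y) = \<upsilon> powi x * \<upsilon> powi y" "\<upsilon> powi (x - y) = \<upsilon> powi x / \<upsilon> powi y"
  "\<upsilon> powi (- x) = 1 / \<upsilon> powi x"
  "\<upsilon> powi (- numeral k) = 1 / \<upsilon> ^ numeral k"
  "\<upsilon> powi (- 1) = 1 / \<upsilon>" "inverse \<upsilon> = 1 / \<upsilon>"
  by (simp_all add: power_int_add power_int_diff power_int_minus field_simps)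
text \<open>Orients shifted exponents as \<open>x + c\<close>, so that equal states reached by
  different routes become syntactically equal.\<close>

lemma int_right: "1 + x = x + (1 :: int)" "numeral k + x = x + (numeral k :: int)"
  "- 1 + x = x - (1 :: int)" "- numeral k + x = x - (numeral k :: int)"
  by auto

lemma qint_shift1:
  "qint (x + 1) = \<upsilon> * qint x + 1 / \<upsilon> powi x"
  "qint (x - 1) = qint x / \<upsilon> - 1 / \<upsilon> powi x"
  using ups_nz by (simp_all add: qint_field powi_field divide_simps) (simp_all add: algebra_simps)

text \<open>Quantum integers at a common site are expressed by the one at \<open>x\<close> and a single power of \<open>\<upsilon>\<close>. The
  operators of type E involve \<open>qint x\<close> and \<open>\<upsilon> powi (- x)\<close>, those of type F \<open>qint x\<close> and
  \<open>\<upsilon> powi x\<close>, and with the matching expansion no denominator \<open>\<upsilon> - inverse \<upsilon>\<close> is left.\<close>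

lemma qint_shiftE:
  "qint (x + 1) = \<upsilon> * qint x + 1 / \<upsilon> powi x"
  "qint (x + 2) = \<upsilon> * (\<upsilon> * qint x + 1 / \<upsilon> powi x) + 1 / (\<upsilon> powi x * \<upsilon>)"
  "qint (x + 3) = \<upsilon> * (\<upsilon> * (\<upsilon> * qint x + 1 / \<upsilon> powi x) + 1 / (\<upsilon> powi x * \<upsilon>)) + 1 / (\<upsilon> powi x * \<upsilon>\<^sup>2)"
  "qint (x - 1) = qint x / \<upsilon> - 1 / \<upsilon> powi x"
  "qint (x - 2) = (qint x / \<upsilon> - 1 / \<upsilon> powi x) / \<upsilon> - \<upsilon> / \<upsilon> powi x"
  using qint_shift1[of x] qint_shift1(1)[of "x + 1"] qint_shift1(1)[of "x + 2"] qint_shift1(2)[of "x - 1"] by (simp_all add: powi_field int_right)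

text \<open>The recursion of \<open>qint_shift1\<close> under inversion of \<upsilon>, which leaves
  every \<open>qint x\<close> unchanged.\<close>

lemma qint_shift1':
  "qint (x + 1) = qint x / \<upsilon> + \<upsilon> powi x"
  "qint (x - 1) = \<upsilon> * qint x - \<upsilon> powi x"
  using ups_nz by (simp_all add: qint_field powi_field divide_simps) (simp_all add: algebra_simps)

lemma qint_shiftF:
  "qint (x + 1) = qint x / \<upsilon> + \<upsilon> powi x"
  "qint (x + 2) = (qint x / \<upsilon> + \<upsilon> powi x) / \<upsilon> + \<upsilon> powi x * \<upsilon>"
  "qint (x + 3) = ((qint x / \<upsilon> + \<upsilon> powi x) / \<upsilon> + \<upsilon> powi x * \<upsilon>) / \<upsilon> + \<upsilon> powi x * \<upsilon>\<^sup>2"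
  "qint (x - 1) = \<upsilon> * qint x - \<upsilon> powi x"
  "qint (x - 2) = \<upsilon> * (\<upsilon> * qint x - \<upsilon> powi x) - \<upsilon> powi x / \<upsilon>"
  using qint_shift1'[of x] qint_shift1'(1)[of "x + 1"] qint_shift1'(1)[of "x + 2"] qint_shift1'(2)[of "x - 1"] by (simp_all add: powi_field int_right)

section \<open>Relations on coinciding or overlapping sites\<close>

text \<open>From even exponent x without odd factor, the two steps pass through exponent x - 1 with
  an odd factor. The return contributes \<open>\<upsilon> powi (1 - x)\<close> and \<upsilon> [x-1]
  times \<open>bar_sq\<close>, with sum (\<open>\<upsilon> powi x\<close> +
  \<open>\<upsilon> powi (-x)\<close>) / (\<upsilon> + \<open>inverse \<upsilon>\<close>); the value
  of \<open>bar_sq\<close> is what makes this closed form appear.\<close>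

lemma rel_KbKb_same:
  assumes "1 \<le> i"
  shows "2 * dual_U (KbG i) (dual_U (KbG i) f) s =
     2 / (\<upsilon> ^ 2 - 1 / \<upsilon> ^ 2) * (dual_U (KG i) (dual_U (KG i) f) s - dual_U (KinvG i) (dual_U (KinvG i) f) s)"
  \<comment> \<open>Splitting on the odd flags decides every conditional and every sign. What
    remains compares coefficients of \<open>f\<close> at the same few states, as rational functions
    of \<upsilon> and of its powers with the even exponents.\<close>
  apply (rule state_win_cases[where i = i and s = s])
  subgoal for x b y d z e
    using assms ups_nz(1) ups_4
    apply (cases b; cases d; simp add: int_right)
    apply (simp_all add: qint_field powi_field bar_sq_field w_field)
    apply (simp_all add: divide_simps ups_nz)
    apply (simp_all add: algebra_simps power2_eq_square power3_eq_cube power4_eq_xxxx)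
    done
  done

text \<open>A dual operator written outermost acts first on monomials, so every product of the
  defining relation appears here in reverse order.\<close>

lemma rel_Kb_E:
  assumes "1 \<le> i"
  shows "dual_U (EG i) (dual_U (KbG i) f) s - \<upsilon> * dual_U (KbG i) (dual_U (EG i) f) s =
     dual_U (KinvG i) (dual_U (EbG i) f) s"
  apply (rule state_win_cases[where i = i and s = s])
  subgoal for x b y d z e
    using assms ups_nz(1)
    apply (cases b; cases d; simp add: int_right)
    apply (simp_all add: qint_field powi_field bar_sq_field w_field)
    apply (simp_all add: divide_simps ups_nz)
    apply (simp_all add: algebra_simps power2_eq_square power3_eq_cube power4_eq_xxxx)
    done
  done

lemma rel_Kb_E_Suc:
  assumes "1 \<le> i"
  shows "\<upsilon> * dual_U (EG i) (dual_U (KbG (Suc i)) f) s - dual_U (KbG (Suc i)) (dual_U (EG i) f) s =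
     - dual_U (EbG i) (dual_U (KinvG (Suc i)) f) s"
  apply (rule state_win_cases[where i = i and s = s])
  subgoal for x b y d z e
    using assms ups_nz(1)
    apply (cases b; cases d; simp add: int_right)
    apply (simp_all add: qint_field powi_field bar_sq_field w_field)
    apply (simp_all add: divide_simps ups_nz)
    apply (simp_all add: algebra_simps power2_eq_square power3_eq_cube power4_eq_xxxx)
    done
  done

lemma rel_Kb_F:
  assumes "1 \<le> i"
  shows "dual_U (FG i) (dual_U (KbG i) f) s - \<upsilon> * dual_U (KbG i) (dual_U (FG i) f) s =
     - dual_U (KG i) (dual_U (FbG i) f) s"
  apply (rule state_win_cases[where i = i and s = s])
  subgoal for x b y d z e
    using assms ups_nz(1)
    apply (cases b; cases d; simp add: int_right)
    apply (simp_all add: qint_field powi_field bar_sq_field w_field)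
    apply (simp_all add: divide_simps ups_nz)
    apply (simp_all add: algebra_simps power2_eq_square power3_eq_cube power4_eq_xxxx)
    done
  done

lemma rel_Kb_F_Suc:
  assumes "1 \<le> i"
  shows "\<upsilon> * dual_U (FG i) (dual_U (KbG (Suc i)) f) s - dual_U (KbG (Suc i)) (dual_U (FG i) f) s =
     dual_U (FbG i) (dual_U (KG (Suc i)) f) s"
  apply (rule state_win_cases[where i = i and s = s])
  subgoal for x b y d z e
    using assms ups_nz(1)
    apply (cases b; cases d; simp add: int_right)
    apply (simp_all add: qint_field powi_field bar_sq_field w_field)
    apply (simp_all add: divide_simps ups_nz)
    apply (simp_all add: algebra_simps power2_eq_square power3_eq_cube power4_eq_xxxx)
    done
  done

lemma rel_E_F_same:
  assumes "1 \<le> i"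
  shows "dual_U (FG i) (dual_U (EG i) f) s - dual_U (EG i) (dual_U (FG i) f) s =
     1 / (\<upsilon> - inverse \<upsilon>) * (dual_U (KinvG (Suc i)) (dual_U (KG i) f) s - dual_U (KG (Suc i)) (dual_U (KinvG i) f) s)"
  apply (rule state_win_cases[where i = i and s = s])
  subgoal for x b y d z e
    using assms ups_nz(1)
    apply (cases b; cases d; simp add: int_right)
    apply (simp_all add: qint_field powi_field bar_sq_field w_field)
    apply (simp_all add: divide_simps ups_nz)
    apply (simp_all add: algebra_simps power2_eq_square power3_eq_cube power4_eq_xxxx)
    done
  done

lemma rel_E_Fb_same:
  assumes "1 \<le> i"
  shows "dual_U (FbG i) (dual_U (EG i) f) s - dual_U (EG i) (dual_U (FbG i) f) s =
     dual_U (KbG i) (dual_U (KinvG (Suc i)) f) s - dual_U (KinvG i) (dual_U (KbG (Suc i)) f) s"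
  apply (rule state_win_cases[where i = i and s = s])
  subgoal for x b y d z e
    using assms ups_nz(1)
    apply (cases b; cases d; simp add: int_right)
    apply (simp_all add: qint_field powi_field bar_sq_field w_field)
    apply (simp_all add: divide_simps ups_nz)
    apply (simp_all add: algebra_simps power2_eq_square power3_eq_cube power4_eq_xxxx)
    done
  done

lemma rel_Eb_F_same:
  assumes "1 \<le> i"
  shows "dual_U (FG i) (dual_U (EbG i) f) s - dual_U (EbG i) (dual_U (FG i) f) s =
     dual_U (KbG i) (dual_U (KG (Suc i)) f) s - dual_U (KG i) (dual_U (KbG (Suc i)) f) s"
  apply (rule state_win_cases[where i = i and s = s])
  subgoal for x b y d z e
    using assms ups_nz(1)
    apply (cases b; cases d; simp add: int_right)
    apply (simp_all add: qint_field powi_field bar_sq_field w_field)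
    apply (simp_all add: divide_simps ups_nz)
    apply (simp_all add: algebra_simps power2_eq_square power3_eq_cube power4_eq_xxxx)
    done
  done

text \<open>Both operators take a unit out of the middle site, so their coefficients interact there.
  On sites without odd factors either order gives [y] [y-1], with y the middle exponent.\<close>

lemma rel_E_F_Suc:
  assumes "1 \<le> i"
  shows "dual_U (FG (Suc i)) (dual_U (EG i) f) s =
     dual_U (EG i) (dual_U (FG (Suc i)) f) s"
  apply (rule state_win_cases[where i = i and s = s])
  subgoal for x b y d z e
    using assms ups_nz(2)
    apply (cases b; cases d; cases e; simp add: int_right)
    apply (simp_all add: powi_field qint_shiftE bar_sq_field)
    apply (simp_all add: divide_simps)
    apply (simp_all add: algebra_simps power2_eq_square power3_eq_cube power4_eq_xxxx)
    done
  done

text \<open>Both operators put a unit into the middle site, and two odd units arriving there are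
  merged by the square relation.\<close>

lemma rel_E_F_Suc2:
  assumes "1 \<le> i"
  shows "dual_U (FG i) (dual_U (EG (Suc i)) f) s =
     dual_U (EG (Suc i)) (dual_U (FG i) f) s"
  apply (rule state_win_cases[where i = i and s = s])
  subgoal for x b y d z e
    using assms ups_nz(2)
    apply (cases b; cases d; cases e; simp add: int_right)
    apply (simp_all add: powi_field qint_shiftE bar_sq_field)
    apply (simp_all add: divide_simps)
    apply (simp_all add: algebra_simps power2_eq_square power3_eq_cube power4_eq_xxxx)
    done
  done

lemma rel_E_Fb_Suc:
  assumes "1 \<le> i"
  shows "dual_U (FbG (Suc i)) (dual_U (EG i) f) s =
     dual_U (EG i) (dual_U (FbG (Suc i)) f) s"
  apply (rule state_win_cases[where i = i and s = s])
  subgoal for x b y d z e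
    using assms ups_nz(2)
    apply (cases b; cases d; cases e; simp add: int_right)
    apply (simp_all add: powi_field qint_shiftE bar_sq_field)
    apply (simp_all add: divide_simps)
    apply (simp_all add: algebra_simps power2_eq_square power3_eq_cube power4_eq_xxxx)
    done
  done

lemma rel_E_Fb_Suc2:
  assumes "1 \<le> i"
  shows "dual_U (FbG i) (dual_U (EG (Suc i)) f) s =
     dual_U (EG (Suc i)) (dual_U (FbG i) f) s"
  apply (rule state_win_cases[where i = i and s = s])
  subgoal for x b y d z e
    using assms ups_nz(2)
    apply (cases b; cases d; cases e; simp add: int_right)
    apply (simp_all add: powi_field qint_shiftE bar_sq_field)
    apply (simp_all add: divide_simps)
    apply (simp_all add: algebra_simps power2_eq_square power3_eq_cube power4_eq_xxxx)
    done
  done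

lemma rel_Eb_F_Suc:
  assumes "1 \<le> i"
  shows "dual_U (FG (Suc i)) (dual_U (EbG i) f) s =
     dual_U (EbG i) (dual_U (FG (Suc i)) f) s"
  apply (rule state_win_cases[where i = i and s = s])
  subgoal for x b y d z e
    using assms ups_nz(2)
    apply (cases b; cases d; cases e; simp add: int_right)
    apply (simp_all add: powi_field qint_shiftE bar_sq_field)
    apply (simp_all add: divide_simps)
    apply (simp_all add: algebra_simps power2_eq_square power3_eq_cube power4_eq_xxxx)
    done
  done

lemma rel_Eb_F_Suc2:
  assumes "1 \<le> i"
  shows "dual_U (FG i) (dual_U (EbG (Suc i)) f) s =
     dual_U (EbG (Suc i)) (dual_U (FG i) f) s"
  apply (rule state_win_cases[where i = i and s = s])
  subgoal for x b y d z e
    using assms ups_nz(2)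
    apply (cases b; cases d; cases e; simp add: int_right)
    apply (simp_all add: powi_field qint_shiftE bar_sq_field)
    apply (simp_all add: divide_simps)
    apply (simp_all add: algebra_simps power2_eq_square power3_eq_cube power4_eq_xxxx)
    done
  done

lemma rel_E_Eb:
  assumes "1 \<le> i"
  shows "dual_U (EbG i) (dual_U (EG i) f) s =
     dual_U (EG i) (dual_U (EbG i) f) s"
  apply (rule state_win_cases[where i = i and s = s])
  subgoal for x b y d z e
    using assms ups_nz(1)
    apply (cases b; cases d; simp add: int_right)
    apply (simp_all add: qint_field powi_field bar_sq_field w_field)
    apply (simp_all add: divide_simps ups_nz)
    apply (simp_all add: algebra_simps power2_eq_square power3_eq_cube power4_eq_xxxx)
    done
  done

lemma rel_F_Fb:
  assumes "1 \<le> i"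
  shows "dual_U (FbG i) (dual_U (FG i) f) s =
     dual_U (FG i) (dual_U (FbG i) f) s"
  apply (rule state_win_cases[where i = i and s = s])
  subgoal for x b y d z e
    using assms ups_nz(1)
    apply (cases b; cases d; simp add: int_right)
    apply (simp_all add: qint_field powi_field bar_sq_field w_field)
    apply (simp_all add: divide_simps ups_nz)
    apply (simp_all add: algebra_simps power2_eq_square power3_eq_cube power4_eq_xxxx)
    done
  done

text \<open>Let y and z be the even exponents of the second and third site, without odd factors. The
  left side moves a unit from the third to the first site with coefficient [z] ([y+1] - \<upsilon>
  [y]) = \<open>\<upsilon> powi (-y)\<close> [z]. On the right the terms with two odd factors cancel
  and this same coefficient remains.\<close>

lemma rel_E_E_Suc:
  assumes "1 \<le> i"
  shows "dual_U (EG (Suc i)) (dual_U (EG i) f) s - \<upsilon> * dual_U (EG i) (dual_U (EG (Suc i)) f) s =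
     dual_U (EbG (Suc i)) (dual_U (EbG i) f) s + \<upsilon> * dual_U (EbG i) (dual_U (EbG (Suc i)) f) s"
  apply (rule state_win_cases[where i = i and s = s])
  subgoal for x b y d z e
    using assms ups_nz(2)
    apply (cases b; cases d; cases e; simp add: int_right)
    apply (simp_all add: powi_field qint_shiftE bar_sq_field)
    apply (simp_all add: divide_simps)
    apply (simp_all add: algebra_simps power2_eq_square power3_eq_cube power4_eq_xxxx)
    done
  done

lemma rel_F_F_Suc:
  assumes "1 \<le> i"
  shows "\<upsilon> * dual_U (FG i) (dual_U (FG (Suc i)) f) s - dual_U (FG (Suc i)) (dual_U (FG i) f) s =
     dual_U (FbG (Suc i)) (dual_U (FbG i) f) s + \<upsilon> * dual_U (FbG i) (dual_U (FbG (Suc i)) f) s"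
  apply (rule state_win_cases[where i = i and s = s])
  subgoal for x b y d z e
    using assms ups_nz(2)
    apply (cases b; cases d; cases e; simp add: int_right)
    apply (simp_all add: powi_field qint_shiftF bar_sq_field)
    apply (simp_all add: divide_simps)
    apply (simp_all add: algebra_simps power2_eq_square power3_eq_cube power4_eq_xxxx)
    done
  done

text \<open>Without odd factors this is [z] [y] times the recursion [y+1] - (\<upsilon> +
  \<open>inverse \<upsilon>\<close>) [y] + [y-1] = 0 in the exponent y of the middle site, with z
  that of the third. The other flag patterns are left to the same comparison of
  coefficients.\<close>

lemma rel_serre_E_Suc:
  assumes "1 \<le> i"
  shows "dual_U (EG (Suc i)) (dual_U (EG i) (dual_U (EG i) f)) s - (\<upsilon> + inverse \<upsilon>) * dual_U (EG i) (dual_U (EG (Suc i)) (dual_U (EG i) f)) s + dual_U (EG i) (dual_U (EG i) (dual_U (EG (Suc i)) f)) s =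
     0"
  apply (rule state_win_cases[where i = i and s = s])
  subgoal for x b y d z e
    using assms ups_nz(2)
    apply (cases b; cases d; cases e; simp add: int_right)
    apply (simp_all add: powi_field qint_shiftE bar_sq_field)
    apply (simp_all add: divide_simps)
    apply (simp_all add: algebra_simps power2_eq_square power3_eq_cube power4_eq_xxxx)
    done
  done

lemma rel_serre_E_Suc2:
  assumes "1 \<le> i"
  shows "dual_U (EG i) (dual_U (EG (Suc i)) (dual_U (EG (Suc i)) f)) s - (\<upsilon> + inverse \<upsilon>) * dual_U (EG (Suc i)) (dual_U (EG i) (dual_U (EG (Suc i)) f)) s + dual_U (EG (Suc i)) (dual_U (EG (Suc i)) (dual_U (EG i) f)) s =
     0"
  apply (rule state_win_cases[where i = i and s = s])
  subgoal for x b y d z e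
    using assms ups_nz(2)
    apply (cases b; cases d; cases e; simp add: int_right)
    apply (simp_all add: powi_field qint_shiftE bar_sq_field)
    apply (simp_all add: divide_simps)
    apply (simp_all add: algebra_simps power2_eq_square power3_eq_cube power4_eq_xxxx)
    done
  done

lemma rel_serre_Eb_Suc:
  assumes "1 \<le> i"
  shows "dual_U (EbG (Suc i)) (dual_U (EG i) (dual_U (EG i) f)) s - (\<upsilon> + inverse \<upsilon>) * dual_U (EG i) (dual_U (EbG (Suc i)) (dual_U (EG i) f)) s + dual_U (EG i) (dual_U (EG i) (dual_U (EbG (Suc i)) f)) s =
     0"
  apply (rule state_win_cases[where i = i and s = s])
  subgoal for x b y d z e
    using assms ups_nz(2)
    apply (cases b; cases d; cases e; simp add: int_right)
    apply (simp_all add: powi_field qint_shiftE bar_sq_field)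
    apply (simp_all add: divide_simps)
    apply (simp_all add: algebra_simps power2_eq_square power3_eq_cube power4_eq_xxxx)
    done
  done

lemma rel_serre_Eb_Suc2:
  assumes "1 \<le> i"
  shows "dual_U (EbG i) (dual_U (EG (Suc i)) (dual_U (EG (Suc i)) f)) s - (\<upsilon> + inverse \<upsilon>) * dual_U (EG (Suc i)) (dual_U (EbG i) (dual_U (EG (Suc i)) f)) s + dual_U (EG (Suc i)) (dual_U (EG (Suc i)) (dual_U (EbG i) f)) s =
     0"
  apply (rule state_win_cases[where i = i and s = s])
  subgoal for x b y d z e
    using assms ups_nz(2)
    apply (cases b; cases d; cases e; simp add: int_right)
    apply (simp_all add: powi_field qint_shiftE bar_sq_field)
    apply (simp_all add: divide_simps)
    apply (simp_all add: algebra_simps power2_eq_square power3_eq_cube power4_eq_xxxx)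
    done
  done

lemma rel_serre_F_Suc:
  assumes "1 \<le> i"
  shows "dual_U (FG (Suc i)) (dual_U (FG i) (dual_U (FG i) f)) s - (\<upsilon> + inverse \<upsilon>) * dual_U (FG i) (dual_U (FG (Suc i)) (dual_U (FG i) f)) s + dual_U (FG i) (dual_U (FG i) (dual_U (FG (Suc i)) f)) s =
     0"
  apply (rule state_win_cases[where i = i and s = s])
  subgoal for x b y d z e
    using assms ups_nz(2)
    apply (cases b; cases d; cases e; simp add: int_right)
    apply (simp_all add: powi_field qint_shiftF bar_sq_field)
    apply (simp_all add: divide_simps)
    apply (simp_all add: algebra_simps power2_eq_square power3_eq_cube power4_eq_xxxx)
    done
  done

lemma rel_serre_F_Suc2:
  assumes "1 \<le> i"
  shows "dual_U (FG i) (dual_U (FG (Suc i)) (dual_U (FG (Suc i)) f)) s - (\<upsilon> + inverse \<upsilon>) * dual_U (FG (Suc i)) (dual_U (FG i) (dual_U (FG (Suc i)) f)) s + dual_U (FG (Suc i)) (dual_U (FG (Suc i)) (dual_U (FG i) f)) s =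
     0"
  apply (rule state_win_cases[where i = i and s = s])
  subgoal for x b y d z e
    using assms ups_nz(2)
    apply (cases b; cases d; cases e; simp add: int_right)
    apply (simp_all add: powi_field qint_shiftF bar_sq_field)
    apply (simp_all add: divide_simps)
    apply (simp_all add: algebra_simps power2_eq_square power3_eq_cube power4_eq_xxxx)
    done
  done

lemma rel_serre_Fb_Suc:
  assumes "1 \<le> i"
  shows "dual_U (FbG (Suc i)) (dual_U (FG i) (dual_U (FG i) f)) s - (\<upsilon> + inverse \<upsilon>) * dual_U (FG i) (dual_U (FbG (Suc i)) (dual_U (FG i) f)) s + dual_U (FG i) (dual_U (FG i) (dual_U (FbG (Suc i)) f)) s =
     0"
  apply (rule state_win_cases[where i = i and s = s])
  subgoal for x b y d z e
    using assms ups_nz(2)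
    apply (cases b; cases d; cases e; simp add: int_right)
    apply (simp_all add: powi_field qint_shiftF bar_sq_field)
    apply (simp_all add: divide_simps)
    apply (simp_all add: algebra_simps power2_eq_square power3_eq_cube power4_eq_xxxx)
    done
  done

lemma rel_serre_Fb_Suc2:
  assumes "1 \<le> i"
  shows "dual_U (FbG i) (dual_U (FG (Suc i)) (dual_U (FG (Suc i)) f)) s - (\<upsilon> + inverse \<upsilon>) * dual_U (FG (Suc i)) (dual_U (FbG i) (dual_U (FG (Suc i)) f)) s + dual_U (FG (Suc i)) (dual_U (FG (Suc i)) (dual_U (FbG i) f)) s =
     0"
  apply (rule state_win_cases[where i = i and s = s])
  subgoal for x b y d z e
    using assms ups_nz(2)
    apply (cases b; cases d; cases e; simp add: int_right)
    apply (simp_all add: powi_field qint_shiftF bar_sq_field)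
    apply (simp_all add: divide_simps)
    apply (simp_all add: algebra_simps power2_eq_square power3_eq_cube power4_eq_xxxx)
    done
  done

section \<open>Relations on disjoint sites\<close>

text \<open>An even operator changes odd flags only in pairs within its two sites, so at a later
  site the two sign changes cancel. The same reason applies when the operator on the other pair is
  odd.\<close>

lemma rel_far_E_E:
  assumes "1 \<le> i" "Suc i < j"
  shows "dual_U (EG j) (dual_U (EG i) f) s =
     dual_U (EG i) (dual_U (EG j) f) s"
  apply (cases "s i"; cases "s (Suc i)"; cases "s j"; cases "s (Suc j)")
  subgoal for x b y d x' b' y' d'
    using assms
    apply (cases b; cases d; cases b'; cases d'; simp add: bar_sign_upd)
    apply (simp_all add: fun_upd_twist algebra_simps)
    done
  done

lemma rel_far_F_F:
  assumes "1 \<le> i" "Suc i < j"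
  shows "dual_U (FG j) (dual_U (FG i) f) s =
     dual_U (FG i) (dual_U (FG j) f) s"
  apply (cases "s i"; cases "s (Suc i)"; cases "s j"; cases "s (Suc j)")
  subgoal for x b y d x' b' y' d'
    using assms
    apply (cases b; cases d; cases b'; cases d'; simp add: bar_sign_upd)
    apply (simp_all add: fun_upd_twist algebra_simps)
    done
  done

lemma rel_far_E_F:
  assumes "1 \<le> i" "Suc i < j"
  shows "dual_U (FG j) (dual_U (EG i) f) s =
     dual_U (EG i) (dual_U (FG j) f) s"
  apply (cases "s i"; cases "s (Suc i)"; cases "s j"; cases "s (Suc j)")
  subgoal for x b y d x' b' y' d'
    using assms
    apply (cases b; cases d; cases b'; cases d'; simp add: bar_sign_upd)
    apply (simp_all add: fun_upd_twist algebra_simps)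
    done
  done

lemma rel_far_F_E:
  assumes "1 \<le> i" "Suc i < j"
  shows "dual_U (EG j) (dual_U (FG i) f) s =
     dual_U (FG i) (dual_U (EG j) f) s"
  apply (cases "s i"; cases "s (Suc i)"; cases "s j"; cases "s (Suc j)")
  subgoal for x b y d x' b' y' d'
    using assms
    apply (cases b; cases d; cases b'; cases d'; simp add: bar_sign_upd)
    apply (simp_all add: fun_upd_twist algebra_simps)
    done
  done

lemma rel_far_E_Fb:
  assumes "1 \<le> i" "Suc i < j"
  shows "dual_U (FbG j) (dual_U (EG i) f) s =
     dual_U (EG i) (dual_U (FbG j) f) s"
  apply (cases "s i"; cases "s (Suc i)"; cases "s j"; cases "s (Suc j)")
  subgoal for x b y d x' b' y' d'
    using assms
    apply (cases b; cases d; cases b'; cases d'; simp add: bar_sign_upd)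
    apply (simp_all add: fun_upd_twist algebra_simps)
    done
  done

lemma rel_far_Fb_E:
  assumes "1 \<le> i" "Suc i < j"
  shows "dual_U (EG j) (dual_U (FbG i) f) s =
     dual_U (FbG i) (dual_U (EG j) f) s"
  apply (cases "s i"; cases "s (Suc i)"; cases "s j"; cases "s (Suc j)")
  subgoal for x b y d x' b' y' d'
    using assms
    apply (cases b; cases d; cases b'; cases d'; simp add: bar_sign_upd)
    apply (simp_all add: fun_upd_twist algebra_simps)
    done
  done

lemma rel_far_Eb_F:
  assumes "1 \<le> i" "Suc i < j"
  shows "dual_U (FG j) (dual_U (EbG i) f) s =
     dual_U (EbG i) (dual_U (FG j) f) s"
  apply (cases "s i"; cases "s (Suc i)"; cases "s j"; cases "s (Suc j)")
  subgoal for x b y d x' b' y' d'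
    using assms
    apply (cases b; cases d; cases b'; cases d'; simp add: bar_sign_upd)
    apply (simp_all add: fun_upd_twist algebra_simps)
    done
  done

lemma rel_far_F_Eb:
  assumes "1 \<le> i" "Suc i < j"
  shows "dual_U (EbG j) (dual_U (FG i) f) s =
     dual_U (FG i) (dual_U (EbG j) f) s"
  apply (cases "s i"; cases "s (Suc i)"; cases "s j"; cases "s (Suc j)")
  subgoal for x b y d x' b' y' d'
    using assms
    apply (cases b; cases d; cases b'; cases d'; simp add: bar_sign_upd)
    apply (simp_all add: fun_upd_twist algebra_simps)
    done
  done

text \<open>The odd operator at the earlier site changes exactly one flag before site j and thereby
  reverses \<open>bar_sign\<close> there; this is the anticommutation.\<close>

lemma rel_far_Kb_Kb:
  assumes "1 \<le> i" "i < j"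
  shows "dual_U (KbG j) (dual_U (KbG i) f) s + dual_U (KbG i) (dual_U (KbG j) f) s =
     0"
  apply (cases "s i"; cases "s j")
  subgoal for x b x' b'
    using assms
    apply (cases b; cases b'; simp add: bar_sign_upd)
    apply (simp_all add: fun_upd_twist algebra_simps)
    done
  done

lemma rel_far_Kb_E:
  assumes "1 \<le> i" "1 \<le> j" "i \<noteq> j" "i \<noteq> Suc j"
  shows "dual_U (EG j) (dual_U (KbG i) f) s =
     dual_U (KbG i) (dual_U (EG j) f) s"
  apply (cases "s i"; cases "s j"; cases "s (Suc j)")
  subgoal for x b x' b' y' d'
    using assms
    \<comment> \<open>The split on \<open>i < j\<close> decides which of the two operators sees the
      flags of the other in its sign.\<close>
    apply (cases b; cases b'; cases d'; cases "i < j"; simp add: bar_sign_upd)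
    apply (simp_all add: fun_upd_twist algebra_simps)
    done
  done

lemma rel_far_Kb_F:
  assumes "1 \<le> i" "1 \<le> j" "i \<noteq> j" "i \<noteq> Suc j"
  shows "dual_U (FG j) (dual_U (KbG i) f) s =
     dual_U (KbG i) (dual_U (FG j) f) s"
  apply (cases "s i"; cases "s j"; cases "s (Suc j)")
  subgoal for x b x' b' y' d'
    using assms
    apply (cases b; cases b'; cases d'; cases "i < j"; simp add: bar_sign_upd)
    apply (simp_all add: fun_upd_twist algebra_simps)
    done
  done

section \<open>The defining relations of both algebras, transposed\<close>

lemma idxs_mem [simp]: "Or i \<in> idxs n \<longleftrightarrow> i \<in> {1..n}" "Bar i \<in> idxs n \<longleftrightarrow> i \<in> {1..n}"
  by (auto simp: idxs_def)

lemma qn_gens_mem [simp]: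
  "KG i \<in> qn_gens n \<longleftrightarrow> i \<in> {1..n}" "KinvG i \<in> qn_gens n \<longleftrightarrow> i \<in> {1..n}"
  "KbG i \<in> qn_gens n \<longleftrightarrow> i \<in> {1..n}"
  "EG j \<in> qn_gens n \<longleftrightarrow> j \<in> {1..<n}" "FG j \<in> qn_gens n \<longleftrightarrow> j \<in> {1..<n}"
  "EbG j \<in> qn_gens n \<longleftrightarrow> j \<in> {1..<n}" "FbG j \<in> qn_gens n \<longleftrightarrow> j \<in> {1..<n}"
  by (auto simp: qn_gens_def)

lemma presentation_qpol: "presentation (idxs n) (qpol_rels n)"
  by (unfold_locales, erule qpol_rels.cases) auto

lemma presentation_qn: "presentation (qn_gens n) (qn_rels n)"
  by (unfold_locales, erule qn_rels.cases) auto

lemmas fev_sum_simps = dual_chi.fev_scal_mult dual_U.fev_scal_mult fev_uminus fev_add fev_diff fev_zero fev_one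
lemmas fev_prod_simps = dual_chi.fev_mult' dual_chi.fev_power2 dual_U.fev_mult' dual_U.fev_power2 fev_gen

text \<open>The left regular representation, transposed and written on states before anything is
  known about a basis. Once the relations are verified, every coset acts on functionals, and
  monomials can be told apart.\<close>

lemma dual_representation_dual_chi: "dual_representation (idxs n) (qpol_rels n) dual_chi"
proof (intro dual_representation.intro dual_representation_axioms.intro presentation_qpol dual_chi.dual_action_axioms)
  fix l r f s
  assume "(l, r) \<in> qpol_rels n"
  then show "fev dual_chi l f s = fev dual_chi r f s"
  proof cases
    case (XX i j)
    then show ?thesis by (cases "i = j") (auto simp: fev_prod_simps fun_upd_twist)
  next
    case (XXb i j)
    then show ?thesis
      by (cases "i = j") (auto simp: fev_prod_simps fun_upd_twist bar_sign_upd int_right)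
  next
    case (XbXb i j)
    then show ?thesis
      by (cases "i < j") (auto simp: fev_prod_simps fev_uminus fun_upd_twist bar_sign_upd)
  next
    case (Xb2 i)
    then show ?thesis
      by (simp only: fev_sum_simps prod.inject) (auto simp: fev_prod_simps bar_sign_upd bar_sq_def int_right)
  qed
qed

lemma dual_U_K_Kb: "dual_U (KG i) (dual_U (KbG j) f) s = dual_U (KbG j) (dual_U (KG i) f) s"
proof (cases "s j")
  case (Pair x b)
  then show ?thesis
    by (cases b; cases "i = j"; simp add: powi_field; simp add: field_simps power2_eq_square)
qed

lemma dual_U_K_K: "dual_U (KG i) (dual_U (KG j) f) s = dual_U (KG j) (dual_U (KG i) f) s"
  by (simp add: algebra_simps)

lemma dual_U_K_Kinv:
  "dual_U (KG i) (dual_U (KinvG i) f) s = f s" "dual_U (KinvG i) (dual_U (KG i) f) s = f s"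
  by (simp_all add: powi_field field_simps)

lemma dual_U_weight_EF:
  assumes "1 \<le> j"
  shows
  "dual_U (EG j) (dual_U (KG i) f) s = \<upsilon> powi (kdelta i j - kdelta i (j + 1)) * dual_U (KG i) (dual_U (EG j) f) s"
    (is ?E)
  and "dual_U (EbG j) (dual_U (KG i) f) s = \<upsilon> powi (kdelta i j - kdelta i (j + 1)) * dual_U (KG i) (dual_U (EbG j) f) s"
    (is ?Eb)
  and "dual_U (FG j) (dual_U (KG i) f) s = \<upsilon> powi (- (kdelta i j - kdelta i (j + 1))) * dual_U (KG i) (dual_U (FG j) f) s"
    (is ?F)
  and "dual_U (FbG j) (dual_U (KG i) f) s = \<upsilon> powi (- (kdelta i j - kdelta i (j + 1))) * dual_U (KG i) (dual_U (FbG j) f) s"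
    (is ?Fb)
proof -
  obtain x b y d where s: "s j = (x, b)" "s (Suc j) = (y, d)" by (metis surj_pair)
  consider "i = j" | "i = Suc j" | "i \<noteq> j" "i \<noteq> Suc j" by auto
  then have "?E \<and> ?Eb \<and> ?F \<and> ?Fb"
  proof cases
    case 1
    with assms s show ?thesis
      by (cases b; cases d; simp add: powi_field; simp add: field_simps power2_eq_square)
  next
    case 2
    with assms s show ?thesis
      by (cases b; cases d; simp add: powi_field; simp add: field_simps power2_eq_square)
  next
    case 3
    with assms s show ?thesis
      by (cases b; cases d; simp add: algebra_simps)
  qed
  then show ?E ?Eb ?F ?Fb by blast+
qed

lemma dual_representation_dual_U: "dual_representation (qn_gens n) (qn_rels n) dual_U"
proof (intro dual_representation.intro dual_representation_axioms.intro presentation_qn dual_U.dual_action_axioms)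
  fix l r f s
  assume "(l, r) \<in> qn_rels n"
  then show "fev dual_U l f s = fev dual_U r f s"
  proof cases
    case (QQ1e i j)
    consider "i = j" | "i < j" | "j < i" by linarith
    then show ?thesis
    proof cases
      case 1
      with QQ1e rel_KbKb_same[of i f s] show ?thesis
        by (simp only: fev_sum_simps prod.inject) (simp add: fev_prod_simps powi_field del: dual_U.simps)
    next
      case 2
      with QQ1e rel_far_Kb_Kb[of i j f s] show ?thesis
        by (simp only: fev_sum_simps prod.inject) (simp add: fev_prod_simps del: dual_U.simps)
    next
      case 3
      with QQ1e rel_far_Kb_Kb[of j i f s] show ?thesis
        by (simp only: fev_sum_simps prod.inject) (simp add: fev_prod_simps add.commute del: dual_U.simps)
    qed
  next
    case (QQ1a i)
    then show ?thesis
      using dual_U_K_Kinv[of i f s]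
      by (simp only: fev_sum_simps prod.inject) (auto simp: fev_prod_simps simp del: dual_U.simps)
  next
    case (QQ1b i)
    then show ?thesis
      using dual_U_K_Kinv[of i f s]
      by (simp only: fev_sum_simps prod.inject) (auto simp: fev_prod_simps simp del: dual_U.simps)
  next
    case (QQ1c i j)
    then show ?thesis
      using dual_U_K_K[of j i f s]
      by (simp only: fev_sum_simps prod.inject) (auto simp: fev_prod_simps simp del: dual_U.simps)
  next
    case (QQ1d i j)
    then show ?thesis
      using dual_U_K_Kb[of i j f s]
      by (simp only: fev_sum_simps prod.inject) (auto simp: fev_prod_simps simp del: dual_U.simps)
  next
    case (QQ2a i j)
    then show ?thesis
      using dual_U_weight_EF(1)[of j i f s]
      by (simp only: fev_sum_simps prod.inject) (auto simp: fev_prod_simps simp del: dual_U.simps)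
  next
    case (QQ2b i j)
    then show ?thesis
      using dual_U_weight_EF(3)[of j i f s]
      by (simp only: fev_sum_simps prod.inject) (auto simp: fev_prod_simps simp del: dual_U.simps)
  next
    case (QQ2c i j)
    then show ?thesis
      using dual_U_weight_EF(2)[of j i f s]
      by (simp only: fev_sum_simps prod.inject) (auto simp: fev_prod_simps simp del: dual_U.simps)
  next
    case (QQ2d i j)
    then show ?thesis
      using dual_U_weight_EF(4)[of j i f s]
      by (simp only: fev_sum_simps prod.inject) (auto simp: fev_prod_simps simp del: dual_U.simps)
  next
    case (QQ3a i j)
    then show ?thesis
      using rel_far_Kb_E[of i j f s]
      by (simp only: fev_sum_simps prod.inject) (auto simp: fev_prod_simps simp del: dual_U.simps)
  next
    case (QQ3b i j)
    then show ?thesis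
      using rel_far_Kb_F[of i j f s]
      by (simp only: fev_sum_simps prod.inject) (auto simp: fev_prod_simps simp del: dual_U.simps)
  next
    case (QQ3c j)
    then show ?thesis
      using rel_Kb_E[of j f s]
      by (simp only: fev_sum_simps prod.inject) (auto simp: fev_prod_simps simp del: dual_U.simps)
  next
    case (QQ3d j)
    then show ?thesis
      using rel_Kb_E_Suc[of j f s]
      by (simp only: fev_sum_simps prod.inject) (auto simp: fev_prod_simps simp del: dual_U.simps)
  next
    case (QQ3e j)
    then show ?thesis
      using rel_Kb_F[of j f s]
      by (simp only: fev_sum_simps prod.inject) (auto simp: fev_prod_simps simp del: dual_U.simps)
  next
    case (QQ3f j)
    then show ?thesis
      using rel_Kb_F_Suc[of j f s]
      by (simp only: fev_sum_simps prod.inject) (auto simp: fev_prod_simps simp del: dual_U.simps)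
  next
    case (QQ4a i j)
    \<comment> \<open>The two pairs of neighbouring sites coincide, share one site or are
      disjoint.\<close>
    consider "i = j" | "j = Suc i" | "i = Suc j" | "Suc i < j" | "Suc j < i" by linarith
    then show ?thesis
      using QQ4a rel_E_F_same[of i f s] rel_E_F_Suc[of i f s] rel_E_F_Suc2[of j f s] rel_far_E_F[of i j f s] rel_far_F_E[of j i f s]
      by cases (simp only: fev_sum_simps prod.inject, simp add: fev_prod_simps del: dual_U.simps)+
  next
    case (QQ4b i j)
    consider "i = j" | "j = Suc i" | "i = Suc j" | "Suc i < j" | "Suc j < i" by linarith
    then show ?thesis
      using QQ4b rel_E_Fb_same[of i f s] rel_E_Fb_Suc[of i f s] rel_E_Fb_Suc2[of j f s] rel_far_E_Fb[of i j f s] rel_far_Fb_E[of j i f s]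
      by cases (simp only: fev_sum_simps prod.inject, simp add: fev_prod_simps del: dual_U.simps)+
  next
    case (QQ4c i j)
    consider "i = j" | "j = Suc i" | "i = Suc j" | "Suc i < j" | "Suc j < i" by linarith
    then show ?thesis
      using QQ4c rel_Eb_F_same[of i f s] rel_Eb_F_Suc[of i f s] rel_Eb_F_Suc2[of j f s] rel_far_Eb_F[of i j f s] rel_far_F_Eb[of j i f s]
      by cases (simp only: fev_sum_simps prod.inject, simp add: fev_prod_simps del: dual_U.simps)+
  next
    case (QQ5a i j)
    then consider "Suc i < j" | "Suc j < i" by linarith
    then show ?thesis
      using QQ5a rel_far_E_E[of i j f s] rel_far_E_E[of j i f s]
      by cases (simp add: fev_prod_simps del: dual_U.simps)+
  next
    case (QQ5b i j)
    then consider "Suc i < j" | "Suc j < i" by linarith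
    then show ?thesis
      using QQ5b rel_far_F_F[of i j f s] rel_far_F_F[of j i f s]
      by cases (simp add: fev_prod_simps del: dual_U.simps)+
  next
    case (QQ5c i)
    then show ?thesis
      using rel_E_Eb[of i f s]
      by (simp only: fev_sum_simps prod.inject) (auto simp: fev_prod_simps simp del: dual_U.simps)
  next
    case (QQ5d i)
    then show ?thesis
      using rel_F_Fb[of i f s]
      by (simp only: fev_sum_simps prod.inject) (auto simp: fev_prod_simps simp del: dual_U.simps)
  next
    case (QQ5e i)
    then show ?thesis
      using rel_E_E_Suc[of i f s]
      by (simp only: fev_sum_simps prod.inject) (auto simp: fev_prod_simps simp del: dual_U.simps)
  next
    case (QQ5f i)
    then show ?thesis
      using rel_F_F_Suc[of i f s]
      by (simp only: fev_sum_simps prod.inject) (auto simp: fev_prod_simps simp del: dual_U.simps)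
  next
    case (QQ6a i j Z)
    then consider "i = Suc j" | "j = Suc i" by linarith
    then show ?thesis
      using QQ6a rel_serre_E_Suc[of i f s] rel_serre_E_Suc2[of j f s] rel_serre_Eb_Suc[of i f s] rel_serre_Eb_Suc2[of j f s]
      by cases (simp only: fev_sum_simps prod.inject, auto simp: fev_prod_simps simp del: dual_U.simps)+
  next
    case (QQ6b i j Z)
    then consider "i = Suc j" | "j = Suc i" by linarith
    then show ?thesis
      using QQ6b rel_serre_F_Suc[of i f s] rel_serre_F_Suc2[of j f s] rel_serre_Fb_Suc[of i f s] rel_serre_Fb_Suc2[of j f s]
      by cases (simp only: fev_sum_simps prod.inject, auto simp: fev_prod_simps simp del: dual_U.simps)+
  qed
qed

section \<open>The monomial basis\<close>

lemma submodule_QV_I: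
  assumes M: "module QV M" and "N \<subseteq> carrier M" "\<zero>\<^bsub>M\<^esub> \<in> N"
    and "\<And>x y. x \<in> N \<Longrightarrow> y \<in> N \<Longrightarrow> x \<oplus>\<^bsub>M\<^esub> y \<in> N"
    and smult: "\<And>c x. x \<in> N \<Longrightarrow> c \<odot>\<^bsub>M\<^esub> x \<in> N"
  shows "submodule N QV M"
proof -
  interpret module QV M by (rule M)
  show ?thesis
  proof (rule submoduleI)
    fix x assume x: "x \<in> N"
    then have xM: "x \<in> carrier M" using assms by auto
    \<comment> \<open>A negative is the multiple by -1, so closure under scalars takes care of
      it.\<close>
    have "\<ominus>\<^bsub>M\<^esub> x = (\<ominus>\<^bsub>QV\<^esub> 1) \<odot>\<^bsub>M\<^esub> x"
      using smult_l_minus[of 1 x] smult_one[OF xM] xM by simp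
    then show "\<ominus>\<^bsub>M\<^esub> x \<in> N" using smult x by simp
  qed (use assms in auto)
qed

lemma submodule_QV_D:
  assumes "module QV M" "submodule N QV M"
  shows "N \<subseteq> carrier M" "\<zero>\<^bsub>M\<^esub> \<in> N"
    "x \<in> N \<Longrightarrow> y \<in> N \<Longrightarrow> x \<oplus>\<^bsub>M\<^esub> y \<in> N" "x \<in> N \<Longrightarrow> c \<odot>\<^bsub>M\<^esub> x \<in> N"
proof -
  interpret module QV M by (rule assms)
  show "N \<subseteq> carrier M" "x \<in> N \<Longrightarrow> y \<in> N \<Longrightarrow> x \<oplus>\<^bsub>M\<^esub> y \<in> N" "x \<in> N \<Longrightarrow> c \<odot>\<^bsub>M\<^esub> x \<in> N"
    using submoduleE[OF assms(2)] by auto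
  show "\<zero>\<^bsub>M\<^esub> \<in> N"
    using subgroup.one_closed[OF submodule.axioms(1)[OF assms(2)]] by simp
qed

lemma lin_span_minimal: "submodule N R M \<Longrightarrow> S \<subseteq> N \<Longrightarrow> lin_span R M S \<subseteq> N"
  by (auto simp: lin_span_def)

lemma lin_span_superset: "S \<subseteq> lin_span R M S"
  by (auto simp: lin_span_def)

lemma submodule_lin_span:
  assumes M: "module QV M" and "S \<subseteq> carrier M"
  shows "submodule (lin_span QV M S) QV M"
proof (rule submodule_QV_I[OF M])
  show "lin_span QV M S \<subseteq> carrier M"
    by (rule lin_span_minimal[OF module.carrier_is_submodule[OF M] assms(2)])
qed (use submodule_QV_D[OF M] in \<open>auto simp: lin_span_def\<close>)

lemma scal_left_commute: "x * (scal c * y) = scal c * (x * y)"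
  by (metis mult.assoc scal_commute)

context presentation
begin

lemma smult_mult:
  assumes "x \<in> carrier A" "y \<in> carrier A"
  shows "(c \<odot>\<^bsub>A\<^esub> x) \<otimes>\<^bsub>A\<^esub> y = c \<odot>\<^bsub>A\<^esub> (x \<otimes>\<^bsub>A\<^esub> y)"
    "x \<otimes>\<^bsub>A\<^esub> (c \<odot>\<^bsub>A\<^esub> y) = c \<odot>\<^bsub>A\<^esub> (x \<otimes>\<^bsub>A\<^esub> y)"
  using assms by (auto simp: carrier_A cl_hom cl_smult mult.assoc scal_left_commute)

lemma word_Cons:
  assumes "g \<in> G" "set w \<subseteq> G"
  shows "cl (Poly_Mapping.single (Wd (g # w)) c) = cl (gen g) \<otimes>\<^bsub>A\<^esub> cl (Poly_Mapping.single (Wd w) c)"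
  using assms by (simp add: single_Cons cl_hom)

lemma carrier_induct [consumes 1, case_names zero add smult word]:
  assumes "u \<in> carrier A" and zero: "P \<zero>\<^bsub>A\<^esub>"
    and add: "\<And>u v. u \<in> carrier A \<Longrightarrow> v \<in> carrier A \<Longrightarrow> P u \<Longrightarrow> P v \<Longrightarrow> P (u \<oplus>\<^bsub>A\<^esub> v)"
    and smult: "\<And>c u. u \<in> carrier A \<Longrightarrow> P u \<Longrightarrow> P (c \<odot>\<^bsub>A\<^esub> u)"
    and word: "\<And>w. set w \<subseteq> G \<Longrightarrow> P (cl (Poly_Mapping.single (Wd w) 1))"
  shows "P u"
proof -
  obtain x where x: "x \<in> F" "u = cl x" using assms(1) by (auto simp: carrier_A)
  have "x \<in> F \<and> P (cl x)" if "x \<in> F" for x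
    using that
  proof (induction x rule: falg_induct)
    case zero
    then show ?case using assms(2) by (simp add: cl_zero)
  next
    case (add x y)
    then show ?case using assms(3)[of "cl x" "cl y"] by (simp add: cl_hom)
  next
    case (single w c)
    then show ?case
      using smult[OF cl_closed word, of w c] by (simp add: cl_smult scal_mult_single)
  qed
  with x show ?thesis by simp
qed

end

interpretation A: dual_representation "idxs n" "qpol_rels n" dual_chi
  rewrites "presented (idxs n) (qpol_rels n) = Aq n"
  for n
  by (rule dual_representation_dual_chi) (simp add: Aq_def)

interpretation U: dual_representation "qn_gens n" "qn_rels n" dual_U
  rewrites "presented (qn_gens n) (qn_rels n) = Uq n"
  for n
  by (rule dual_representation_dual_U) (simp add: Uq_def)

interpretation Aq: module QV "Aq n" for n
  by (rule A.module_A)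

interpretation Aq: ring "Aq n" for n
  by (rule A.ring_A)

section \<open>Pairing functionals with elements\<close>

text \<open>\<open>cev y\<close> is the transpose of left multiplication by \<open>y\<close>; at the
  state of the empty monomial it gives the value of \<open>f\<close> on \<open>y\<close> times 1,
  that is, on \<open>y\<close>.\<close>

definition pairing :: "nat \<Rightarrow> (state \<Rightarrow> qv) \<Rightarrow> idx falg set \<Rightarrow> qv" where
  "pairing n f y = A.cev y f (\<lambda>_. (0, False))"

lemma Xgen_closed [simp, intro]: "p \<in> idxs n \<Longrightarrow> Xgen n p \<in> carrier (Aq n)"
  by (simp add: Xgen_def)

lemma pairing_hom:
  "y \<in> carrier (Aq n) \<Longrightarrow> z \<in> carrier (Aq n) \<Longrightarrow> pairing n f (y \<oplus>\<^bsub>Aq n\<^esub> z) = pairing n f y + pairing n f z"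
  "y \<in> carrier (Aq n) \<Longrightarrow> pairing n f (c \<odot>\<^bsub>Aq n\<^esub> y) = c * pairing n f y"
  "pairing n f \<zero>\<^bsub>Aq n\<^esub> = 0" "pairing n f \<one>\<^bsub>Aq n\<^esub> = f (\<lambda>_. (0, False))"
  by (simp_all add: pairing_def A.cev_hom)

lemma pairing_lin: "lin_op (\<lambda>f (_ :: unit). pairing n f y)"
  using A.lin_cev[of y] by (auto simp: lin_op_def pairing_def fun_eq_iff)

lemma pairing_linD:
  "pairing n (\<lambda>s. f s + h s) y = pairing n f y + pairing n h y" "pairing n (\<lambda>s. c * f s) y = c * pairing n f y" "pairing n (\<lambda>s. 0) y = 0"
  using lin_opD[OF pairing_lin[of n y]] by auto

lemma pairing_Xgen_mult:
  "p \<in> idxs n \<Longrightarrow> y \<in> carrier (Aq n) \<Longrightarrow> pairing n f (Xgen n p \<otimes>\<^bsub>Aq n\<^esub> y) = pairing n (dual_chi p f) y"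
  by (simp add: pairing_def A.cev_hom Xgen_def)

lemma pairing_Xgen_pow_mult:
  "p \<in> idxs n \<Longrightarrow> y \<in> carrier (Aq n) \<Longrightarrow>
    pairing n f ((Xgen n p [^]\<^bsub>Aq n\<^esub> (k::nat)) \<otimes>\<^bsub>Aq n\<^esub> y) = pairing n ((dual_chi p ^^ k) f) y"
proof (induction k arbitrary: y)
  case (Suc k)
  then show ?case
    by (simp add: Aq.m_assoc pairing_Xgen_mult)
qed simp

lemma dual_chi_Or_pow: "(dual_chi (Or i) ^^ k) f s = f (s(i := (fst (s i) + int k, snd (s i))))"
  by (induction k arbitrary: s) (simp_all add: ac_simps)

text \<open>Each pair of odd factors turns into \<open>bar_sq\<close> and two even ones, and one odd
  factor is left if k is odd. The hypothesis on \<open>bar_sign\<close> says that reaching site i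
  costs no sign.\<close>

lemma dual_chi_Bar_pow:
  assumes "bar_sign s i = 1" "s i = (x, False)"
  shows "(dual_chi (Bar i) ^^ k) f s = bar_sq ^ (k div 2) * f (s(i := (x + 2 * int (k div 2), odd k)))"
proof (induction k arbitrary: f)
  case 0
  then show ?case using assms by (simp flip: assms(2))
next
  case (Suc k)
  have "(dual_chi (Bar i) ^^ Suc k) f s = (dual_chi (Bar i) ^^ k) (dual_chi (Bar i) f) s"
    by (simp add: funpow_swap1)
  also have "\<dots> = bar_sq ^ (k div 2) * dual_chi (Bar i) f (s(i := (x + 2 * int (k div 2), odd k)))"
    by (rule Suc)
  also have "\<dots> = bar_sq ^ (Suc k div 2) * f (s(i := (x + 2 * int (Suc k div 2), odd (Suc k))))"
    using assms(1) by (cases "even k") (auto simp: bar_sign_upd ac_simps)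
  finally show ?case .
qed

text \<open>The product in \<open>Xmon\<close> over an arbitrary list of indices, as inductions
  along the list require.\<close>

definition xprod :: "nat \<Rightarrow> (idx \<Rightarrow> nat) \<Rightarrow> idx list \<Rightarrow> idx falg set" where
  "xprod n a l = foldr (\<lambda>p y. (Xgen n p [^]\<^bsub>Aq n\<^esub> a p) \<otimes>\<^bsub>Aq n\<^esub> y) l \<one>\<^bsub>Aq n\<^esub>"

lemma xprod_simps [simp]:
  "xprod n a [] = \<one>\<^bsub>Aq n\<^esub>"
  "xprod n a (p # l) = (Xgen n p [^]\<^bsub>Aq n\<^esub> a p) \<otimes>\<^bsub>Aq n\<^esub> xprod n a l"
  by (simp_all add: xprod_def)

lemma xprod_closed [simp, intro]: "set l \<subseteq> idxs n \<Longrightarrow> xprod n a l \<in> carrier (Aq n)"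
  by (induction l) auto

abbreviation "all_idx n \<equiv> map Or [1..<n + 1] @ map Bar [1..<n + 1]"

lemma Xmon_xprod: "Xmon n a = xprod n a (all_idx n)"
  by (simp only: Xmon_def xprod_def)

lemma all_idx: "set (all_idx n) = idxs n" "distinct (all_idx n)"
  by (auto simp: idxs_def distinct_map inj_on_def)

lemma Xmon_closed [simp, intro]: "Xmon n a \<in> carrier (Aq n)"
  unfolding Xmon_xprod by (rule xprod_closed) (use all_idx in auto)

text \<open>Odd exponents may exceed 1 here: \<open>Xmon n a\<close> is the monomial of \<open>state_of n a\<close> up to a power of
  \<open>bar_sq\<close>.\<close>

definition state_of :: "nat \<Rightarrow> (idx \<Rightarrow> nat) \<Rightarrow> state" where
  "state_of n a = (\<lambda>i. if i \<in> {1..n} then (int (a (Or i)) + 2 * int (a (Bar i) div 2), odd (a (Bar i))) else (0, False))"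

lemma pairing_xprod_Bar:
  assumes "sorted_wrt (<) l" "set l \<subseteq> {1..n}"
  shows "pairing n f (xprod n a (map Bar l)) = (\<Prod>i\<in>set l. bar_sq ^ (a (Bar i) div 2)) *
    f (\<lambda>i. if i \<in> set l then (2 * int (a (Bar i) div 2), odd (a (Bar i))) else (0, False))"
  using assms
proof (induction l arbitrary: f)
  case Nil
  then show ?case by (simp add: pairing_hom)
next
  case (Cons i l)
  let ?s = "\<lambda>i. if i \<in> set l then (2 * int (a (Bar i) div 2), odd (a (Bar i))) else (0, False)"
  have i: "i \<notin> set l" using Cons.prems by auto
  \<comment> \<open>The list increases, so the odd factors already placed belong to sites after i
    and contribute no sign.\<close>
  have "bar_sign ?s i = 1" using Cons.prems by (fastforce simp: bar_sign_def intro!: prod.neutral)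
  moreover have "map Bar l = map Bar l" "set (map Bar l) \<subseteq> idxs n" using Cons.prems by auto
  moreover have "?s(i := (0 + 2 * int (a (Bar i) div 2), odd (a (Bar i)))) =
     (\<lambda>j. if j \<in> set (i # l) then (2 * int (a (Bar j) div 2), odd (a (Bar j))) else (0, False))"
    by auto
  ultimately show ?case
    using Cons i dual_chi_Bar_pow[of ?s i 0 "a (Bar i)" f]
    by (simp add: pairing_Xgen_pow_mult mult_ac)
qed

lemma pairing_xprod:
  assumes "distinct k" "set k \<subseteq> {1..n}" "sorted_wrt (<) l" "set l \<subseteq> {1..n}"
  shows "pairing n f (xprod n a (map Or k @ map Bar l)) = (\<Prod>i\<in>set l. bar_sq ^ (a (Bar i) div 2)) *
    f (\<lambda>i. ((if i \<in> set k then int (a (Or i)) else 0) + (if i \<in> set l then 2 * int (a (Bar i) div 2) else 0),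
       i \<in> set l \<and> odd (a (Bar i))))"
  using assms(1,2)
proof (induction k arbitrary: f)
  case Nil
  have "(\<lambda>i. (0 + (if i \<in> set l then 2 * int (a (Bar i) div 2) else 0), i \<in> set l \<and> odd (a (Bar i)))) =
    (\<lambda>i. if i \<in> set l then (2 * int (a (Bar i) div 2), odd (a (Bar i))) else (0, False))"
    by auto
  then show ?case using pairing_xprod_Bar[OF assms(3,4)] by simp
next
  case (Cons i k)
  have "set (map Or k @ map Bar l) \<subseteq> idxs n" using Cons.prems assms by auto
  then show ?case
    using Cons by (auto simp: pairing_Xgen_pow_mult dual_chi_Or_pow intro!: arg_cong[of _ _ f])
qed

lemma pairing_Xmon: "pairing n f (Xmon n a) = (\<Prod>i\<in>{1..n}. bar_sq ^ (a (Bar i) div 2)) * f (state_of n a)"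
proof -
  have "(\<lambda>i. ((if i \<in> set [1..<n + 1] then int (a (Or i)) else 0) + (if i \<in> set [1..<n + 1] then 2 * int (a (Bar i) div 2) else 0),
       i \<in> set [1..<n + 1] \<and> odd (a (Bar i)))) = state_of n a"
    by (auto simp: state_of_def fun_eq_iff)
  moreover have "set [1..<n + 1] = {1..n}" by auto
  ultimately show ?thesis
    using pairing_xprod[of "[1..<n + 1]" n "[1..<n + 1]" f a] sorted_wrt_upt[of 1 "n + 1"] distinct_upt[of 1 "n + 1"]
    by (simp only: Xmon_xprod subset_refl simp_thms)
qed

lemma pairing_Xmon_expos: "a \<in> expos n \<Longrightarrow> pairing n f (Xmon n a) = f (state_of n a)"
proof -
  assume a: "a \<in> expos n"
  then have "a (Bar i) div 2 = 0" for i by (auto simp: expos_def div_eq_0_iff less_Suc_eq_le numeral_2_eq_2)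
  then show ?thesis by (simp add: pairing_Xmon)
qed

lemma inj_on_state_of: "inj_on (state_of n) (expos n)"
proof (rule inj_onI)
  fix a b assume ab: "a \<in> expos n" "b \<in> expos n" "state_of n a = state_of n b"
  have "a p = b p" for p
  proof (cases "p \<in> idxs n")
    case False
    then show ?thesis using ab by (auto simp: expos_def)
  next
    case True
    obtain i where i: "p = Or i \<or> p = Bar i" "i \<in> {1..n}"
      using True by (auto simp: idxs_def)
    have "a (Bar i) \<le> 1" "b (Bar i) \<le> 1" using ab by (auto simp: expos_def)
    moreover have "state_of n a i = state_of n b i" using ab by simp
    ultimately show ?thesis
      using i by (auto simp: state_of_def le_Suc_eq)
  qed
  then show "a = b" by auto
qed

section \<open>Reordering of products: the monomials span\<close>

lemma (in presentation) rel_cl: "(l, r) \<in> Rel \<Longrightarrow> cl l = cl r"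
  using rels_closed rel_in_I by (simp add: cl_eq_iff)

lemma Xgen_Or_commute:
  assumes "Or i \<in> idxs n" "q \<in> idxs n"
  shows "Xgen n (Or i) \<otimes>\<^bsub>Aq n\<^esub> Xgen n q = Xgen n q \<otimes>\<^bsub>Aq n\<^esub> Xgen n (Or i)"
proof -
  have "cls (idxs n) (qpol_rels n) (gen (Or i) * gen q) = cls (idxs n) (qpol_rels n) (gen q * gen (Or i))"
    using assms by (cases q) (auto intro!: A.rel_cl qpol_rels.intros)
  then show ?thesis using assms by (simp add: Xgen_def A.cl_hom)
qed

text \<open>Spanning is insensitive to scalars, so signs are kept as an unspecified factor
  \<open>e\<close>. An odd generator commutes with itself, with factor 1.\<close>

lemma Xgen_commute:
  assumes "p \<in> idxs n" "q \<in> idxs n"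
  shows "\<exists>e. Xgen n p \<otimes>\<^bsub>Aq n\<^esub> Xgen n q = e \<odot>\<^bsub>Aq n\<^esub> (Xgen n q \<otimes>\<^bsub>Aq n\<^esub> Xgen n p)"
proof -
  have *: "Xgen n p \<otimes>\<^bsub>Aq n\<^esub> Xgen n q = e \<odot>\<^bsub>Aq n\<^esub> (Xgen n q \<otimes>\<^bsub>Aq n\<^esub> Xgen n p)"
    if "cls (idxs n) (qpol_rels n) (gen p * gen q) = cls (idxs n) (qpol_rels n) (scal e * (gen q * gen p))" for e
    using assms that by (simp add: Xgen_def A.cl_hom A.cl_smult)
  show ?thesis
  proof (cases p)
    case p: (Or i)
    show ?thesis
      by (rule exI, rule *[of 1], cases q)
        (use assms p in \<open>auto intro!: A.rel_cl qpol_rels.intros\<close>)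
  next
    case p: (Bar i)
    show ?thesis
    proof (cases q)
      case q: (Or j)
      show ?thesis
        by (rule exI, rule *[of 1])
          (use assms p q in \<open>auto intro!: A.rel_cl[symmetric] qpol_rels.intros\<close>)
    next
      case q: (Bar j)
      have m: "scal (- 1) * x = - x" for x :: "idx falg"
        by (simp add: scal_def single_uminus)
      show ?thesis
      proof (cases "i = j")
        case True
        then show ?thesis using assms p q Aq.smult_one[of "Xgen n p \<otimes>\<^bsub>Aq n\<^esub> Xgen n q" n] by (intro exI[of _ 1]) simp
      next
        case False
        show ?thesis
          by (rule exI, rule *[of "- 1"])
            (use assms p q False in \<open>auto simp: m intro!: A.rel_cl qpol_rels.intros\<close>)
      qed
    qed
  qed
qed

lemma Xgen_pow_commute:
  assumes "p \<in> idxs n" "q \<in> idxs n"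
  shows "\<exists>e. Xgen n p \<otimes>\<^bsub>Aq n\<^esub> (Xgen n q [^]\<^bsub>Aq n\<^esub> (k::nat)) = e \<odot>\<^bsub>Aq n\<^esub> ((Xgen n q [^]\<^bsub>Aq n\<^esub> k) \<otimes>\<^bsub>Aq n\<^esub> Xgen n p)"
proof (induction k)
  case 0
  then show ?case using assms Aq.smult_one[of "Xgen n p" n] by (intro exI[of _ 1]) simp
next
  case (Suc k)
  let ?p = "Xgen n p" and ?q = "Xgen n q"
  obtain e where e: "?p \<otimes>\<^bsub>Aq n\<^esub> (?q [^]\<^bsub>Aq n\<^esub> k) = e \<odot>\<^bsub>Aq n\<^esub> ((?q [^]\<^bsub>Aq n\<^esub> k) \<otimes>\<^bsub>Aq n\<^esub> ?p)"
    using Suc by blast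
  obtain e' where e': "?p \<otimes>\<^bsub>Aq n\<^esub> ?q = e' \<odot>\<^bsub>Aq n\<^esub> (?q \<otimes>\<^bsub>Aq n\<^esub> ?p)"
    using Xgen_commute[OF assms] by blast
  have "?p \<otimes>\<^bsub>Aq n\<^esub> (?q [^]\<^bsub>Aq n\<^esub> Suc k) = (?p \<otimes>\<^bsub>Aq n\<^esub> (?q [^]\<^bsub>Aq n\<^esub> k)) \<otimes>\<^bsub>Aq n\<^esub> ?q"
    using assms by (simp add: Aq.m_assoc)
  also have "\<dots> = e \<odot>\<^bsub>Aq n\<^esub> ((?q [^]\<^bsub>Aq n\<^esub> k) \<otimes>\<^bsub>Aq n\<^esub> (?p \<otimes>\<^bsub>Aq n\<^esub> ?q))"
    unfolding e using assms by (simp add: A.smult_mult Aq.m_assoc)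
  also have "\<dots> = (e * e') \<odot>\<^bsub>Aq n\<^esub> ((?q [^]\<^bsub>Aq n\<^esub> Suc k) \<otimes>\<^bsub>Aq n\<^esub> ?p)"
    unfolding e' using assms Aq.smult_assoc1[of e e'] by (simp add: A.smult_mult Aq.m_assoc)
  finally show ?case by blast
qed

lemma Xgen_pow_lcomm:
  assumes "p \<in> idxs n" "q \<in> idxs n" "y \<in> carrier (Aq n)"
  shows "\<exists>e. Xgen n p \<otimes>\<^bsub>Aq n\<^esub> ((Xgen n q [^]\<^bsub>Aq n\<^esub> (k::nat)) \<otimes>\<^bsub>Aq n\<^esub> y) = e \<odot>\<^bsub>Aq n\<^esub> ((Xgen n q [^]\<^bsub>Aq n\<^esub> k) \<otimes>\<^bsub>Aq n\<^esub> (Xgen n p \<otimes>\<^bsub>Aq n\<^esub> y))"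
proof -
  obtain e where e: "Xgen n p \<otimes>\<^bsub>Aq n\<^esub> (Xgen n q [^]\<^bsub>Aq n\<^esub> k) = e \<odot>\<^bsub>Aq n\<^esub> ((Xgen n q [^]\<^bsub>Aq n\<^esub> k) \<otimes>\<^bsub>Aq n\<^esub> Xgen n p)"
    using Xgen_pow_commute[OF assms(1,2)] by blast
  have "Xgen n p \<otimes>\<^bsub>Aq n\<^esub> ((Xgen n q [^]\<^bsub>Aq n\<^esub> k) \<otimes>\<^bsub>Aq n\<^esub> y) = (Xgen n p \<otimes>\<^bsub>Aq n\<^esub> (Xgen n q [^]\<^bsub>Aq n\<^esub> k)) \<otimes>\<^bsub>Aq n\<^esub> y"
    using assms by (simp add: Aq.m_assoc)
  also have "\<dots> = e \<odot>\<^bsub>Aq n\<^esub> ((Xgen n q [^]\<^bsub>Aq n\<^esub> k) \<otimes>\<^bsub>Aq n\<^esub> (Xgen n p \<otimes>\<^bsub>Aq n\<^esub> y))"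
    unfolding e using assms by (simp add: A.smult_mult Aq.m_assoc)
  finally show ?thesis by blast
qed

lemma xprod_cong: "(\<And>p. p \<in> set l \<Longrightarrow> a p = b p) \<Longrightarrow> xprod n a l = xprod n b l"
  by (induction l) auto

text \<open>The generator passes the powers in front of its own slot, each at the cost of a scalar
  by \<open>Xgen_pow_lcomm\<close>.\<close>

lemma Xgen_mult_xprod:
  assumes "p \<in> set l" "distinct l" "set l \<subseteq> idxs n"
  shows "\<exists>e. Xgen n p \<otimes>\<^bsub>Aq n\<^esub> xprod n a l = e \<odot>\<^bsub>Aq n\<^esub> xprod n (a(p := Suc (a p))) l"
  using assms
proof (induction l)
  case (Cons q l)
  have l: "set l \<subseteq> idxs n" and pq: "p \<in> idxs n" "q \<in> idxs n" using Cons.prems by auto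
  show ?case
  proof (cases "p = q")
    case True
    then have "xprod n (a(p := Suc (a p))) l = xprod n a l"
      using Cons.prems by (intro xprod_cong) auto
    then have "Xgen n p \<otimes>\<^bsub>Aq n\<^esub> xprod n a (q # l) = 1 \<odot>\<^bsub>Aq n\<^esub> xprod n (a(p := Suc (a p))) (q # l)"
      using True pq l Aq.smult_one[of "xprod n (a(p := Suc (a p))) (q # l)" n]
        Aq.nat_pow_mult[of "Xgen n p" n 1 "a p"]
      by (simp add: flip: Aq.m_assoc)
    then show ?thesis by blast
  next
    case False
    obtain e where e: "Xgen n p \<otimes>\<^bsub>Aq n\<^esub> xprod n a (q # l) =
        e \<odot>\<^bsub>Aq n\<^esub> ((Xgen n q [^]\<^bsub>Aq n\<^esub> a q) \<otimes>\<^bsub>Aq n\<^esub> (Xgen n p \<otimes>\<^bsub>Aq n\<^esub> xprod n a l))"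
      using Xgen_pow_lcomm[OF pq xprod_closed[OF l], of "a q" a] unfolding xprod_simps by blast
    obtain e' where e': "Xgen n p \<otimes>\<^bsub>Aq n\<^esub> xprod n a l = e' \<odot>\<^bsub>Aq n\<^esub> xprod n (a(p := Suc (a p))) l"
      using Cons.IH[OF _ _ l] Cons.prems False by (metis distinct.simps(2) set_ConsD)
    have "Xgen n p \<otimes>\<^bsub>Aq n\<^esub> xprod n a (q # l) = (e * e') \<odot>\<^bsub>Aq n\<^esub> xprod n (a(p := Suc (a p))) (q # l)"
      unfolding e e' using l pq False Aq.smult_assoc1[of e e']
      by (simp add: A.smult_mult)
    then show ?thesis by blast
  qed
qed simp

text \<open>Even generators commute with all generators without a scalar, so the two copies of
  \<open>Or i\<close> created by the square relation can be carried to the front.\<close>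

lemma xprod_Bar_2:
  assumes "Bar i \<in> set l" "distinct l" "set l \<subseteq> idxs n" "a (Bar i) = 2"
  shows "\<exists>e. xprod n a l = e \<odot>\<^bsub>Aq n\<^esub> (Xgen n (Or i) \<otimes>\<^bsub>Aq n\<^esub> (Xgen n (Or i) \<otimes>\<^bsub>Aq n\<^esub> xprod n (a(Bar i := 0)) l))"
  using assms(1-3)
proof (induction l)
  case (Cons q l)
  let ?x = "Xgen n (Or i)"
  have l: "set l \<subseteq> idxs n" and q: "q \<in> idxs n" "Or i \<in> idxs n" "Bar i \<in> idxs n" using Cons.prems by auto
  show ?case
  proof (cases "q = Bar i")
    case True
    have 2: "xprod n (a(Bar i := 0)) l = xprod n a l"
      using Cons.prems True by (intro xprod_cong) auto
    have "cls (idxs n) (qpol_rels n) (gen (Bar i) ^ 2) =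
        cls (idxs n) (qpol_rels n) (scal ((\<upsilon> - inverse \<upsilon>) / (\<upsilon> + inverse \<upsilon>)) * gen (Or i) ^ 2)"
      by (rule A.rel_cl) (use q in \<open>auto intro: qpol_rels.intros\<close>)
    then have "Xgen n (Bar i) \<otimes>\<^bsub>Aq n\<^esub> Xgen n (Bar i) = bar_sq \<odot>\<^bsub>Aq n\<^esub> (?x \<otimes>\<^bsub>Aq n\<^esub> ?x)"
      using q by (simp add: Xgen_def A.cl_hom A.cl_smult power2_eq_square bar_sq_def)
    then have "Xgen n (Bar i) [^]\<^bsub>Aq n\<^esub> (2::nat) = bar_sq \<odot>\<^bsub>Aq n\<^esub> (?x \<otimes>\<^bsub>Aq n\<^esub> ?x)"
      using q by (simp add: numeral_2_eq_2)
    then have "xprod n a (q # l) = bar_sq \<odot>\<^bsub>Aq n\<^esub> (?x \<otimes>\<^bsub>Aq n\<^esub> (?x \<otimes>\<^bsub>Aq n\<^esub> xprod n (a(Bar i := 0)) (q # l)))"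
      using True assms(4) l q 2 by (simp add: A.smult_mult Aq.m_assoc)
    then show ?thesis by blast
  next
    case False
    let ?Q = "Xgen n q [^]\<^bsub>Aq n\<^esub> a q" and ?y = "xprod n (a(Bar i := 0)) l"
    obtain e where e: "xprod n a l = e \<odot>\<^bsub>Aq n\<^esub> (?x \<otimes>\<^bsub>Aq n\<^esub> (?x \<otimes>\<^bsub>Aq n\<^esub> ?y))"
      using Cons.IH[OF _ _ l] Cons.prems False by (metis distinct.simps(2) set_ConsD)
    have Qx: "?Q \<otimes>\<^bsub>Aq n\<^esub> ?x = ?x \<otimes>\<^bsub>Aq n\<^esub> ?Q"
      using q by (intro Aq.group_commutes_pow Xgen_Or_commute[symmetric] Xgen_closed)
    have Qx': "?Q \<otimes>\<^bsub>Aq n\<^esub> (?x \<otimes>\<^bsub>Aq n\<^esub> y) = ?x \<otimes>\<^bsub>Aq n\<^esub> (?Q \<otimes>\<^bsub>Aq n\<^esub> y)" if "y \<in> carrier (Aq n)" for y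
      using that q Qx by (simp flip: Aq.m_assoc)
    have "xprod n a (q # l) = e \<odot>\<^bsub>Aq n\<^esub> (?x \<otimes>\<^bsub>Aq n\<^esub> (?x \<otimes>\<^bsub>Aq n\<^esub> xprod n (a(Bar i := 0)) (q # l)))"
      using False e q l by (simp add: A.smult_mult Qx')
    then show ?thesis by blast
  qed
qed simp

lemma expos_upd_Or: "a \<in> expos n \<Longrightarrow> Or i \<in> idxs n \<Longrightarrow> a(Or i := k) \<in> expos n"
  by (auto simp: expos_def)

text \<open>The span of the monomials contains 1 and is stable under left multiplication by
  generators, hence contains all words.\<close>

lemma Xmon_span:
  assumes N: "submodule N QV (Aq n)" and XN: "Xmon n ` expos n \<subseteq> N"
  shows "N = carrier (Aq n)"
proof -
  let ?N = "lin_span QV (Aq n) (Xmon n ` expos n)"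
  have sub: "submodule ?N QV (Aq n)"
    by (rule submodule_lin_span[OF Aq.module_axioms]) auto
  note N' = submodule_QV_D[OF Aq.module_axioms sub]
  have X: "Xmon n a \<in> ?N" if "a \<in> expos n" for a
    using that lin_span_superset by fastforce
  have ins: "\<exists>e. Xgen n p \<otimes>\<^bsub>Aq n\<^esub> Xmon n a = e \<odot>\<^bsub>Aq n\<^esub> Xmon n (a(p := Suc (a p)))" if "p \<in> idxs n" for p a
    unfolding Xmon_xprod using that all_idx[of n] by (intro Xgen_mult_xprod) auto
  have step: "Xgen n p \<otimes>\<^bsub>Aq n\<^esub> Xmon n a \<in> ?N" if p: "p \<in> idxs n" and a: "a \<in> expos n" for p a
  proof -
    obtain e where e: "Xgen n p \<otimes>\<^bsub>Aq n\<^esub> Xmon n a = e \<odot>\<^bsub>Aq n\<^esub> Xmon n (a(p := Suc (a p)))"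
      using ins[OF p] by blast
    show ?thesis
    proof (cases "a(p := Suc (a p)) \<in> expos n")
      case True
      then show ?thesis unfolding e by (intro N' X)
    next
      case False
      \<comment> \<open>Only a second copy of an odd generator leads out of \<open>expos n\<close>.
        The resulting square is traded for two even generators, which are inserted one after the
        other.\<close>
      then obtain i where i: "p = Bar i" "a (Bar i) = 1"
      proof (cases p)
        case (Or i)
        then show ?thesis using False expos_upd_Or[OF a, of i] p by simp
      next
        case (Bar i)
        moreover have "a (Bar i) \<noteq> 0" "a (Bar i) \<le> 1"
          using False Bar a p by (auto simp: expos_def split: if_splits)
        ultimately show ?thesis using that by simp
      qed
      have Or: "Or i \<in> idxs n" using p i by simp
      let ?a = "a(Bar i := 2)" and ?b = "a(Bar i := 0)"
      have a0: "?b \<in> expos n" using a by (auto simp: expos_def)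
      obtain e2 where e2: "Xmon n ?a = e2 \<odot>\<^bsub>Aq n\<^esub> (Xgen n (Or i) \<otimes>\<^bsub>Aq n\<^esub> (Xgen n (Or i) \<otimes>\<^bsub>Aq n\<^esub> Xmon n ?b))"
        using xprod_Bar_2[of i "all_idx n" n ?a, OF _ all_idx(2)] p i
        unfolding all_idx(1) Xmon_xprod fun_upd_upd by (auto simp del: upt_Suc)
      obtain e3 where e3: "Xgen n (Or i) \<otimes>\<^bsub>Aq n\<^esub> Xmon n ?b = e3 \<odot>\<^bsub>Aq n\<^esub> Xmon n (?b(Or i := Suc (?b (Or i))))"
        using ins[OF Or] by blast
      let ?d = "?b(Or i := Suc (?b (Or i)))"
      obtain e4 where e4: "Xgen n (Or i) \<otimes>\<^bsub>Aq n\<^esub> Xmon n ?d = e4 \<odot>\<^bsub>Aq n\<^esub> Xmon n (?d(Or i := Suc (?d (Or i))))"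
        using ins[OF Or] by blast
      have "?d(Or i := Suc (?d (Or i))) \<in> expos n"
        by (intro expos_upd_Or a0 Or)
      moreover have "a(p := Suc (a p)) = ?a" using i by auto
      ultimately show ?thesis
        unfolding e \<open>a(p := Suc (a p)) = ?a\<close> e2 e3 using Or
        by (simp add: A.smult_mult e4 N' X del: fun_upd_apply)
    qed
  qed
  have mult: "Xgen n p \<otimes>\<^bsub>Aq n\<^esub> y \<in> ?N" if p: "p \<in> idxs n" and y: "y \<in> ?N" for p y
  proof -
    have "submodule {y \<in> carrier (Aq n). Xgen n p \<otimes>\<^bsub>Aq n\<^esub> y \<in> ?N} QV (Aq n)"
      by (rule submodule_QV_I[OF Aq.module_axioms])
        (use p N' in \<open>auto simp: Aq.r_distr A.smult_mult\<close>)
    then have "?N \<subseteq> {y \<in> carrier (Aq n). Xgen n p \<otimes>\<^bsub>Aq n\<^esub> y \<in> ?N}"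
      by (rule lin_span_minimal) (use step p in auto)
    then show ?thesis using y by auto
  qed
  have one: "\<one>\<^bsub>Aq n\<^esub> \<in> ?N"
  proof -
    have "xprod n (\<lambda>_. 0) l = \<one>\<^bsub>Aq n\<^esub>" for l by (induction l) auto
    then show ?thesis using X[of "\<lambda>_. 0"] by (simp only: Xmon_xprod) (simp add: expos_def)
  qed
  have word: "cls (idxs n) (qpol_rels n) (Poly_Mapping.single (Wd w) 1) \<in> ?N" if "set w \<subseteq> idxs n" for w
    using that
  proof (induction w)
    case Nil
    then show ?case using one by (simp add: single_Nil A.cl_one)
  next
    case (Cons p w)
    then show ?case using mult[of p] by (simp add: A.word_Cons Xgen_def)
  qed
  have "u \<in> N" if "u \<in> carrier (Aq n)" for u
  proof -
    have "u \<in> ?N" using that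
      by (induction u rule: A.carrier_induct) (use N' word in auto)
    then show ?thesis using lin_span_minimal[OF N XN] by auto
  qed
  then show ?thesis using submodule_QV_D(1)[OF Aq.module_axioms N] by auto
qed

lemma Aq_induct [consumes 1, case_names zero add smult Xmon]:
  assumes "y \<in> carrier (Aq n)" "P \<zero>\<^bsub>Aq n\<^esub>"
    and "\<And>x y. x \<in> carrier (Aq n) \<Longrightarrow> y \<in> carrier (Aq n) \<Longrightarrow> P x \<Longrightarrow> P y \<Longrightarrow> P (x \<oplus>\<^bsub>Aq n\<^esub> y)"
    and "\<And>c x. x \<in> carrier (Aq n) \<Longrightarrow> P x \<Longrightarrow> P (c \<odot>\<^bsub>Aq n\<^esub> x)"
    and "\<And>a. a \<in> expos n \<Longrightarrow> P (Xmon n a)"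
  shows "P y"
proof -
  have "{y \<in> carrier (Aq n). P y} = carrier (Aq n)"
    by (rule Xmon_span, rule submodule_QV_I[OF Aq.module_axioms]) (use assms in auto)
  then show ?thesis using assms(1) by auto
qed

section \<open>Coordinates and linear independence\<close>

definition lin_comb :: "nat \<Rightarrow> ((idx \<Rightarrow> nat) \<Rightarrow> qv) \<Rightarrow> (idx \<Rightarrow> nat) set \<Rightarrow> idx falg set" where
  "lin_comb n c S = (\<Oplus>\<^bsub>Aq n\<^esub>a\<in>S. c a \<odot>\<^bsub>Aq n\<^esub> Xmon n a)"

lemma lin_comb_closed [simp, intro]: "lin_comb n c S \<in> carrier (Aq n)"
  unfolding lin_comb_def by (rule Aq.finsum_closed) auto

lemma pairing_lin_comb:
  assumes "finite S" "S \<subseteq> expos n"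
  shows "pairing n f (lin_comb n c S) = (\<Sum>a\<in>S. c a * f (state_of n a))"
  using assms unfolding lin_comb_def
  by (induction S rule: finite_induct)
    (auto simp: pairing_hom pairing_Xmon_expos Pi_iff)

lemma lin_comb_superset:
  assumes "finite T" "S \<subseteq> T" "\<And>a. a \<notin> S \<Longrightarrow> c a = 0"
  shows "lin_comb n c S = lin_comb n c T"
  unfolding lin_comb_def
  by (rule Aq.add.finprod_mono_neutral_cong_left)
    (use assms Aq.smult_l_null[simplified] in \<open>simp_all add: Pi_iff\<close>)

lemma lin_comb_exists:
  assumes "y \<in> carrier (Aq n)"
  shows "\<exists>c S. finite S \<and> S \<subseteq> expos n \<and> (\<forall>a. a \<notin> S \<longrightarrow> c a = 0) \<and> y = lin_comb n c S"
  using assms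
proof (induction y rule: Aq_induct)
  case zero
  show ?case by (intro exI[of _ "\<lambda>_. 0"] exI[of _ "{}"]) (simp add: lin_comb_def)
next
  case (add x y)
  then obtain c S d T where S: "finite S" "S \<subseteq> expos n" "\<forall>a. a \<notin> S \<longrightarrow> c a = 0" "x = lin_comb n c S"
    and T: "finite T" "T \<subseteq> expos n" "\<forall>a. a \<notin> T \<longrightarrow> d a = 0" "y = lin_comb n d T" by metis
  have "x = lin_comb n c (S \<union> T)" "y = lin_comb n d (S \<union> T)"
    unfolding S(4) T(4) using S T by (simp_all add: lin_comb_superset[of "S \<union> T"])
  then have "x \<oplus>\<^bsub>Aq n\<^esub> y = lin_comb n (\<lambda>a. c a + d a) (S \<union> T)"
    using S T by (simp add: lin_comb_def Aq.smult_l_distr[simplified] Aq.finsum_addf)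
  then show ?case using S T by (intro exI[of _ "\<lambda>a. c a + d a"] exI[of _ "S \<union> T"]) auto
next
  case (smult k x)
  then obtain c S where S: "finite S" "S \<subseteq> expos n" "\<forall>a. a \<notin> S \<longrightarrow> c a = 0" "x = lin_comb n c S" by metis
  have "k \<odot>\<^bsub>Aq n\<^esub> x = lin_comb n (\<lambda>a. k * c a) S"
    using S by (simp add: lin_comb_def Aq.smult_assoc1[simplified] Aq.finsum_smult_ldistr)
  then show ?case using S by (intro exI[of _ "\<lambda>a. k * c a"] exI[of _ S]) auto
next
  case (Xmon a)
  have "Xmon n a = lin_comb n (\<lambda>b. of_bool (b = a)) {a}"
    using Aq.smult_one[of "Xmon n a" n] by (simp add: lin_comb_def)
  then show ?case using Xmon by (intro exI[of _ "\<lambda>b. of_bool (b = a)"] exI[of _ "{a}"]) auto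
qed

text \<open>The functional dual to a monomial is the indicator of its state, so coordinates are
  given by a formula before independence is known.\<close>

definition coord :: "nat \<Rightarrow> (idx \<Rightarrow> nat) \<Rightarrow> idx falg set \<Rightarrow> qv" where
  "coord n a = pairing n (\<lambda>s. of_bool (s = state_of n a))"

text \<open>Distinct vectors in \<open>expos n\<close> have distinct states, so the indicator picks
  out a single coefficient; this is the linear independence of the monomials.\<close>

lemma coord_lin_comb:
  assumes "finite S" "S \<subseteq> expos n" "a \<in> expos n"
  shows "coord n a (lin_comb n c S) = (if a \<in> S then c a else 0)"
proof -
  have "coord n a (lin_comb n c S) = (\<Sum>b\<in>S. if b = a then c b else 0)"
    unfolding coord_def pairing_lin_comb[OF assms(1,2)]
    by (rule sum.cong) (use assms inj_onD[OF inj_on_state_of[of n]] in auto)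
  then show ?thesis using assms(1) by simp
qed

lemma coord_lincomb:
  assumes "y \<in> carrier (Aq n)"
  shows "finite {a \<in> expos n. coord n a y \<noteq> 0}" "y = lin_comb n (\<lambda>a. coord n a y) {a \<in> expos n. coord n a y \<noteq> 0}"
proof -
  obtain c S where S: "finite S" "S \<subseteq> expos n" "\<forall>a. a \<notin> S \<longrightarrow> c a = 0" "y = lin_comb n c S"
    using lin_comb_exists[OF assms] by blast
  have coord: "coord n a y = c a" if "a \<in> expos n" for a using S that by (auto simp: coord_lin_comb)
  then have *: "{a \<in> expos n. coord n a y \<noteq> 0} \<subseteq> S" using S by auto
  then show "finite {a \<in> expos n. coord n a y \<noteq> 0}" using S finite_subset by blast
  show "y = lin_comb n (\<lambda>a. coord n a y) {a \<in> expos n. coord n a y \<noteq> 0}"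
  proof -
    have "lin_comb n (\<lambda>a. coord n a y) {a \<in> expos n. coord n a y \<noteq> 0} = lin_comb n c {a \<in> expos n. coord n a y \<noteq> 0}"
      unfolding lin_comb_def by (rule Aq.finsum_cong') (simp_all add: coord)
    also have "\<dots> = lin_comb n c S"
      by (rule lin_comb_superset) (use S coord * in auto)
    finally show ?thesis using S(4) by simp
  qed
qed

lemma coord_hom:
  "y \<in> carrier (Aq n) \<Longrightarrow> z \<in> carrier (Aq n) \<Longrightarrow> coord n a (y \<oplus>\<^bsub>Aq n\<^esub> z) = coord n a y + coord n a z"
  "y \<in> carrier (Aq n) \<Longrightarrow> coord n a (c \<odot>\<^bsub>Aq n\<^esub> y) = c * coord n a y"
  "coord n a \<zero>\<^bsub>Aq n\<^esub> = 0"
  by (simp_all add: coord_def pairing_hom)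

lemma coord_eqI:
  assumes "y \<in> carrier (Aq n)" "z \<in> carrier (Aq n)" "\<And>a. a \<in> expos n \<Longrightarrow> coord n a y = coord n a z"
  shows "y = z"
proof -
  have S: "{a \<in> expos n. coord n a y \<noteq> 0} = {a \<in> expos n. coord n a z \<noteq> 0}" using assms(3) by auto
  have "lin_comb n (\<lambda>a. coord n a y) {a \<in> expos n. coord n a y \<noteq> 0} = lin_comb n (\<lambda>a. coord n a z) {a \<in> expos n. coord n a z \<noteq> 0}"
    unfolding lin_comb_def by (rule Aq.finsum_cong') (use assms(3) S in auto)
  then show ?thesis using coord_lincomb(2)[OF assms(1)] coord_lincomb(2)[OF assms(2)] by metis
qed

text \<open>Nondegeneracy: coordinates are among the values of the pairing. Equalities in
  \<open>Aq n\<close> are from here on tested against functionals.\<close>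

lemma pairing_eqI:
  assumes "y \<in> carrier (Aq n)" "z \<in> carrier (Aq n)" "\<And>f. pairing n f y = pairing n f z"
  shows "y = z"
  by (rule coord_eqI) (use assms in \<open>auto simp: coord_def\<close>)

section \<open>Operators and their duals\<close>

lemma End_alg_simps [simp]:
  "monoid.mult (EndA n) = (\<lambda>f g. compose (carrier (Aq n)) f g)"
  "one (EndA n) = (\<lambda>x\<in>carrier (Aq n). x)"
  "zero (EndA n) = (\<lambda>x\<in>carrier (Aq n). \<zero>\<^bsub>Aq n\<^esub>)"
  "add (EndA n) = (\<lambda>f g. \<lambda>x\<in>carrier (Aq n). f x \<oplus>\<^bsub>Aq n\<^esub> g x)"
  "module.smult (EndA n) = (\<lambda>c f. \<lambda>x\<in>carrier (Aq n). c \<odot>\<^bsub>Aq n\<^esub> f x)"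
  by (simp_all add: End_alg_def)

lemma End_alg_mem:
  "T \<in> carrier (EndA n) \<longleftrightarrow> T \<in> carrier (Aq n) \<rightarrow>\<^sub>E carrier (Aq n) \<and>
    (\<forall>x\<in>carrier (Aq n). \<forall>y\<in>carrier (Aq n). T (x \<oplus>\<^bsub>Aq n\<^esub> y) = T x \<oplus>\<^bsub>Aq n\<^esub> T y) \<and>
    (\<forall>c. \<forall>x\<in>carrier (Aq n). T (c \<odot>\<^bsub>Aq n\<^esub> x) = c \<odot>\<^bsub>Aq n\<^esub> T x)"
  by (auto simp: End_alg_def)

lemma End_closed: "T \<in> carrier (EndA n) \<Longrightarrow> y \<in> carrier (Aq n) \<Longrightarrow> T y \<in> carrier (Aq n)"
  by (auto simp: End_alg_mem)

lemma End_zero: "T \<in> carrier (EndA n) \<Longrightarrow> T \<zero>\<^bsub>Aq n\<^esub> = \<zero>\<^bsub>Aq n\<^esub>"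
proof -
  assume T: "T \<in> carrier (EndA n)"
  have "T (0 \<odot>\<^bsub>Aq n\<^esub> \<zero>\<^bsub>Aq n\<^esub>) = 0 \<odot>\<^bsub>Aq n\<^esub> T \<zero>\<^bsub>Aq n\<^esub>"
    using T Aq.zero_closed unfolding End_alg_mem by blast
  then show ?thesis
    using End_closed[OF T Aq.zero_closed] Aq.smult_l_null[simplified] by simp
qed

lemma End_eqI:
  assumes T: "T \<in> carrier (EndA n)" "T' \<in> carrier (EndA n)"
    and eq: "\<And>a. a \<in> expos n \<Longrightarrow> T (Xmon n a) = T' (Xmon n a)"
  shows "T = T'"
proof (rule extensionalityI)
  show "T \<in> extensional (carrier (Aq n))" "T' \<in> extensional (carrier (Aq n))"
    using T by (auto simp: End_alg_mem PiE_def)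
  fix y assume "y \<in> carrier (Aq n)"
  then show "T y = T' y"
    by (induction y rule: Aq_induct) (use T eq in \<open>auto simp: End_zero, auto simp: End_alg_mem\<close>)
qed

text \<open>\<open>D\<close> is realizable if it is the transpose of an operator on \<open>Aq n\<close>; this operator is then
  \<open>op_of_dual n D\<close>.\<close>

definition realizable :: "nat \<Rightarrow> ((state \<Rightarrow> qv) \<Rightarrow> state \<Rightarrow> qv) \<Rightarrow> bool" where
  "realizable n D \<longleftrightarrow> (\<forall>a\<in>expos n. \<exists>z\<in>carrier (Aq n). \<forall>f. pairing n f z = D f (state_of n a))"

definition op_of_dual :: "nat \<Rightarrow> ((state \<Rightarrow> qv) \<Rightarrow> state \<Rightarrow> qv) \<Rightarrow> idx falg set \<Rightarrow> idx falg set" where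
  "op_of_dual n D = (\<lambda>y\<in>carrier (Aq n). THE z. z \<in> carrier (Aq n) \<and> (\<forall>f. pairing n f z = pairing n (D f) y))"

text \<open>\<open>realizable\<close> supplies the image of each basis monomial. For fixed
  \<open>f\<close> the pairing with \<open>D f\<close> is additive and homogeneous in
  \<open>y\<close>, so images of sums and multiples are formed from those of the parts;
  nondegeneracy makes them unique.\<close>

lemma op_of_dual_spec:
  assumes "realizable n D" "y \<in> carrier (Aq n)"
  shows "op_of_dual n D y \<in> carrier (Aq n)" "pairing n f (op_of_dual n D y) = pairing n (D f) y"
proof -
  have "\<exists>z. z \<in> carrier (Aq n) \<and> (\<forall>f. pairing n f z = pairing n (D f) y)"
    using assms(2)
  proof (induction y rule: Aq_induct)
    case zero
    then show ?case by (intro exI[of _ "\<zero>\<^bsub>Aq n\<^esub>"]) (simp add: pairing_hom)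
  next
    case (add x y)
    then obtain z w where "z \<in> carrier (Aq n)" "\<forall>f. pairing n f z = pairing n (D f) x"
      "w \<in> carrier (Aq n)" "\<forall>f. pairing n f w = pairing n (D f) y" by blast
    with add show ?case by (intro exI[of _ "z \<oplus>\<^bsub>Aq n\<^esub> w"]) (simp add: pairing_hom)
  next
    case (smult c x)
    then obtain z where "z \<in> carrier (Aq n)" "\<forall>f. pairing n f z = pairing n (D f) x" by blast
    with smult show ?case by (intro exI[of _ "c \<odot>\<^bsub>Aq n\<^esub> z"]) (simp add: pairing_hom)
  next
    case (Xmon a)
    then show ?case using assms(1) by (auto simp: realizable_def pairing_Xmon_expos)
  qed
  then have "\<exists>!z. z \<in> carrier (Aq n) \<and> (\<forall>f. pairing n f z = pairing n (D f) y)"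
    by (metis pairing_eqI)
  from theI'[OF this] show "op_of_dual n D y \<in> carrier (Aq n)" "pairing n f (op_of_dual n D y) = pairing n (D f) y"
    using assms(2) by (simp_all add: op_of_dual_def)
qed

lemma op_of_dual_End: "realizable n D \<Longrightarrow> op_of_dual n D \<in> carrier (EndA n)"
proof -
  assume D: "realizable n D"
  note * = op_of_dual_spec[OF D]
  have "op_of_dual n D (x \<oplus>\<^bsub>Aq n\<^esub> y) = op_of_dual n D x \<oplus>\<^bsub>Aq n\<^esub> op_of_dual n D y"
    if "x \<in> carrier (Aq n)" "y \<in> carrier (Aq n)" for x y
    using that * by (intro pairing_eqI[of _ n]) (simp_all add: pairing_hom)
  moreover have "op_of_dual n D (c \<odot>\<^bsub>Aq n\<^esub> x) = c \<odot>\<^bsub>Aq n\<^esub> op_of_dual n D x" if "x \<in> carrier (Aq n)" for c x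
    using that * by (intro pairing_eqI[of _ n]) (simp_all add: pairing_hom)
  ultimately show ?thesis
    using *(1) by (simp add: End_alg_mem PiE_def Pi_iff) (simp add: op_of_dual_def)
qed

lemma pairing_op_of_dual_Xmon:
  "realizable n D \<Longrightarrow> a \<in> expos n \<Longrightarrow> pairing n f (op_of_dual n D (Xmon n a)) = D f (state_of n a)"
  by (simp add: op_of_dual_spec pairing_Xmon_expos)

text \<open>Operators with the same pairings on the basis coincide, by nondegeneracy and
  \<open>End_eqI\<close>. Products, sums and left multiplications are recognized in this
  way.\<close>

lemma op_of_dual_unique:
  assumes "T \<in> carrier (EndA n)" "\<And>a f. a \<in> expos n \<Longrightarrow> pairing n f (T (Xmon n a)) = D f (state_of n a)"
  shows "realizable n D" "T = op_of_dual n D"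
proof -
  show D: "realizable n D"
    using assms End_closed[OF assms(1) Xmon_closed] unfolding realizable_def by blast
  show "T = op_of_dual n D"
  proof (rule End_eqI[OF assms(1) op_of_dual_End[OF D]])
    fix a assume "a \<in> expos n"
    then show "T (Xmon n a) = op_of_dual n D (Xmon n a)"
      by (intro pairing_eqI[of _ n])
        (simp_all add: D assms(2) pairing_op_of_dual_Xmon End_closed[OF assms(1)] End_closed[OF op_of_dual_End])
  qed
qed

lemma End_mult_closed:
  "T \<in> carrier (EndA n) \<Longrightarrow> T' \<in> carrier (EndA n) \<Longrightarrow> T \<otimes>\<^bsub>EndA n\<^esub> T' \<in> carrier (EndA n)"
  by (simp add: End_alg_mem compose_def PiE_def Pi_iff)

lemma End_add_closed:
  "T \<in> carrier (EndA n) \<Longrightarrow> T' \<in> carrier (EndA n) \<Longrightarrow> T \<oplus>\<^bsub>EndA n\<^esub> T' \<in> carrier (EndA n)"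
  by (simp add: End_alg_mem PiE_def Pi_iff Aq.smult_r_distr[simplified] Aq.a_ac)

lemma End_smult_closed:
  "T \<in> carrier (EndA n) \<Longrightarrow> c \<odot>\<^bsub>EndA n\<^esub> T \<in> carrier (EndA n)"
  by (simp add: End_alg_mem PiE_def Pi_iff Aq.smult_r_distr[simplified])
    (simp add: mult.commute flip: Aq.smult_assoc1[simplified])

text \<open>The left operator acts last on elements and therefore first on functionals.\<close>

lemma realizable_compose:
  assumes "realizable n D" "realizable n D'"
  shows "realizable n (\<lambda>f. D' (D f))" "op_of_dual n D \<otimes>\<^bsub>EndA n\<^esub> op_of_dual n D' = op_of_dual n (\<lambda>f. D' (D f))"
proof -
  have "pairing n f ((op_of_dual n D \<otimes>\<^bsub>EndA n\<^esub> op_of_dual n D') (Xmon n a)) = D' (D f) (state_of n a)" if "a \<in> expos n" for a f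
    using that assms by (simp add: compose_eq op_of_dual_spec pairing_Xmon_expos)
  note op_of_dual_unique[OF End_mult_closed this, OF op_of_dual_End op_of_dual_End, OF assms]
  then show "realizable n (\<lambda>f. D' (D f))" "op_of_dual n D \<otimes>\<^bsub>EndA n\<^esub> op_of_dual n D' = op_of_dual n (\<lambda>f. D' (D f))"
    by auto
qed

lemma realizable_add:
  assumes "realizable n D" "realizable n D'"
  shows "realizable n (\<lambda>f s. D f s + D' f s)"
    "op_of_dual n D \<oplus>\<^bsub>EndA n\<^esub> op_of_dual n D' = op_of_dual n (\<lambda>f s. D f s + D' f s)"
proof -
  have "pairing n f ((op_of_dual n D \<oplus>\<^bsub>EndA n\<^esub> op_of_dual n D') (Xmon n a)) = D f (state_of n a) + D' f (state_of n a)"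
    if "a \<in> expos n" for a f
    using that assms by (simp add: op_of_dual_spec pairing_hom pairing_Xmon_expos)
  note op_of_dual_unique[where D = "\<lambda>f s. D f s + D' f s", OF End_add_closed this, OF op_of_dual_End op_of_dual_End, OF assms]
  then show "realizable n (\<lambda>f s. D f s + D' f s)"
    "op_of_dual n D \<oplus>\<^bsub>EndA n\<^esub> op_of_dual n D' = op_of_dual n (\<lambda>f s. D f s + D' f s)"
    by blast+
qed

lemma realizable_smult:
  assumes "realizable n D"
  shows "realizable n (\<lambda>f s. c * D f s)" "c \<odot>\<^bsub>EndA n\<^esub> op_of_dual n D = op_of_dual n (\<lambda>f s. c * D f s)"
proof -
  have "pairing n f ((c \<odot>\<^bsub>EndA n\<^esub> op_of_dual n D) (Xmon n a)) = c * D f (state_of n a)" if "a \<in> expos n" for a f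
    using that assms by (simp add: op_of_dual_spec pairing_hom pairing_Xmon_expos)
  note op_of_dual_unique[where D = "\<lambda>f s. c * D f s", OF End_smult_closed this, OF op_of_dual_End, OF assms]
  then show "realizable n (\<lambda>f s. c * D f s)" "c \<odot>\<^bsub>EndA n\<^esub> op_of_dual n D = op_of_dual n (\<lambda>f s. c * D f s)"
    by blast+
qed

lemma realizable_weight: "realizable n (\<lambda>f s. w s * f s)"
  unfolding realizable_def
proof
  fix a assume "a \<in> expos n"
  then show "\<exists>z\<in>carrier (Aq n). \<forall>f. pairing n f z = w (state_of n a) * f (state_of n a)"
    by (intro bexI[of _ "w (state_of n a) \<odot>\<^bsub>Aq n\<^esub> Xmon n a"]) (auto simp: pairing_hom pairing_Xmon_expos)
qed

lemma realizable_id: "realizable n (\<lambda>f. f)" "one (EndA n) = op_of_dual n (\<lambda>f. f)"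
proof -
  have "(\<lambda>x\<in>carrier (Aq n). x) \<in> carrier (EndA n)"
    by (simp add: End_alg_mem)
  from op_of_dual_unique[OF this, of "\<lambda>f. f"] show "realizable n (\<lambda>f. f)" "one (EndA n) = op_of_dual n (\<lambda>f. f)"
    by (simp_all add: pairing_Xmon_expos)
qed

section \<open>The given operators as transposes\<close>

text \<open>Gives meaning to the definite description in \<open>lin_ext\<close>:
  \<open>op_of_dual\<close> provides a linear operator with the prescribed values, and
  \<open>End_eqI\<close> its uniqueness.\<close>

lemma lin_ext_op_of_dual:
  assumes "\<And>a. a \<in> expos n \<Longrightarrow> g a \<in> carrier (Aq n)"
    and "\<And>a f. a \<in> expos n \<Longrightarrow> pairing n f (g a) = D f (state_of n a)"
  shows "lin_ext n g = op_of_dual n D" "realizable n D"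
proof -
  show D: "realizable n D"
    using assms unfolding realizable_def by blast
  have g: "op_of_dual n D (Xmon n a) = g a" if "a \<in> expos n" for a
    by (rule pairing_eqI[of _ n]) (use that assms D in \<open>auto simp: pairing_op_of_dual_Xmon intro: op_of_dual_spec\<close>)
  show "lin_ext n g = op_of_dual n D"
    unfolding lin_ext_def
  proof (rule the_equality)
    show "op_of_dual n D \<in> carrier (EndA n) \<and> (\<forall>a\<in>expos n. op_of_dual n D (Xmon n a) = g a)"
      using g op_of_dual_End[OF D] by blast
    show "T = op_of_dual n D" if "T \<in> carrier (EndA n) \<and> (\<forall>a\<in>expos n. T (Xmon n a) = g a)" for T
      using that g op_of_dual_End[OF D] by (intro End_eqI) auto
  qed
qed

lemma state_of_expos: "a \<in> expos n \<Longrightarrow> state_of n a = (\<lambda>i. (int (a (Or i)), a (Bar i) = 1))"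
proof
  fix i assume a: "a \<in> expos n"
  then have "a (Bar i) \<le> 1" "i \<notin> {1..n} \<Longrightarrow> a (Bar i) = 0 \<and> a (Or i) = 0"
    by (auto simp: expos_def)
  then show "state_of n a i = (int (a (Or i)), a (Bar i) = 1)"
    by (auto simp: state_of_def le_Suc_eq)
qed

lemma Bar_cases: "a \<in> expos n \<Longrightarrow> a (Bar i) = 0 \<or> a (Bar i) = 1"
  by (auto simp: expos_def le_Suc_eq)

lemma sgn_lt_bar_sign: "a \<in> expos n \<Longrightarrow> sgn_lt a i = bar_sign (state_of n a) i"
proof -
  assume a: "a \<in> expos n"
  then have "(- 1) ^ a (Bar j) = (if a (Bar j) = 1 then - 1 else (1::qv))" for j
    using Bar_cases[OF a, of j] by auto
  then show ?thesis using a
    by (simp add: sgn_lt_def bar_sign_def state_of_expos power_sum)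
qed

lemma expos_dec: "a \<in> expos n \<Longrightarrow> dec p a \<in> expos n"
  by (auto simp: expos_def dec_def)

lemma qint_01 [simp]: "qint 0 = 0" "qint 1 = 1"
  using ups_diff_nonzero by (simp_all add: qint_def power_int_minus)

lemma dual_pd_state_of:
  assumes "a \<in> expos n"
  shows "dual_pd (Or i) f (state_of n a) = qint (int (a (Or i))) * f (state_of n (dec (Or i) a))"
    "dual_pd (Bar i) f (state_of n a) = sgn_lt a i * qint (int (a (Bar i))) * f (state_of n (dec (Bar i) a))"
proof -
  have "(state_of n a)(i := (int (a (Or i)) - 1, a (Bar i) = 1)) = state_of n (dec (Or i) a)" if "a (Or i) \<noteq> 0"
    using assms that by (auto simp: state_of_expos expos_dec fun_eq_iff) (auto simp: dec_def)
  \<comment> \<open>At exponent 0 the state has -1 where \<open>dec\<close> truncates to 0; both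
    values of \<open>f\<close> are multiplied by \<open>qint 0\<close>, which vanishes.\<close>
  then show "dual_pd (Or i) f (state_of n a) = qint (int (a (Or i))) * f (state_of n (dec (Or i) a))"
    using assms by (cases "a (Or i) = 0") (auto simp: state_of_expos)
  have "(state_of n a)(i := (int (a (Or i)), False)) = state_of n (dec (Bar i) a)"
    using assms Bar_cases[OF assms, of i] by (auto simp: state_of_expos expos_dec fun_eq_iff) (auto simp: dec_def)
  then show "dual_pd (Bar i) f (state_of n a) = sgn_lt a i * qint (int (a (Bar i))) * f (state_of n (dec (Bar i) a))"
    using assms Bar_cases[OF assms, of i] by (auto simp: state_of_expos sgn_lt_bar_sign)
qed

lemma chi_op_of_dual: "p \<in> idxs n \<Longrightarrow> chi n p = op_of_dual n (dual_chi p)" "p \<in> idxs n \<Longrightarrow> realizable n (dual_chi p)"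
proof -
  assume p: "p \<in> idxs n"
  have "chi n p \<in> carrier (EndA n)"
    using p by (auto simp: End_alg_mem chi_def Aq.r_distr A.smult_mult)
  from op_of_dual_unique[OF this, of "dual_chi p"] p show "chi n p = op_of_dual n (dual_chi p)" "realizable n (dual_chi p)"
    by (simp_all add: chi_def pairing_Xgen_mult pairing_Xmon_expos)
qed

lemma pd_op_of_dual: "pd n p = op_of_dual n (dual_pd p)" "realizable n (dual_pd p)"
proof -
  show "pd n p = op_of_dual n (dual_pd p)"
    by (cases p) (auto intro!: lin_ext_op_of_dual simp: pairing_hom pairing_Xmon_expos expos_dec dual_pd_state_of simp del: dual_pd.simps)
  show "realizable n (dual_pd p)"
  proof (cases p)
    case (Or i)
    show ?thesis unfolding Or
      by (rule lin_ext_op_of_dual(2)[of n "\<lambda>a. qint (int (a (Or i))) \<odot>\<^bsub>Aq n\<^esub> Xmon n (dec (Or i) a)"])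
        (auto simp: pairing_hom pairing_Xmon_expos expos_dec dual_pd_state_of simp del: dual_pd.simps)
  next
    case (Bar i)
    show ?thesis unfolding Bar
      by (rule lin_ext_op_of_dual(2)[of n "\<lambda>a. (sgn_lt a i * qint (int (a (Bar i)))) \<odot>\<^bsub>Aq n\<^esub> Xmon n (dec (Bar i) a)"])
        (auto simp: pairing_hom pairing_Xmon_expos expos_dec dual_pd_state_of simp del: dual_pd.simps)
  qed
qed

lemma exponent_state_of: "a \<in> expos n \<Longrightarrow> exponent (state_of n a) p = int (a p)"
  using Bar_cases[of a n] by (cases p) (fastforce simp: state_of_expos)+

lemma diag_op_of_dual:
  "del n p = op_of_dual n (\<lambda>f s. \<upsilon> powi exponent s p * f s)"
  "del_inv n p = op_of_dual n (\<lambda>f s. \<upsilon> powi (- exponent s p) * f s)"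
  "sbar n i = op_of_dual n (\<lambda>f s. (if snd (s i) then - 1 else 1) * f s)"
proof -
  show "del n p = op_of_dual n (\<lambda>f s. \<upsilon> powi exponent s p * f s)"
    "del_inv n p = op_of_dual n (\<lambda>f s. \<upsilon> powi (- exponent s p) * f s)"
    unfolding del_def del_inv_def
    by (rule lin_ext_op_of_dual; simp add: pairing_hom pairing_Xmon_expos exponent_state_of)+
  have "(- 1) ^ a (Bar i) = (if snd (state_of n a i) then - 1 else (1::qv))" if "a \<in> expos n" for a
    using Bar_cases[OF that, of i] that by (auto simp: state_of_expos)
  then show "sbar n i = op_of_dual n (\<lambda>f s. (if snd (s i) then - 1 else 1) * f s)"
    unfolding sbar_def by (intro lin_ext_op_of_dual; simp add: pairing_hom pairing_Xmon_expos)
qed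

lemma realizable_dual_pd_LX:
  assumes "q \<in> idxs n"
  shows "realizable n (\<lambda>f. dual_pd p (dual_chi q f))" "realizable n (\<lambda>f s. w s * dual_pd p (dual_chi q f) s)"
    "realizable n (\<lambda>f s. v s * (w s * dual_pd p (dual_chi q f) s))"
    "realizable n (\<lambda>f s. v s * w s * dual_pd p (dual_chi q f) s)"
proof -
  show 1: "realizable n (\<lambda>f. dual_pd p (dual_chi q f))"
    by (rule realizable_compose(1)[OF chi_op_of_dual(2)[OF assms] pd_op_of_dual(2)])
  show 2: "realizable n (\<lambda>f s. w s * dual_pd p (dual_chi q f) s)" for w
    by (rule realizable_compose(1)[OF 1 realizable_weight])
  show "realizable n (\<lambda>f s. v s * (w s * dual_pd p (dual_chi q f) s))"
    by (rule realizable_compose(1)[OF 2 realizable_weight])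
  show "realizable n (\<lambda>f s. v s * w s * dual_pd p (dual_chi q f) s)"
    by (rule 2)
qed

lemma op_dual_U:
  shows "i \<in> {1..n} \<Longrightarrow> op_K n i = op_of_dual n (dual_U (KG i))"
  and "i \<in> {1..n} \<Longrightarrow> op_Kb n i = op_of_dual n (dual_U (KbG i))"
  and "h \<in> {1..<n} \<Longrightarrow> op_E n h = op_of_dual n (dual_U (EG h))"
  and "h \<in> {1..<n} \<Longrightarrow> op_F n h = op_of_dual n (dual_U (FG h))"
  and "h \<in> {1..<n} \<Longrightarrow> op_Eb n h = op_of_dual n (dual_U (EbG h))"
  and "h \<in> {1..<n} \<Longrightarrow> op_Fb n h = op_of_dual n (dual_U (FbG h))"
proof -
  \<comment> \<open>Products and sums of operators stay folded, since
    \<open>realizable_compose\<close> and \<open>realizable_add\<close> rewrite them as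
    such.\<close>
  note [simp del] = End_alg_simps
  note [simp] = realizable_compose(2) realizable_dual_pd_LX realizable_add(2) realizable_weight pd_op_of_dual chi_op_of_dual diag_op_of_dual
  show "i \<in> {1..n} \<Longrightarrow> op_K n i = op_of_dual n (dual_U (KG i))"
    by (simp add: op_K_def del: dual_U.simps dual_chi.simps dual_pd.simps exponent.simps) (rule arg_cong[of _ _ "op_of_dual n"], intro ext, simp add: power_int_add)
  show "i \<in> {1..n} \<Longrightarrow> op_Kb n i = op_of_dual n (dual_U (KbG i))"
    by (simp add: op_Kb_def del: dual_U.simps dual_chi.simps dual_pd.simps exponent.simps) (rule arg_cong[of _ _ "op_of_dual n"], intro ext, simp add: power_int_add)
  show "h \<in> {1..<n} \<Longrightarrow> op_E n h = op_of_dual n (dual_U (EG h))"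
    by (simp add: op_E_def del: dual_U.simps dual_chi.simps dual_pd.simps exponent.simps) (rule arg_cong[of _ _ "op_of_dual n"], intro ext, simp add: power_int_add)
  show "h \<in> {1..<n} \<Longrightarrow> op_F n h = op_of_dual n (dual_U (FG h))"
    by (simp add: op_F_def del: dual_U.simps dual_chi.simps dual_pd.simps exponent.simps) (rule arg_cong[of _ _ "op_of_dual n"], intro ext, simp add: power_int_add)
  show "h \<in> {1..<n} \<Longrightarrow> op_Eb n h = op_of_dual n (dual_U (EbG h))"
    by (simp add: op_Eb_def del: dual_U.simps dual_chi.simps dual_pd.simps exponent.simps) (rule arg_cong[of _ _ "op_of_dual n"], intro ext, simp add: power_int_add)
  show "h \<in> {1..<n} \<Longrightarrow> op_Fb n h = op_of_dual n (dual_U (FbG h))"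
    by (simp add: op_Fb_def del: dual_U.simps dual_chi.simps dual_pd.simps exponent.simps) (rule arg_cong[of _ _ "op_of_dual n"], intro ext, simp add: power_int_add)
qed

text \<open>For \<open>KinvG\<close> no operator has been defined, but its transpose is diagonal and
  so comes from one.\<close>

lemma realizable_dual_U:
  assumes "g \<in> qn_gens n"
  shows "realizable n (dual_U g)"
proof (cases g)
  case (KinvG i)
  have "dual_U g = (\<lambda>f s. \<upsilon> powi (- (exponent s (Or i) + exponent s (Bar i))) * f s)"
    using KinvG by (intro ext) simp
  then show ?thesis using realizable_weight by simp
next
  case (KG i)
  have "dual_U g = (\<lambda>f s. \<upsilon> powi (exponent s (Or i) + exponent s (Bar i)) * f s)"
    using KG by (intro ext) simp
  then show ?thesis using realizable_weight by simp
next
  case (EG h)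
  have "dual_U g = (\<lambda>f s. \<upsilon> powi exponent s (Bar (Suc h)) * dual_pd (Or (Suc h)) (dual_chi (Or h) f) s
     + (if snd (s h) then - 1 else 1) * \<upsilon> powi (- exponent s (Or (Suc h))) * dual_pd (Bar (Suc h)) (dual_chi (Bar h) f) s)"
    using EG by (intro ext) (simp only: dual_U.simps)
  then show ?thesis using assms EG by (simp only:) (intro realizable_add realizable_dual_pd_LX; simp)
next
  case (FG h)
  have "dual_U g = (\<lambda>f s. \<upsilon> powi (- exponent s (Bar h)) * dual_pd (Or h) (dual_chi (Or (Suc h)) f) s
     + \<upsilon> powi exponent s (Or h) * dual_pd (Bar h) (dual_chi (Bar (Suc h)) f) s)"
    using FG by (intro ext) (simp only: dual_U.simps)
  then show ?thesis using assms FG by (simp only:) (intro realizable_add realizable_dual_pd_LX; simp)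
next
  case (KbG i)
  have "dual_U g = (\<lambda>f s. \<upsilon> powi (- exponent s (Or i)) * dual_pd (Bar i) (dual_chi (Or i) f) s
     + \<upsilon> powi exponent s (Bar i) * dual_pd (Or i) (dual_chi (Bar i) f) s)"
    using KbG by (intro ext) (simp only: dual_U.simps)
  then show ?thesis using assms KbG by (simp only:) (intro realizable_add realizable_dual_pd_LX; simp)
next
  case (EbG h)
  have "dual_U g = (\<lambda>f s. (if snd (s h) then - 1 else 1) * \<upsilon> powi exponent s (Bar (Suc h)) * dual_pd (Or (Suc h)) (dual_chi (Bar h) f) s
     + \<upsilon> powi (- exponent s (Or (Suc h))) * dual_pd (Bar (Suc h)) (dual_chi (Or h) f) s)"
    using EbG by (intro ext) (simp only: dual_U.simps)
  then show ?thesis using assms EbG by (simp only:) (intro realizable_add realizable_dual_pd_LX; simp)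
next
  case (FbG h)
  have "dual_U g = (\<lambda>f s. \<upsilon> powi (- exponent s (Bar h)) * dual_pd (Or h) (dual_chi (Bar (Suc h)) f) s
     + \<upsilon> powi exponent s (Or h) * dual_pd (Bar h) (dual_chi (Or (Suc h)) f) s)"
    using FbG by (intro ext) (simp only: dual_U.simps)
  then show ?thesis using assms FbG by (simp only:) (intro realizable_add realizable_dual_pd_LX; simp)
qed

section \<open>The homomorphism and its uniqueness\<close>

lemma realizable_cev:
  assumes "u \<in> carrier (Uq n)"
  shows "realizable n (U.cev u)"
  using assms
proof (induction u rule: U.carrier_induct)
  case zero
  have "U.cev \<zero>\<^bsub>Uq n\<^esub> = (\<lambda>f s. 0 * f s)" by (intro ext) (simp add: U.cev_hom)
  then show ?case using realizable_weight[of n "\<lambda>_. 0"] by simp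
next
  case (add u v)
  have "U.cev (u \<oplus>\<^bsub>Uq n\<^esub> v) = (\<lambda>f s. U.cev u f s + U.cev v f s)"
    using add by (intro ext) (simp add: U.cev_hom)
  then show ?case using realizable_add(1) add by simp
next
  case (smult c u)
  have "U.cev (c \<odot>\<^bsub>Uq n\<^esub> u) = (\<lambda>f s. c * U.cev u f s)"
    using smult by (intro ext) (simp add: U.cev_hom)
  then show ?case using realizable_smult(1) smult by simp
next
  case (word w)
  have "realizable n (fold dual_U w)"
    using word
  proof (induction w)
    case Nil
    then show ?case using realizable_id by (simp add: id_def)
  next
    case (Cons g w)
    then show ?case using realizable_compose(1)[OF realizable_dual_U, of g n "fold dual_U w"] by (simp add: comp_def)
  qed
  moreover have "U.cev (cls (qn_gens n) (qn_rels n) (Poly_Mapping.single (Wd w) 1)) = fold dual_U w"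
    using word by (intro ext) (simp add: U.cev_cl fev_single)
  ultimately show ?case by simp
qed

definition rho :: "nat \<Rightarrow> qn_gen falg set \<Rightarrow> idx falg set \<Rightarrow> idx falg set" where
  "rho n u = op_of_dual n (U.cev u)"

lemma rho_End: "u \<in> carrier (Uq n) \<Longrightarrow> rho n u \<in> carrier (EndA n)"
  by (simp add: rho_def op_of_dual_End realizable_cev)

text \<open>\<open>cev\<close> reverses products, and \<open>op_of_dual\<close> reverses them
  again.\<close>

lemma rho_hom: "rho n \<in> algebra_hom QV (Uq n) (EndA n)"
proof -
  have "rho n \<in> ring_hom (Uq n) (EndA n)"
  proof (rule ring_hom_memI)
    fix u v assume uv: "u \<in> carrier (Uq n)" "v \<in> carrier (Uq n)"
    have "U.cev (u \<otimes>\<^bsub>Uq n\<^esub> v) = (\<lambda>f. U.cev v (U.cev u f))"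
      using uv by (intro ext) (simp add: U.cev_hom)
    then show "rho n (u \<otimes>\<^bsub>Uq n\<^esub> v) = rho n u \<otimes>\<^bsub>EndA n\<^esub> rho n v"
      using uv by (simp add: rho_def realizable_compose(2) realizable_cev del: End_alg_simps)
    have "U.cev (u \<oplus>\<^bsub>Uq n\<^esub> v) = (\<lambda>f s. U.cev u f s + U.cev v f s)"
      using uv by (intro ext) (simp add: U.cev_hom)
    then show "rho n (u \<oplus>\<^bsub>Uq n\<^esub> v) = rho n u \<oplus>\<^bsub>EndA n\<^esub> rho n v"
      using uv by (simp add: rho_def realizable_add(2) realizable_cev del: End_alg_simps)
  next
    have "U.cev \<one>\<^bsub>Uq n\<^esub> = (\<lambda>f. f)" by (intro ext) (simp add: U.cev_hom)
    then show "rho n \<one>\<^bsub>Uq n\<^esub> = \<one>\<^bsub>EndA n\<^esub>"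
      by (simp add: rho_def realizable_id(2) del: End_alg_simps)
  qed (rule rho_End)
  moreover have "rho n (c \<odot>\<^bsub>Uq n\<^esub> u) = c \<odot>\<^bsub>EndA n\<^esub> rho n u" if "u \<in> carrier (Uq n)" for c u
  proof -
    have "U.cev (c \<odot>\<^bsub>Uq n\<^esub> u) = (\<lambda>f s. c * U.cev u f s)"
      using that by (intro ext) (simp add: U.cev_hom)
    then show ?thesis
      using that by (simp add: rho_def realizable_smult(2) realizable_cev del: End_alg_simps)
  qed
  ultimately show ?thesis by (simp add: algebra_hom_def del: End_alg_simps)
qed

lemma Ugen_closed: "g \<in> qn_gens n \<Longrightarrow> Ugen n g \<in> carrier (Uq n)"
  by (simp add: Ugen_def U.cl_closed)

lemma rho_Ugen: "g \<in> qn_gens n \<Longrightarrow> rho n (Ugen n g) = op_of_dual n (dual_U g)"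
  by (simp add: rho_def Ugen_def U.cev_cl) (simp add: fev_gen[abs_def])

lemma pairing_rho:
  "u \<in> carrier (Uq n) \<Longrightarrow> y \<in> carrier (Aq n) \<Longrightarrow> pairing n f (rho n u y) = pairing n (U.cev u f) y"
  by (simp add: rho_def op_of_dual_spec realizable_cev)

lemma rho_extends: "extends_assignment n (rho n)"
  unfolding extends_assignment_def
  by (simp add: rho_hom rho_Ugen op_dual_U)

lemma rho_unique:
  assumes "extends_assignment n \<rho>'" "u \<in> carrier (Uq n)"
  shows "\<rho>' u = rho n u"
proof -
  have hom': "\<rho>' \<in> algebra_hom QV (Uq n) (EndA n)"
    using assms(1) by (simp add: extends_assignment_def)
  have h: "\<sigma> u \<in> carrier (EndA n)" "\<sigma> (u \<otimes>\<^bsub>Uq n\<^esub> v) = \<sigma> u \<otimes>\<^bsub>EndA n\<^esub> \<sigma> v"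
      "\<sigma> (u \<oplus>\<^bsub>Uq n\<^esub> v) = \<sigma> u \<oplus>\<^bsub>EndA n\<^esub> \<sigma> v" "\<sigma> (c \<odot>\<^bsub>Uq n\<^esub> u) = c \<odot>\<^bsub>EndA n\<^esub> \<sigma> u"
      "\<sigma> \<one>\<^bsub>Uq n\<^esub> = \<one>\<^bsub>EndA n\<^esub>"
    if "\<sigma> \<in> algebra_hom QV (Uq n) (EndA n)" "u \<in> carrier (Uq n)" "v \<in> carrier (Uq n)" for \<sigma> u v c
    using that by (simp_all add: algebra_hom_def ring_hom_def Pi_iff del: End_alg_simps)
  note h1 = h[OF hom'] and h2 = h[OF rho_hom]
  have gen: "\<rho>' (Ugen n g) = rho n (Ugen n g)" if g: "g \<in> qn_gens n" for g
  proof (cases "\<exists>i. g = KinvG i")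
    case False
    then show ?thesis
      using g assms(1) rho_extends[of n] by (cases g) (auto simp: extends_assignment_def)
  next
    case True
    then obtain i where i: "g = KinvG i" "i \<in> {1..n}" using g by auto
    let ?K = "Ugen n (KG i)" and ?L = "Ugen n (KinvG i)"
    have KL: "?K \<in> carrier (Uq n)" "?L \<in> carrier (Uq n)" using i Ugen_closed by auto
    have rel: "?K \<otimes>\<^bsub>Uq n\<^esub> ?L = \<one>\<^bsub>Uq n\<^esub>" "?L \<otimes>\<^bsub>Uq n\<^esub> ?K = \<one>\<^bsub>Uq n\<^esub>"
      using i U.rel_cl[OF QQ1a[of i n]] U.rel_cl[OF QQ1b[of i n]]
      by (simp_all add: Ugen_def U.cl_hom U.cl_one)
    have K: "\<rho>' ?K = rho n ?K"
      using i assms(1) rho_extends[of n] by (auto simp: extends_assignment_def)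
    \<comment> \<open>The value at \<open>KinvG i\<close> is not prescribed. The operator of
      \<open>KG i\<close>, common to both maps, sends \<open>?z\<close> to \<open>y\<close>, and the
      left inverse \<open>\<rho>' ?L\<close> sends it back.\<close>
    have "\<rho>' ?L y = rho n ?L y" if y: "y \<in> carrier (Aq n)" for y
    proof -
      let ?z = "rho n ?L y"
      have z: "?z \<in> carrier (Aq n)" using End_closed[OF rho_End[OF KL(2)] y] .
      have "rho n ?K ?z = y"
        using h2(2)[OF KL] h2(5)[OF KL] rel(1) y by (simp add: compose_eq fun_eq_iff) (metis compose_eq)
      moreover have "\<rho>' ?L (\<rho>' ?K ?z) = ?z"
        using h1(2)[OF KL(2,1)] h1(5)[OF KL] rel(2) z by (simp add: fun_eq_iff) (metis compose_eq)
      ultimately show ?thesis using K by simp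
    qed
    then show ?thesis
      using h1(1)[OF KL(2,1)] rho_End[OF KL(2)] i
      by (intro End_eqI) auto
  qed
  show ?thesis
    using assms(2)
  proof (induction u rule: U.carrier_induct)
    case zero
    have z: "\<zero>\<^bsub>Uq n\<^esub> \<in> carrier (Uq n)" using U.cl_closed[of 0 n] by (simp add: U.cl_zero)
    \<comment> \<open>\<open>ring_hom\<close> does not list preservation of zero, so both values are
      compared through zero being 0 times itself.\<close>
    have "\<zero>\<^bsub>Uq n\<^esub> = 0 \<odot>\<^bsub>Uq n\<^esub> \<zero>\<^bsub>Uq n\<^esub>" by (simp add: U.cl_zero U.cl_smult)
    then have e: "\<rho>' \<zero>\<^bsub>Uq n\<^esub> = 0 \<odot>\<^bsub>EndA n\<^esub> \<rho>' \<zero>\<^bsub>Uq n\<^esub>" "rho n \<zero>\<^bsub>Uq n\<^esub> = 0 \<odot>\<^bsub>EndA n\<^esub> rho n \<zero>\<^bsub>Uq n\<^esub>"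
      using h1(4)[OF z z, of 0] h2(4)[OF z z, of 0] by metis+
    have zz: "T (Xmon n a) = \<zero>\<^bsub>Aq n\<^esub>" if "T = 0 \<odot>\<^bsub>EndA n\<^esub> T" "T \<in> carrier (EndA n)" for T a
      using fun_cong[OF that(1), of "Xmon n a"] End_closed[OF that(2)]
      by (simp add: Aq.smult_l_null[simplified])
    show ?case
    proof (rule End_eqI[OF h1(1)[OF z z] h2(1)[OF z z]])
      show "\<rho>' \<zero>\<^bsub>Uq n\<^esub> (Xmon n a) = rho n \<zero>\<^bsub>Uq n\<^esub> (Xmon n a)" for a
        by (rule trans[OF zz[OF e(1) h1(1)[OF z z]] zz[OF e(2) h2(1)[OF z z], symmetric]])
    qed
  next
    case (word w)
    then show ?case
    proof (induction w)
      case Nil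
      have "\<one>\<^bsub>Uq n\<^esub> \<in> carrier (Uq n)" by (simp add: U.cl_one U.cl_closed)
      then show ?case using h1(5) h2(5) by (simp add: single_Nil flip: U.cl_one)
    next
      case (Cons g w)
      let ?w = "cls (qn_gens n) (qn_rels n) (Poly_Mapping.single (Wd w) 1)"
      have w: "?w \<in> carrier (Uq n)" and g: "Ugen n g \<in> carrier (Uq n)"
        using Cons.prems Ugen_closed by (auto intro: U.cl_closed)
      show ?case
        using Cons h1(2)[OF g w] h2(2)[OF g w] gen[of g]
        by (simp add: U.word_Cons Ugen_def[symmetric])
    qed
  qed (simp_all add: h1 h2)
qed

section \<open>The action on monomials\<close>

lemma pairing_Xmon_one_Bar:
  assumes "\<And>j. j \<noteq> i \<Longrightarrow> a (Bar j) \<le> 1" "i \<in> {1..n}"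
  shows "pairing n f (Xmon n a) = bar_sq ^ (a (Bar i) div 2) * f (state_of n a)"
proof -
  have "bar_sq ^ (a (Bar j) div 2) = 1" if "j \<noteq> i" for j
    using assms(1)[OF that] by (auto simp: le_Suc_eq)
  then have "(\<Prod>j\<in>{1..n}. bar_sq ^ (a (Bar j) div 2)) = bar_sq ^ (a (Bar i) div 2)"
    using assms(2) prod.remove[of "{1..n}" i "\<lambda>j. bar_sq ^ (a (Bar j) div 2)"] by simp
  then show ?thesis by (simp add: pairing_Xmon)
qed

text \<open>On the right the exponent of \<open>Bar i\<close> may be 2. \<open>Xmon\<close> then
  evaluates a square in the algebra, and the factor in \<open>pairing_Xmon_one_Bar\<close> is the
  \<open>bar_sq\<close> that \<open>dual_chi\<close> produces.\<close>

lemma dual_chi_state_of: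
  assumes "a \<in> expos n" "i \<in> {1..n}"
  shows "dual_chi (Or i) f (state_of n a) = pairing n f (Xmon n (a(Or i := Suc (a (Or i)))))"
    "dual_chi (Bar i) f (state_of n a) = sgn_lt a i * pairing n f (Xmon n (a(Bar i := Suc (a (Bar i)))))"
proof -
  have "(state_of n a)(i := (int (a (Or i)) + 1, a (Bar i) = 1)) = state_of n (a(Or i := Suc (a (Or i))))"
    using assms by (auto simp: state_of_expos expos_upd_Or fun_eq_iff)
  then show "dual_chi (Or i) f (state_of n a) = pairing n f (Xmon n (a(Or i := Suc (a (Or i)))))"
    using assms by (simp add: pairing_Xmon_expos expos_upd_Or state_of_expos)
  have *: "pairing n f (Xmon n (a(Bar i := Suc (a (Bar i))))) =
      bar_sq ^ (Suc (a (Bar i)) div 2) * f (state_of n (a(Bar i := Suc (a (Bar i)))))"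
    using assms by (subst pairing_Xmon_one_Bar[of i]) (auto simp: expos_def)
  have "state_of n (a(Bar i := Suc (a (Bar i)))) =
     (state_of n a)(i := (int (a (Or i)) + 2 * int (Suc (a (Bar i)) div 2), odd (Suc (a (Bar i)))))"
    using assms by (auto simp: state_of_def fun_eq_iff)
  with * show "dual_chi (Bar i) f (state_of n a) = sgn_lt a i * pairing n f (Xmon n (a(Bar i := Suc (a (Bar i)))))"
    using Bar_cases[OF assms(1), of i] assms by (auto simp: sgn_lt_bar_sign state_of_expos)
qed

lemma move_dec: "p \<noteq> q \<Longrightarrow> (dec p a)(q := Suc (dec p a q)) = move p q a"
  by (simp add: dec_def move_def)

lemma sgn_lt_dec:
  "sgn_lt (dec (Or i) a) j = sgn_lt a j" "j \<le> i \<Longrightarrow> sgn_lt (dec (Bar i) a) j = sgn_lt a j"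
  unfolding sgn_lt_def dec_def by (intro arg_cong[of _ _ "(^) (- 1)"] sum.cong; simp)+

lemma sgn_lt_Suc: "1 \<le> i \<Longrightarrow> sgn_lt a (Suc i) = sgn_lt a i * (- 1) ^ a (Bar i)"
  by (simp add: sgn_lt_def atLeastLessThanSuc power_add mult.commute)

lemma sgn_le_Suc: "sgn_le a i = sgn_lt a (Suc i)"
  by (simp add: sgn_le_def sgn_lt_def atLeastLessThanSuc_atLeastAtMost)

text \<open>\<open>move\<close> lowers and raises at once, the composite one after the other; the
  sign of an odd multiplication is therefore that of the already lowered exponent vector.\<close>

lemma dual_pd_dual_chi_red:
  assumes "a \<in> expos n" "j \<in> {1..n}"
  shows "i \<noteq> j \<Longrightarrow> dual_pd (Or i) (dual_chi (Or j) f) (state_of n a) = qint (int (a (Or i))) * pairing n f (Xmon n (move (Or i) (Or j) a))"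
    "dual_pd (Bar i) (dual_chi (Or j) f) (state_of n a) = sgn_lt a i * (qint (int (a (Bar i))) * pairing n f (Xmon n (move (Bar i) (Or j) a)))"
    "dual_pd (Or i) (dual_chi (Bar j) f) (state_of n a) = qint (int (a (Or i))) * (sgn_lt a j * pairing n f (Xmon n (move (Or i) (Bar j) a)))"
    "i \<noteq> j \<Longrightarrow> dual_pd (Bar i) (dual_chi (Bar j) f) (state_of n a) =
       sgn_lt a i * (qint (int (a (Bar i))) * (sgn_lt (dec (Bar i) a) j * pairing n f (Xmon n (move (Bar i) (Bar j) a))))"
  using assms by (simp_all add: dual_pd_state_of dual_chi_state_of expos_dec move_dec sgn_lt_dec mult.assoc del: dual_chi.simps dual_pd.simps)

lemma sgn_lt_sq [simp]: "sgn_lt a i * sgn_lt a i = 1" "sgn_lt a i * (sgn_lt a i * c) = c"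
  by (simp_all add: sgn_lt_def flip: mult.assoc power_add mult_2)

lemma sign_state_of: "a \<in> expos n \<Longrightarrow> (if snd (state_of n a i) then - 1 else 1) = (- 1 :: qv) ^ a (Bar i)"
  using Bar_cases[of a n i] by (auto simp: state_of_expos)

lemma m1_sq [simp]: "(- 1 :: qv) ^ k * (- 1) ^ k = 1" "(- 1 :: qv) ^ k * ((- 1) ^ k * c) = c"
  by (simp_all flip: mult.assoc power_add mult_2)

lemma act_formulas_K:
  assumes a: "a \<in> expos n" and i: "i \<in> {1..n}"
  shows "rho n (Ugen n (KG i)) (Xmon n a) =
        \<upsilon> powi (int (a (Or i)) + int (a (Bar i))) \<odot>\<^bsub>Aq n\<^esub> Xmon n a" (is ?K)
   and "rho n (Ugen n (KbG i)) (Xmon n a) =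
        sgn_lt a i \<odot>\<^bsub>Aq n\<^esub>
          ((\<upsilon> powi (- int (a (Or i))) * qint (int (a (Bar i)))) \<odot>\<^bsub>Aq n\<^esub> Xmon n (move (Bar i) (Or i) a)
           \<oplus>\<^bsub>Aq n\<^esub>
           (\<upsilon> powi int (a (Bar i)) * qint (int (a (Or i)))) \<odot>\<^bsub>Aq n\<^esub> Xmon n (move (Or i) (Bar i) a))" (is ?Kb)
proof -
  have *: "KG i \<in> qn_gens n" "KbG i \<in> qn_gens n" using i by auto
  note [simp] = rho_Ugen pairing_op_of_dual_Xmon realizable_dual_U op_of_dual_spec(1) pairing_hom
  show ?K
    by (rule pairing_eqI[of _ n]) (use a i * in \<open>simp_all add: exponent_state_of pairing_Xmon_expos del: exponent.simps\<close>)
  show ?Kb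
    by (rule pairing_eqI[of _ n])
      (use a i * in \<open>simp_all add: exponent_state_of dual_pd_dual_chi_red algebra_simps del: exponent.simps dual_chi.simps dual_pd.simps\<close>)
qed

lemma act_formulas_EF:
  assumes a: "a \<in> expos n" and h: "h \<in> {1..<n}"
  shows
      "rho n (Ugen n (EG h)) (Xmon n a) =
        (\<upsilon> powi int (a (Bar (h + 1))) * qint (int (a (Or (h + 1)))))
          \<odot>\<^bsub>Aq n\<^esub> Xmon n (move (Or (h + 1)) (Or h) a)
        \<oplus>\<^bsub>Aq n\<^esub>
        (\<upsilon> powi (- int (a (Or (h + 1)))) * qint (int (a (Bar (h + 1)))))
          \<odot>\<^bsub>Aq n\<^esub> Xmon n (move (Bar (h + 1)) (Bar h) a)" (is ?E)
   and "rho n (Ugen n (FG h)) (Xmon n a) =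
        (\<upsilon> powi (- int (a (Bar h))) * qint (int (a (Or h))))
          \<odot>\<^bsub>Aq n\<^esub> Xmon n (move (Or h) (Or (h + 1)) a)
        \<oplus>\<^bsub>Aq n\<^esub>
        (\<upsilon> powi int (a (Or h)) * qint (int (a (Bar h))))
          \<odot>\<^bsub>Aq n\<^esub> Xmon n (move (Bar h) (Bar (h + 1)) a)" (is ?F)
   and "rho n (Ugen n (EbG h)) (Xmon n a) =
        sgn_le a h \<odot>\<^bsub>Aq n\<^esub>
          ((\<upsilon> powi int (a (Bar (h + 1))) * qint (int (a (Or (h + 1)))))
             \<odot>\<^bsub>Aq n\<^esub> Xmon n (move (Or (h + 1)) (Bar h) a)
           \<oplus>\<^bsub>Aq n\<^esub>
           (\<upsilon> powi (- int (a (Or (h + 1)))) * qint (int (a (Bar (h + 1)))))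
             \<odot>\<^bsub>Aq n\<^esub> Xmon n (move (Bar (h + 1)) (Or h) a))" (is ?Eb)
   and "rho n (Ugen n (FbG h)) (Xmon n a) =
        (sgn_le a h * \<upsilon> powi (- int (a (Bar h))) * qint (int (a (Or h))))
          \<odot>\<^bsub>Aq n\<^esub> Xmon n (move (Or h) (Bar (h + 1)) a)
        \<oplus>\<^bsub>Aq n\<^esub>
        (sgn_lt a h * \<upsilon> powi int (a (Or h)) * qint (int (a (Bar h))))
          \<odot>\<^bsub>Aq n\<^esub> Xmon n (move (Bar h) (Or (h + 1)) a)" (is ?Fb)
proof -
  have *: "EG h \<in> qn_gens n" "FG h \<in> qn_gens n" "EbG h \<in> qn_gens n" "FbG h \<in> qn_gens n" "1 \<le> h"
    using h by auto
  have d: "dec (Bar h) a (Bar h) = a (Bar h) - 1" by (simp add: dec_def)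
  note [simp] = rho_Ugen pairing_op_of_dual_Xmon realizable_dual_U op_of_dual_spec(1) pairing_hom
  note [simp del] = exponent.simps dual_chi.simps dual_pd.simps
  note [simp] = exponent_state_of dual_pd_dual_chi_red sign_state_of sgn_lt_Suc sgn_le_Suc sgn_lt_dec algebra_simps
  \<comment> \<open>The sign of the odd derivative at h + 1 exceeds that of the odd multiplication
    at h by \<open>(- 1) ^ a (Bar h)\<close>. The operator \<open>sbar n h\<close> contributes the
    same factor, and all signs cancel.\<close>
  show ?E by (rule pairing_eqI[of _ n]) (use a h * in simp_all)
  \<comment> \<open>The odd factor at h is removed before the one at h + 1 is multiplied on, so it
    no longer counts in the second sign. If it was absent, \<open>qint 0\<close> kills the
    term.\<close>
  show ?F by (rule pairing_eqI[of _ n]) (use Bar_cases[OF a, of h] a h * d in auto)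
  show ?Eb by (rule pairing_eqI[of _ n]) (use a h * in simp_all)
  show ?Fb by (rule pairing_eqI[of _ n]) (use a h * in simp_all)
qed

section \<open>Gradings\<close>

text \<open>The span of the monomials with exponents in S, put in terms of vanishing coordinates so
  that intersections and membership are read off coordinatewise; only the part of S inside
  \<open>expos n\<close> matters.\<close>

definition supported :: "nat \<Rightarrow> (idx \<Rightarrow> nat) set \<Rightarrow> idx falg set set" where
  "supported n S = {y \<in> carrier (Aq n). \<forall>a\<in>expos n - S. coord n a y = 0}"

lemma submodule_supported: "submodule (supported n S) QV (Aq n)"
  by (rule submodule_QV_I[OF Aq.module_axioms]) (auto simp: supported_def coord_hom)

lemma supported_UNIV: "supported n UNIV = carrier (Aq n)"
  by (auto simp: supported_def)

lemma supported_Int: "supported n S \<inter> supported n T = supported n (S \<inter> T)"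
  by (auto simp: supported_def)

lemma Xmon_supported: "a \<in> expos n \<Longrightarrow> a \<in> S \<Longrightarrow> Xmon n a \<in> supported n S"
  using inj_onD[OF inj_on_state_of[of n]] by (auto simp: supported_def coord_def pairing_Xmon_expos)

lemma lin_comb_mem:
  assumes N: "submodule N QV (Aq n)" and "finite S" "\<And>a. a \<in> S \<Longrightarrow> Xmon n a \<in> N"
  shows "lin_comb n c S \<in> N"
  using assms(2,3)
proof (induction S rule: finite_induct)
  case (insert a S)
  note N' = submodule_QV_D[OF Aq.module_axioms N]
  have "lin_comb n c (insert a S) = (c a \<odot>\<^bsub>Aq n\<^esub> Xmon n a) \<oplus>\<^bsub>Aq n\<^esub> lin_comb n c S"
    using insert by (simp add: lin_comb_def Pi_iff)
  then show ?case using insert N' by simp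
qed (use submodule_QV_D[OF Aq.module_axioms N] in \<open>simp add: lin_comb_def\<close>)

lemma lin_span_supported: "lin_span QV (Aq n) (Xmon n ` {a \<in> expos n. a \<in> S}) = supported n S"
proof
  show "lin_span QV (Aq n) (Xmon n ` {a \<in> expos n. a \<in> S}) \<subseteq> supported n S"
    by (rule lin_span_minimal[OF submodule_supported]) (auto intro: Xmon_supported)
  show "supported n S \<subseteq> lin_span QV (Aq n) (Xmon n ` {a \<in> expos n. a \<in> S})"
  proof
    fix y assume y: "y \<in> supported n S"
    then have yc: "y \<in> carrier (Aq n)" by (simp add: supported_def)
    have "lin_comb n (\<lambda>a. coord n a y) {a \<in> expos n. coord n a y \<noteq> 0} \<in> N"
      if "submodule N QV (Aq n)" "Xmon n ` {a \<in> expos n. a \<in> S} \<subseteq> N" for N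
      by (rule lin_comb_mem[OF that(1) coord_lincomb(1)[OF yc]]) (use y that(2) in \<open>auto simp: supported_def\<close>)
    then show "y \<in> lin_span QV (Aq n) (Xmon n ` {a \<in> expos n. a \<in> S})"
      using coord_lincomb(2)[OF yc] by (auto simp: lin_span_def)
  qed
qed

lemma coord_finsum:
  assumes "finite I" "f \<in> I \<rightarrow> carrier (Aq n)"
  shows "coord n a (\<Oplus>\<^bsub>Aq n\<^esub>i\<in>I. f i) = (\<Sum>i\<in>I. coord n a (f i))"
  using assms by (induction I rule: finite_induct) (auto simp: coord_hom Pi_iff)

text \<open>A partition of a basis gives a direct sum: \<kappa> names the block of an exponent
  vector, and each coordinate of a sum of components is seen by one component only.\<close>

lemma direct_sum_supported:
  assumes \<kappa>: "\<And>a. a \<in> expos n \<Longrightarrow> a \<in> S \<Longrightarrow> \<kappa> a \<in> J"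
    and V: "\<And>j. j \<in> J \<Longrightarrow> V j = supported n {a \<in> S. \<kappa> a = j}"
  shows "direct_sum QV (Aq n) (supported n S) J V"
  unfolding direct_sum_def
proof (intro conjI ballI)
  show "submodule (V j) QV (Aq n)" if "j \<in> J" for j
    using that V submodule_supported by simp
  let ?Z = "\<zero>\<^bsub>Aq n\<^esub>"
  let ?fam = "{f \<in> \<Pi>\<^sub>E j\<in>J. V j. finite {j \<in> J. f j \<noteq> ?Z}}"
  let ?sum = "\<lambda>f. \<Oplus>\<^bsub>Aq n\<^esub>j\<in>{j \<in> J. f j \<noteq> ?Z}. f j"
  have fam: "f j \<in> carrier (Aq n)" "a \<in> expos n \<Longrightarrow> \<not> (a \<in> S \<and> \<kappa> a = j) \<Longrightarrow> coord n a (f j) = 0"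
    if "f \<in> ?fam" "j \<in> J" for f j a
  proof -
    have "f j \<in> supported n {a \<in> S. \<kappa> a = j}"
      using that by (auto simp: V[OF that(2), symmetric])
    then show "f j \<in> carrier (Aq n)" "a \<in> expos n \<Longrightarrow> \<not> (a \<in> S \<and> \<kappa> a = j) \<Longrightarrow> coord n a (f j) = 0"
      by (auto simp: supported_def)
  qed
  have closed: "?sum f \<in> carrier (Aq n)" if "f \<in> ?fam" for f
    by (rule Aq.finsum_closed) (use fam[OF that] in auto)
  have coord_sum: "coord n a (?sum f) = (if a \<in> S then coord n a (f (\<kappa> a)) else 0)"
    if f: "f \<in> ?fam" and a: "a \<in> expos n" for f a
  proof -
    have fin: "finite {j \<in> J. f j \<noteq> ?Z}" using f by auto
    have "coord n a (?sum f) = (\<Sum>j\<in>{j \<in> J. f j \<noteq> ?Z}. coord n a (f j))"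
      by (rule coord_finsum[OF fin]) (use fam[OF f] in auto)
    also have "\<dots> = (\<Sum>j\<in>{j \<in> J. f j \<noteq> ?Z}. if j = \<kappa> a then (if a \<in> S then coord n a (f j) else 0) else 0)"
      by (rule sum.cong) (use fam(2)[OF f _ a] in auto)
    \<comment> \<open>If the component at \<open>\<kappa> a\<close> is zero, its index is absent
      from the summation set, and its coordinate is zero anyway.\<close>
    also have "\<dots> = (if a \<in> S then coord n a (f (\<kappa> a)) else 0)"
      using fin \<kappa>[OF a] by (auto simp: coord_hom)
    finally show ?thesis .
  qed
  show "bij_betw ?sum ?fam (supported n S)"
    unfolding bij_betw_def
  proof (intro conjI inj_onI equalityI subsetI)
    fix f g assume fg: "f \<in> ?fam" "g \<in> ?fam" and eq: "?sum f = ?sum g"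
    have "f j = g j" if j: "j \<in> J" for j
    proof (rule coord_eqI[of _ n])
      fix a assume a: "a \<in> expos n"
      show "coord n a (f j) = coord n a (g j)"
        using coord_sum[OF fg(1) a] coord_sum[OF fg(2) a] eq fam(2)[OF fg(1) j a] fam(2)[OF fg(2) j a]
        by (cases "a \<in> S \<and> \<kappa> a = j") auto
    qed (use fam(1)[OF fg(1) j] fam(1)[OF fg(2) j] in auto)
    then show "f = g" using fg by (intro PiE_ext[of f J V]) auto
  next
    fix y assume "y \<in> ?sum ` ?fam"
    then obtain f where f: "f \<in> ?fam" "y = ?sum f" by blast
    then show "y \<in> supported n S"
      using closed[OF f(1)] coord_sum[OF f(1)] unfolding supported_def by auto
  next
    fix y assume y: "y \<in> supported n S"
    then have yc: "y \<in> carrier (Aq n)" by (simp add: supported_def)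
    let ?c = "\<lambda>a. coord n a y"
    let ?P = "{a \<in> expos n. ?c a \<noteq> 0}"
    have fin: "finite ?P" by (rule coord_lincomb(1)[OF yc])
    define f where "f = (\<lambda>j\<in>J. lin_comb n ?c {a \<in> ?P. \<kappa> a = j})"
    have PS: "?P \<subseteq> S" using y by (auto simp: supported_def)
    have cof: "coord n a (f j) = (if \<kappa> a = j then ?c a else 0)" if "j \<in> J" "a \<in> expos n" for a j
    proof -
      have "finite {a \<in> ?P. \<kappa> a = j}" by (rule finite_subset[OF _ fin]) auto
      from coord_lin_comb[OF this, of n a ?c] that show ?thesis by (auto simp: f_def)
    qed
    have fV: "f j \<in> V j" if "j \<in> J" for j
      unfolding V[OF that] supported_def using cof[OF that] that PS y
      by (auto simp: f_def supported_def)
    \<comment> \<open>Only finitely many blocks meet the finite set of nonzero coordinates; any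
      other block receives the empty sum.\<close>
    have "{j \<in> J. f j \<noteq> ?Z} \<subseteq> \<kappa> ` ?P"
    proof
      fix j assume j: "j \<in> {j \<in> J. f j \<noteq> ?Z}"
      have "{a \<in> ?P. \<kappa> a = j} \<noteq> {}"
      proof
        assume e: "{a \<in> ?P. \<kappa> a = j} = {}"
        have "f j = lin_comb n ?c {a \<in> ?P. \<kappa> a = j}" using j by (simp add: f_def)
        then have "f j = ?Z" by (simp only: e lin_comb_def Aq.finsum_empty)
        then show False using j by simp
      qed
      then show "j \<in> \<kappa> ` ?P" by blast
    qed
    then have "finite {j \<in> J. f j \<noteq> ?Z}" using fin finite_surj by blast
    then have ffam: "f \<in> ?fam" using fV by (auto simp: f_def)
    moreover have "y = ?sum f"
    proof (rule coord_eqI[of _ n, OF yc closed[OF ffam]])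
      fix a assume a: "a \<in> expos n"
      show "coord n a y = coord n a (?sum f)"
        using coord_sum[OF ffam a] cof[OF \<kappa>[OF a] a] y a by (auto simp: supported_def)
    qed
    ultimately show "y \<in> ?sum ` ?fam" by blast
  qed
qed

section \<open>Invariance of graded pieces\<close>

definition vanish_on :: "(state \<Rightarrow> bool) \<Rightarrow> (state \<Rightarrow> qv) \<Rightarrow> bool" where
  "vanish_on Q f \<longleftrightarrow> (\<forall>s. Q s \<longrightarrow> f s = 0)"

text \<open>Turns invariance of a graded piece under \<open>rho\<close> into a statement about
  transposes. The expansion in monomials gives one direction; indicators of states outside Q give
  the other.\<close>

lemma supported_iff:
  "y \<in> supported n {a. Q (state_of n a)} \<longleftrightarrow> y \<in> carrier (Aq n) \<and> (\<forall>f. vanish_on Q f \<longrightarrow> pairing n f y = 0)"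
proof (intro iffI conjI allI impI)
  assume y: "y \<in> supported n {a. Q (state_of n a)}"
  then show yc: "y \<in> carrier (Aq n)" by (simp add: supported_def)
  fix f assume f: "vanish_on Q f"
  have "pairing n f y = (\<Sum>a\<in>{a \<in> expos n. coord n a y \<noteq> 0}. coord n a y * f (state_of n a))"
    by (rule trans[OF arg_cong[OF coord_lincomb(2)[OF yc], of "pairing n f"] pairing_lin_comb[OF coord_lincomb(1)[OF yc]]]) auto
  also have "\<dots> = 0"
    by (rule sum.neutral) (use y f in \<open>auto simp: supported_def vanish_on_def\<close>)
  finally show "pairing n f y = 0" .
next
  assume y: "y \<in> carrier (Aq n) \<and> (\<forall>f. vanish_on Q f \<longrightarrow> pairing n f y = 0)"
  have "vanish_on Q (\<lambda>s. of_bool (s = state_of n a))" if "\<not> Q (state_of n a)" for a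
    using that by (auto simp: vanish_on_def)
  with y show "y \<in> supported n {a. Q (state_of n a)}"
    by (auto simp: supported_def coord_def)
qed

definition parity :: "nat \<Rightarrow> state \<Rightarrow> bit" where
  "parity n s = (\<Sum>i\<in>{1..n}. if snd (s i) then 1 else 0)"

definition total_degree :: "nat \<Rightarrow> state \<Rightarrow> int" where
  "total_degree n s = (\<Sum>i\<in>{1..n}. exponent s (Or i) + exponent s (Bar i))"

text \<open>Written without subtraction, so that it serves the parity in \<open>bit\<close> as well
  as the degree in \<open>int\<close>.\<close>

lemma sum_upd:
  fixes g :: "'a \<Rightarrow> 'b::comm_monoid_add"
  assumes "finite I" "i \<in> I"
  shows "(\<Sum>j\<in>I. g ((s(i := p)) j)) + g (s i) = (\<Sum>j\<in>I. g (s j)) + g p"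
proof -
  have "(\<Sum>j\<in>I - {i}. g ((s(i := p)) j)) = (\<Sum>j\<in>I - {i}. g (s j))"
    by (rule sum.cong) auto
  then show ?thesis
    using assms by (simp only: sum.remove[OF assms]) (simp add: ac_simps)
qed

lemma bit_cancel [simp]: "(x :: bit) + y + y = x" "(x :: bit) + (x + y) = y"
  by (cases x; cases y; simp)+

lemma parity_upd:
  "i \<in> {1..n} \<Longrightarrow> parity n (s(i := p)) =
    parity n s + (if snd p then 1 else 0) + (if snd (s i) then 1 else 0)"
  using sum_upd[of "{1..n}" i "\<lambda>x. if snd x then 1 else (0::bit)" s p] unfolding parity_def
  by (metis bit_cancel(1) finite_atLeastAtMost)

lemma total_upd: "i \<in> {1..n} \<Longrightarrow>
  total_degree n (s(i := p)) = total_degree n s + (fst p + of_bool (snd p)) - (fst (s i) + of_bool (snd (s i)))"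
  using sum_upd[of "{1..n}" i "\<lambda>x. fst x + of_bool (snd x)" s p] unfolding total_degree_def exponent.simps
  by (simp del: fun_upd_apply)

primrec idx_par :: "idx \<Rightarrow> bit" where
  "idx_par (Or i) = 0"
| "idx_par (Bar i) = 1"

text \<open>Merging two odd factors clears the flag, so multiplication by \<open>Bar i\<close>
  changes the parity in every case; in \<open>bit\<close> adding and removing an odd factor have the
  same effect.\<close>

lemma vanish_parity:
  assumes "p \<in> idxs n"
  shows "vanish_on (\<lambda>s. parity n s = idx_par p + q) f \<Longrightarrow> vanish_on (\<lambda>s. parity n s = q) (dual_chi p f)"
    "vanish_on (\<lambda>s. parity n s = idx_par p + q) f \<Longrightarrow> vanish_on (\<lambda>s. parity n s = q) (dual_pd p f)"
  using assms by (cases p; auto simp: vanish_on_def parity_upd add.commute[of 1])+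

text \<open>The square relation is homogeneous: a second odd factor turns both into exponent 2 of
  the even generator, and the degree still grows by one.\<close>

lemma vanish_total:
  assumes "i \<in> {1..n}"
  shows "vanish_on (\<lambda>s. total_degree n s = r) f \<Longrightarrow> vanish_on (\<lambda>s. total_degree n s = r - 1) (dual_chi (Or i) f)"
    "vanish_on (\<lambda>s. total_degree n s = r) f \<Longrightarrow> vanish_on (\<lambda>s. total_degree n s = r - 1) (dual_chi (Bar i) f)"
    "vanish_on (\<lambda>s. total_degree n s = r - 1) f \<Longrightarrow> vanish_on (\<lambda>s. total_degree n s = r) (dual_pd (Or i) f)"
    "vanish_on (\<lambda>s. total_degree n s = r - 1) f \<Longrightarrow> vanish_on (\<lambda>s. total_degree n s = r) (dual_pd (Bar i) f)"
  using assms by (auto simp: vanish_on_def total_upd)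

lemma dual_U_vanish_parity:
  assumes "g \<in> qn_gens n" "vanish_on (\<lambda>s. parity n s = qn_par g + q) f"
  shows "vanish_on (\<lambda>s. parity n s = q) (dual_U g f)"
proof -
  have "vanish_on (\<lambda>s. parity n s = q) (dual_pd p (dual_chi r f))"
    if "p \<in> idxs n" "r \<in> idxs n" "idx_par r + idx_par p = qn_par g" for p r
    by (rule vanish_parity(2)[OF that(1)], rule vanish_parity(1)[OF that(2)])
      (use assms(2) that(3) in \<open>simp only: add.assoc[symmetric]\<close>)
  note * = this[unfolded vanish_on_def, rule_format]
  show ?thesis
    using assms by (cases g) (auto simp: vanish_on_def * simp del: dual_chi.simps dual_pd.simps)
qed

lemma dual_U_vanish_total:
  assumes "g \<in> qn_gens n" "vanish_on (\<lambda>s. total_degree n s = r) f"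
  shows "vanish_on (\<lambda>s. total_degree n s = r) (dual_U g f)"
proof -
  have "vanish_on (\<lambda>s. total_degree n s = r) (dual_pd p (dual_chi q f))" if "p \<in> idxs n" "q \<in> idxs n" for p q
    using that vanish_total assms(2) by (cases p; cases q) (auto simp del: dual_chi.simps dual_pd.simps)
  note * = this[unfolded vanish_on_def, rule_format]
  show ?thesis
    using assms by (cases g) (auto simp: vanish_on_def * simp del: dual_chi.simps dual_pd.simps)
qed

lemma fold_dual_U_vanish_parity:
  assumes "set w \<subseteq> qn_gens n" "vanish_on (\<lambda>s. parity n s = sum_list (map qn_par w) + q) f"
  shows "vanish_on (\<lambda>s. parity n s = q) (fold dual_U w f)"
  using assms
proof (induction w arbitrary: f)
  case (Cons g w)
  then show ?case
    using dual_U_vanish_parity[of g n "sum_list (map qn_par w) + q" f]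
    by (simp only: list.map sum_list.Cons add.assoc fold_simps list.set insert_subset simp_thms)
next
  case Nil
  then show ?case by (simp only: list.map sum_list.Nil add_0 fold_simps)
qed

lemma cev_word: "set w \<subseteq> qn_gens n \<Longrightarrow>
  U.cev (cls (qn_gens n) (qn_rels n) (Poly_Mapping.single (Wd w) 1)) = fold dual_U w"
  by (intro ext) (simp add: U.cev_cl fev_single)

lemma cev_vanish_parity:
  assumes "u \<in> Uq_part n p" "vanish_on (\<lambda>s. parity n s = p + q) f"
  shows "u \<in> carrier (Uq n)" "vanish_on (\<lambda>s. parity n s = q) (U.cev u f)"
proof -
  \<comment> \<open>Quantified over all q and f, the conclusion cuts out a submodule, so it has to
    be checked only on the words that span \<open>Uq_part n p\<close>.\<close>
  let ?N = "{u \<in> carrier (Uq n). \<forall>q f. vanish_on (\<lambda>s. parity n s = p + q) f \<longrightarrow> vanish_on (\<lambda>s. parity n s = q) (U.cev u f)}"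
  interpret Um: module QV "Uq n" by (rule U.module_A)
  have "submodule ?N QV (Uq n)"
    by (rule submodule_QV_I[OF U.module_A]) (auto simp: vanish_on_def U.cev_hom)
  then have "Uq_part n p \<subseteq> ?N"
    unfolding Uq_part_def presented_part_def Uq_def[symmetric]
    by (rule lin_span_minimal) (auto simp: cev_word U.cl_closed simp del: U.cev_cl intro!: fold_dual_U_vanish_parity)
  then show "u \<in> carrier (Uq n)" "vanish_on (\<lambda>s. parity n s = q) (U.cev u f)"
    using assms by auto
qed

lemma cev_vanish_total:
  assumes "u \<in> carrier (Uq n)" "vanish_on (\<lambda>s. total_degree n s = r) f"
  shows "vanish_on (\<lambda>s. total_degree n s = r) (U.cev u f)"
  using assms(1)
proof (induction u rule: U.carrier_induct)
  case (word w)
  then have "vanish_on (\<lambda>s. total_degree n s = r) (fold dual_U w f)"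
    using assms(2)
    by (induction w arbitrary: f) (auto intro: dual_U_vanish_total)
  then show ?case using word by (simp add: cev_word del: U.cev_cl)
qed (auto simp: vanish_on_def U.cev_hom)

lemma parity_state_of: "a \<in> expos n \<Longrightarrow> of_nat (\<Sum>i=1..n. a (Bar i)) = parity n (state_of n a)"
proof -
  assume a: "a \<in> expos n"
  have "of_nat (a (Bar i)) = (if snd (state_of n a i) then 1 else (0::bit))" for i
    using Bar_cases[OF a, of i] a by (auto simp: state_of_expos)
  then show ?thesis by (simp add: parity_def)
qed

lemma total_state_of: "a \<in> expos n \<Longrightarrow> int (\<Sum>i=1..n. a (Or i) + a (Bar i)) = total_degree n (state_of n a)"
  by (simp add: total_degree_def exponent_state_of del: exponent.simps)

lemma Aq_part_supported: "Aq_part n p = supported n {a. parity n (state_of n a) = p}"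
proof -
  have "{a \<in> expos n. of_nat (\<Sum>i=1..n. a (Bar i)) = p} = {a \<in> expos n. a \<in> {a. parity n (state_of n a) = p}}"
    using parity_state_of by auto
  then show ?thesis
    unfolding Aq_part_def by (simp only: lin_span_supported)
qed

lemma Aq_hom_supported: "Aq_hom n r = supported n {a. total_degree n (state_of n a) = int r}"
proof -
  have "{a \<in> expos n. (\<Sum>i=1..n. a (Or i) + a (Bar i)) = r} = {a \<in> expos n. a \<in> {a. total_degree n (state_of n a) = int r}}"
    using total_state_of[of _ n] by (auto simp del: of_nat_sum simp flip: total_state_of)
  then show ?thesis
    unfolding Aq_hom_def by (simp only: lin_span_supported)
qed

section \<open>Weight spaces and the final structure\<close>

text \<open>Each coordinate is scaled by a power of \<upsilon>, and distinct exponents give distinct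
  powers, so the eigenvalue equations force all coordinates of other weights to vanish.\<close>

lemma weight_space_supported:
  assumes \<mu>: "\<mu> \<in> {1..n} \<rightarrow>\<^sub>E (UNIV :: int set)"
  shows "weight_space n (Aq n) (rho n) \<mu> = supported n {a. (\<lambda>i\<in>{1..n}. exponent (state_of n a) (Or i) + exponent (state_of n a) (Bar i)) = \<mu>}"
proof -
  let ?k = "\<lambda>a i. exponent (state_of n a) (Or i) + exponent (state_of n a) (Bar i)"
  have coord: "coord n a (rho n (Ugen n (KG i)) y) = \<upsilon> powi (?k a i) * coord n a y"
    if "i \<in> {1..n}" "y \<in> carrier (Aq n)" for a i y
  proof -
    \<comment> \<open>The indicator of a state is an eigenvector of the transpose of
      \<open>KG i\<close>.\<close>
    have "dual_U (KG i) (\<lambda>s. of_bool (s = state_of n a)) = (\<lambda>s. \<upsilon> powi (?k a i) * of_bool (s = state_of n a))"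
      by (intro ext) auto
    then show ?thesis
      using that by (simp add: coord_def rho_Ugen op_of_dual_spec realizable_dual_U pairing_linD del: dual_U.simps exponent.simps)
  qed
  have closed: "rho n (Ugen n (KG i)) y \<in> carrier (Aq n)" if "i \<in> {1..n}" "y \<in> carrier (Aq n)" for i y
    using that by (simp add: rho_Ugen op_of_dual_spec realizable_dual_U)
  have eig: "rho n (Ugen n (KG i)) y = \<upsilon> powi \<mu> i \<odot>\<^bsub>Aq n\<^esub> y \<longleftrightarrow> (\<forall>a\<in>expos n. coord n a y = 0 \<or> ?k a i = \<mu> i)"
    if "i \<in> {1..n}" "y \<in> carrier (Aq n)" for i y
  proof -
    have "rho n (Ugen n (KG i)) y = \<upsilon> powi \<mu> i \<odot>\<^bsub>Aq n\<^esub> y \<longleftrightarrow>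
      (\<forall>a\<in>expos n. coord n a (rho n (Ugen n (KG i)) y) = coord n a (\<upsilon> powi \<mu> i \<odot>\<^bsub>Aq n\<^esub> y))"
      using that closed coord_eqI[of "rho n (Ugen n (KG i)) y" n "\<upsilon> powi \<mu> i \<odot>\<^bsub>Aq n\<^esub> y"] by auto
    then show ?thesis
      using that by (simp add: coord coord_hom ups_powi_eq_iff disj_commute del: exponent.simps)
  qed
  \<comment> \<open>\<mu> is \<open>undefined\<close> outside \<open>{1..n}\<close>, which the
    restricted weight of a monomial matches.\<close>
  have restr: "(\<lambda>i\<in>{1..n}. ?k a i) = \<mu> \<longleftrightarrow> (\<forall>i\<in>{1..n}. ?k a i = \<mu> i)" for a
    using \<mu> by (auto simp: fun_eq_iff PiE_def extensional_def simp del: exponent.simps)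
  show ?thesis
    unfolding weight_space_def supported_def
  proof (rule Collect_cong, rule conj_cong[OF refl])
    fix y assume y: "y \<in> carrier (Aq n)"
    have "(\<forall>i\<in>{1..n}. rho n (Ugen n (KG i)) y = \<upsilon> powi \<mu> i \<odot>\<^bsub>Aq n\<^esub> y) \<longleftrightarrow>
        (\<forall>i\<in>{1..n}. \<forall>a\<in>expos n. coord n a y = 0 \<or> ?k a i = \<mu> i)"
      by (rule ball_cong[OF refl]) (rule eig[OF _ y])
    also have "\<dots> \<longleftrightarrow> (\<forall>a\<in>expos n - {a. (\<lambda>i\<in>{1..n}. ?k a i) = \<mu>}. coord n a y = 0)"
      unfolding restr by blast
    finally show "(\<forall>i\<in>{1..n}. rho n (Ugen n (KG i)) y = \<upsilon> powi \<mu> i \<odot>\<^bsub>Aq n\<^esub> y) \<longleftrightarrow>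
      (\<forall>a\<in>expos n - {a. (\<lambda>i\<in>{1..n}. ?k a i) = \<mu>}. coord n a y = 0)" .
  qed
qed

lemma rho_alg_module: "alg_module QV (Uq n) (Aq n) (rho n)"
  by (simp add: alg_module_def rho_hom Aq.module_axioms)

lemma rho_supported:
  assumes "u \<in> carrier (Uq n)" "y \<in> supported n {a. Q (state_of n a)}"
    and "\<And>f. vanish_on Q' f \<Longrightarrow> vanish_on Q (U.cev u f)"
  shows "rho n u y \<in> supported n {a. Q' (state_of n a)}"
  using assms by (auto simp: supported_iff pairing_rho intro: End_closed rho_End)

lemma weight_supermodule_Aq: "weight_supermodule n (Aq n) (Aq_part n) (rho n)"
proof -
  have U: "carrier (Aq n) = supported n UNIV" by (simp add: supported_UNIV)
  have "direct_sum QV (Aq n) (carrier (Aq n)) UNIV (Aq_part n)"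
    unfolding U by (rule direct_sum_supported[where \<kappa> = "\<lambda>a. parity n (state_of n a)"]) (simp_all add: Aq_part_supported)
  moreover have "direct_sum QV (Aq n) (carrier (Aq n)) ({1..n} \<rightarrow>\<^sub>E UNIV) (weight_space n (Aq n) (rho n))"
    unfolding U
    by (rule direct_sum_supported[where \<kappa> = "\<lambda>a. (\<lambda>i\<in>{1..n}. exponent (state_of n a) (Or i) + exponent (state_of n a) (Bar i))"])
      (simp_all add: weight_space_supported del: exponent.simps)
  moreover have "rho n u m \<in> Aq_part n (p + q)" if "u \<in> Uq_part n p" "m \<in> Aq_part n q" for p q u m
  proof -
    \<comment> \<open>The membership part of \<open>cev_vanish_parity\<close> asks for some
      functional vanishing on a parity class; the zero functional serves.\<close>
    have "u \<in> carrier (Uq n)"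
      using cev_vanish_parity(1)[OF that(1), of 0 "\<lambda>_. 0"] by (simp add: vanish_on_def)
    from rho_supported[OF this, of m "\<lambda>s. parity n s = q" "\<lambda>s. parity n s = p + q"]
    show ?thesis
      using that cev_vanish_parity(2)[OF that(1)] by (simp add: Aq_part_supported)
  qed
  ultimately show ?thesis
    by (simp add: weight_supermodule_def supermodule_def rho_alg_module)
qed

lemma subsupermodule_Aq_hom: "subsupermodule QV (Uq n) (Aq n) (Aq_part n) (rho n) (Aq_hom n r)"
proof -
  let ?S = "{a. total_degree n (state_of n a) = int r}"
  have "rho n u m \<in> Aq_hom n r" if "u \<in> carrier (Uq n)" "m \<in> Aq_hom n r" for u m
    using rho_supported[OF that(1), of m "\<lambda>s. total_degree n s = int r" "\<lambda>s. total_degree n s = int r"] that cev_vanish_total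
    by (simp add: Aq_hom_supported)
  moreover have "direct_sum QV (Aq n) (Aq_hom n r) UNIV (\<lambda>p. Aq_hom n r \<inter> Aq_part n p)"
    unfolding Aq_hom_supported
    by (rule direct_sum_supported[where \<kappa> = "\<lambda>a. parity n (state_of n a)"])
      (auto simp: Aq_part_supported supported_Int intro!: arg_cong[of _ _ "supported n"])
  ultimately show ?thesis
    by (simp add: subsupermodule_def Aq_hom_supported submodule_supported)
qed

theorem theorem5p4:
  fixes n :: nat
  assumes "n \<ge> 2"
  shows "\<exists>\<rho>.
    extends_assignment n \<rho> \<and>
    (\<forall>\<rho>'. extends_assignment n \<rho>' \<longrightarrow> (\<forall>u\<in>carrier (Uq n). \<rho>' u = \<rho> u)) \<and>
    alg_module QV (Uq n) (Aq n) \<rho> \<and>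
    (\<forall>a\<in>expos n. \<forall>i\<in>{1..n}.
      \<rho> (Ugen n (KG i)) (Xmon n a) =
        \<upsilon> powi (int (a (Or i)) + int (a (Bar i))) \<odot>\<^bsub>Aq n\<^esub> Xmon n a \<and>
      \<rho> (Ugen n (KbG i)) (Xmon n a) =
        sgn_lt a i \<odot>\<^bsub>Aq n\<^esub>
          ((\<upsilon> powi (- int (a (Or i))) * qint (int (a (Bar i)))) \<odot>\<^bsub>Aq n\<^esub> Xmon n (move (Bar i) (Or i) a)
           \<oplus>\<^bsub>Aq n\<^esub>
           (\<upsilon> powi int (a (Bar i)) * qint (int (a (Or i)))) \<odot>\<^bsub>Aq n\<^esub> Xmon n (move (Or i) (Bar i) a))) \<and>
    (\<forall>a\<in>expos n. \<forall>h\<in>{1..<n}.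
      \<rho> (Ugen n (EG h)) (Xmon n a) =
        (\<upsilon> powi int (a (Bar (h + 1))) * qint (int (a (Or (h + 1)))))
          \<odot>\<^bsub>Aq n\<^esub> Xmon n (move (Or (h + 1)) (Or h) a)
        \<oplus>\<^bsub>Aq n\<^esub>
        (\<upsilon> powi (- int (a (Or (h + 1)))) * qint (int (a (Bar (h + 1)))))
          \<odot>\<^bsub>Aq n\<^esub> Xmon n (move (Bar (h + 1)) (Bar h) a) \<and>
      \<rho> (Ugen n (FG h)) (Xmon n a) =
        (\<upsilon> powi (- int (a (Bar h))) * qint (int (a (Or h))))
          \<odot>\<^bsub>Aq n\<^esub> Xmon n (move (Or h) (Or (h + 1)) a)
        \<oplus>\<^bsub>Aq n\<^esub>
        (\<upsilon> powi int (a (Or h)) * qint (int (a (Bar h))))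
          \<odot>\<^bsub>Aq n\<^esub> Xmon n (move (Bar h) (Bar (h + 1)) a) \<and>
      \<rho> (Ugen n (EbG h)) (Xmon n a) =
        sgn_le a h \<odot>\<^bsub>Aq n\<^esub>
          ((\<upsilon> powi int (a (Bar (h + 1))) * qint (int (a (Or (h + 1)))))
             \<odot>\<^bsub>Aq n\<^esub> Xmon n (move (Or (h + 1)) (Bar h) a)
           \<oplus>\<^bsub>Aq n\<^esub>
           (\<upsilon> powi (- int (a (Or (h + 1)))) * qint (int (a (Bar (h + 1)))))
             \<odot>\<^bsub>Aq n\<^esub> Xmon n (move (Bar (h + 1)) (Or h) a)) \<and>
      \<rho> (Ugen n (FbG h)) (Xmon n a) =
        (sgn_le a h * \<upsilon> powi (- int (a (Bar h))) * qint (int (a (Or h))))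
          \<odot>\<^bsub>Aq n\<^esub> Xmon n (move (Or h) (Bar (h + 1)) a)
        \<oplus>\<^bsub>Aq n\<^esub>
        (sgn_lt a h * \<upsilon> powi int (a (Or h)) * qint (int (a (Bar h))))
          \<odot>\<^bsub>Aq n\<^esub> Xmon n (move (Bar h) (Or (h + 1)) a)) \<and>
    weight_supermodule n (Aq n) (Aq_part n) \<rho> \<and>
    (\<forall>r. subsupermodule QV (Uq n) (Aq n) (Aq_part n) \<rho> (Aq_hom n r))"
proof (intro exI[of _ "rho n"] conjI allI impI ballI)
  show "extends_assignment n (rho n)" by (rule rho_extends)
  show "alg_module QV (Uq n) (Aq n) (rho n)" by (rule rho_alg_module)
  show "weight_supermodule n (Aq n) (Aq_part n) (rho n)" by (rule weight_supermodule_Aq)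
qed (use rho_unique act_formulas_K act_formulas_EF subsupermodule_Aq_hom in \<open>simp_all only:\<close>)

end
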